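(* Let $(A,\mathfrak a)$ be a unital good pair over $\Bbbk$, and let $n\ge 1$, $d\ge 0$ be integers. Then $T^A_{\mathfrak a}(n,d)\subseteq S^A(n,d)$ is a unital subalgebra.
   Context: $\Bbbk$ is a commutative domain of characteristic $0$. Superalgebras are $\mathbb Z/2$-graded associative (not necessarily unital) $\Bbbk$-algebras $A=A_{\bar 0}\oplus A_{\bar 1}$; $\bar a$ denotes the parity of a homogeneous element $a$; tensor products of superalgebras carry the product $(x\otimes y)(z\otimes w)=(-1)^{\bar y\bar z}xz\otimes yw$. A good pair $(A,\mathfrak a)$ consists of a superalgebra $A$ with $A_{\bar 0},A_{\bar 1}$ free over $\Bbbk$ and a subalgebra $\mathfrak a\subseteq A_{\bar 0}$ such that $\mathfrak a$ and $A/\mathfrak a$ are free $\Bbbk$-modules; it is a unital good pair if $A$ and $\mathfrak a$ are unital with $1_{\mathfrak a}=1_A$. An $(A,\mathfrak a)$-basis is a $\Bbbk$-basis $B=B_{\mathfrak a}\sqcup B_{\mathfrak c}\sqcup B_{\bar 1}$ of $A$, where $B_{\mathfrak a}$, $B_{\mathfrak c}$, $B_{\bar 1}$ are bases of $\mathfrak a$, of a chosen $\Bbbk$-module complement $\mathfrak c$ of $\mathfrak a$ in $A_{\bar 0}$, and of $A_{\bar 1}$, respectively; one such basis is fixed. For $a\in A$ put $\xi^a_{r,s}:=aE_{r,s}\in M_n(A)$ ($E_{r,s}$ the matrix units; $M_n(A)$ is a superalgebra via parities of entries). Write $[1,n]=\{1,\dots,n\}$. The symmetric group $\mathfrak S_d$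 acts on the right on words by $(x_1\cdots x_d)\sigma=x_{\sigma 1}\cdots x_{\sigma d}$, diagonally on tuples of words, and on $M_n(A)^{\otimes d}$ by superalgebra automorphisms $(\xi^{a_1}_{r_1,s_1}\otimes\cdots\otimes\xi^{a_d}_{r_d,s_d})^\sigma=(-1)^{\langle\sigma;\boldsymbol a\rangle}\xi^{a_{\sigma1}}_{r_{\sigma1},s_{\sigma1}}\otimes\cdots\otimes\xi^{a_{\sigma d}}_{r_{\sigma d},s_{\sigma d}}$ for homogeneous $a_i$, where $\langle\sigma;\boldsymbol a\rangle=\#\{(k,l): k<l,\ \sigma^{-1}k>\sigma^{-1}l,\ a_k,a_l \text{ odd}\}$. Define $S^A(n,d):=(M_n(A)^{\otimes d})^{\mathfrak S_d}$. $\mathrm{Tri}^B(n,d)$ is the set of triples $(\boldsymbol b,\boldsymbol r,\boldsymbol s)\in B^d\times[1,n]^d\times[1,n]^d$ such that for $k\ne l$ the equality $(b_k,r_k,s_k)=(b_l,r_l,s_l)$ holds only if $b_k$ is even. For such a triple let $\xi^{\boldsymbol b}_{\boldsymbol r,\boldsymbol s}:=\sum_\sigma(\xi^{b_1}_{r_1,s_1}\otimes\cdots\otimes\xi^{b_d}_{r_d,s_d})^\sigma\in S^A(n,d)$, with $\sigma$ over representatives of the cosets $\mathfrak S_{\boldsymbol b,\boldsymbol r,\boldsymbol s}\backslash\mathfrak S_d$, where $\mathfrak S_{\boldsymbol b,\boldsymbol r,\boldsymbol s}$ is the stabilizer of the triple. Let $[\boldsymbol b,\boldsymbol r,\boldsymbol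 s]^b_{r,s}:=\#\{k: (b_k,r_k,s_k)=(b,r,s)\}$, $[\boldsymbol b,\boldsymbol r,\boldsymbol s]^!_{\mathfrak c}:=\prod_{b\in B_{\mathfrak c},\,r,s\in[1,n]}[\boldsymbol b,\boldsymbol r,\boldsymbol s]^b_{r,s}!$, and $\eta^{\boldsymbol b}_{\boldsymbol r,\boldsymbol s}:=[\boldsymbol b,\boldsymbol r,\boldsymbol s]^!_{\mathfrak c}\,\xi^{\boldsymbol b}_{\boldsymbol r,\boldsymbol s}$. Finally $T^A_{\mathfrak a}(n,d)$ is the $\Bbbk$-span of all $\eta^{\boldsymbol b}_{\boldsymbol r,\boldsymbol s}$ with $(\boldsymbol b,\boldsymbol r,\boldsymbol s)\in\mathrm{Tri}^B(n,d)$. *)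

theory Defs
  imports
    "HOL-Library.Poly_Mapping"
    "HOL-Combinatorics.Permutations"
    "HOL-Algebra.Subrings"
    "Jordan_Normal_Form.Matrix"
begin

locale superalgebra = Modules.module scale
  for scale :: "'k::{idom,ring_char_0} \<Rightarrow> 'a::ring \<Rightarrow> 'a" +
  fixes A0 A1 :: "'a set"
  assumes scale_mult_left: "scale c (x * y) = scale c x * y"
    and scale_mult_right: "scale c (x * y) = x * scale c y"
    and subspace_A0: "subspace A0"
    and subspace_A1: "subspace A1"
    and A0_Int_A1: "A0 \<inter> A1 = {0}"
    and A0_plus_A1: "\<exists>y\<in>A0. \<exists>z\<in>A1. x = y + z"
    and mult_00: "x \<in> A0 \<Longrightarrow> y \<in> A0 \<Longrightarrow> x * y \<in> A0"
    and mult_01: "x \<in> A0 \<Longrightarrow> y \<in> A1 \<Longrightarrow> x * y \<in> A1"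
    and mult_10: "x \<in> A1 \<Longrightarrow> y \<in> A0 \<Longrightarrow> x * y \<in> A1"
    and mult_11: "x \<in> A1 \<Longrightarrow> y \<in> A1 \<Longrightarrow> x * y \<in> A0"
begin

definition is_basis :: "'a set \<Rightarrow> 'a set \<Rightarrow> bool" where
  "is_basis B V \<longleftrightarrow> independent B \<and> span B = V"

definition free_submodule :: "'a set \<Rightarrow> bool" where
  "free_submodule V \<longleftrightarrow> (\<exists>B. is_basis B V)"

text \<open>The quotient of the whole module by \<open>N\<close> is free: the set \<open>C\<close> consists of one representative
  of each member of a basis of the quotient, i.e. the cosets of the elements of \<open>C\<close> generate the
  quotient and are linearly independent in it.\<close>

definition free_quotient :: "'a set \<Rightarrow> bool" where
  "free_quotient N \<longleftrightarrow> (\<exists>C. (\<forall>x. \<exists>y\<in>span C. x - y \<in> N) \<and>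
     (\<forall>t u. finite t \<and> t \<subseteq> C \<and> (\<Sum>v\<in>t. scale (u v) v) \<in> N \<longrightarrow> (\<forall>v\<in>t. u v = 0)))"

end

locale good_pair = superalgebra scale A0 A1
  for scale :: "'k::{idom,ring_char_0} \<Rightarrow> 'a::ring \<Rightarrow> 'a"
    and A0 A1 :: "'a set" +
  fixes \<aa> :: "'a set"
  assumes free_A0: "free_submodule A0"
    and free_A1: "free_submodule A1"
    and subspace_\<aa>: "subspace \<aa>"
    and \<aa>_subset_A0: "\<aa> \<subseteq> A0"
    and mult_\<aa>: "x \<in> \<aa> \<Longrightarrow> y \<in> \<aa> \<Longrightarrow> x * y \<in> \<aa>"
    and free_\<aa>: "free_submodule \<aa>"
    and free_quotient_\<aa>: "free_quotient \<aa>"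

text \<open>The unit is an explicit element \<open>e\<close> rather than the constant of class \<open>ring_1\<close>, so that the
  zero algebra is not excluded.\<close>

locale unital_good_pair = good_pair scale A0 A1 \<aa>
  for scale :: "'k::{idom,ring_char_0} \<Rightarrow> 'a::ring \<Rightarrow> 'a"
    and A0 A1 \<aa> :: "'a set" +
  fixes e :: 'a
  assumes unit_left: "e * x = x"
    and unit_right: "x * e = x"
    and unit_in_\<aa>: "e \<in> \<aa>"

text \<open>Linear independence and disjointness of the whole family, and that it spans the algebra, follow
  from the direct sum decompositions.\<close>

locale good_pair_basis = good_pair scale A0 A1 \<aa>
  for scale :: "'k::{idom,ring_char_0} \<Rightarrow> 'a::ring \<Rightarrow> 'a"
    and A0 A1 \<aa> :: "'a set" +
  fixes \<cc> B\<^sub>\<aa> B\<^sub>\<cc> B\<^sub>1 :: "'a set"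
  assumes subspace_\<cc>: "subspace \<cc>"
    and \<aa>_Int_\<cc>: "\<aa> \<inter> \<cc> = {0}"
    and \<aa>_plus_\<cc>: "A0 = {x + y | x y. x \<in> \<aa> \<and> y \<in> \<cc>}"
    and basis_\<aa>: "is_basis B\<^sub>\<aa> \<aa>"
    and basis_\<cc>: "is_basis B\<^sub>\<cc> \<cc>"
    and basis_A1: "is_basis B\<^sub>1 A1"

text \<open>Finitely supported functions on words, as the free module on the set of words.\<close>

definition fscale :: "'k::comm_ring_1 \<Rightarrow> ('w \<Rightarrow>\<^sub>0 'k) \<Rightarrow> ('w \<Rightarrow>\<^sub>0 'k)" where
  "fscale c x = Poly_Mapping.map ((*) c) x"

definition linear_extension ::
    "('v \<Rightarrow> ('w \<Rightarrow>\<^sub>0 'k)) \<Rightarrow> ('v \<Rightarrow>\<^sub>0 'k) \<Rightarrow> ('w \<Rightarrow>\<^sub>0 'k::comm_ring_1)" where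
  "linear_extension f x = (\<Sum>v\<in>Poly_Mapping.keys x. fscale (Poly_Mapping.lookup x v) (f v))"

text \<open>The span of a set \<open>G\<close> of elements of a carrier-based module \<open>M\<close>.\<close>

definition mspan :: "('k, 'w, 'z) module_scheme \<Rightarrow> 'w set \<Rightarrow> 'w set" where
  "mspan M G = {(\<Oplus>\<^bsub>M\<^esub>x\<in>F. c x \<odot>\<^bsub>M\<^esub> x) | F c. finite F \<and> F \<subseteq> G}"

text \<open>The ring of scalars is a whole type, so every scalar acts. Membership of the unit of \<open>M\<close>
  in \<open>T\<close> is part of \<open>subring\<close>, and so is \<open>T \<subseteq> carrier M\<close>.\<close>

definition unital_subalgebra :: "'w set \<Rightarrow> ('k, 'w, 'z) module_scheme \<Rightarrow> bool" where
  "unital_subalgebra T M \<longleftrightarrow> subring T M \<and> (\<forall>c. \<forall>x\<in>T. c \<odot>\<^bsub>M\<^esub> x \<in> T)"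

context superalgebra
begin

definition even_part :: "'a \<Rightarrow> 'a" where
  "even_part x = (THE y. y \<in> A0 \<and> x - y \<in> A1)"

definition odd_part :: "'a \<Rightarrow> 'a" where
  "odd_part x = x - even_part x"

text \<open>Matrix rows and columns, and positions in words, are numbered from \<open>0\<close>.\<close>

context
  fixes n d :: nat
begin

definition words :: "'a mat list set" where
  "words = {w. length w = d \<and> set w \<subseteq> carrier_mat n n}"

definition free_on_words :: "('a mat list \<Rightarrow>\<^sub>0 'k) set" where
  "free_on_words = {x. Poly_Mapping.keys x \<subseteq> words}"

abbreviation word :: "'a mat list \<Rightarrow> 'a mat list \<Rightarrow>\<^sub>0 'k" where
  "word w \<equiv> Poly_Mapping.single w 1"

definition multilinear_relations :: "('a mat list \<Rightarrow>\<^sub>0 'k) set" where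
  "multilinear_relations = Modules.module.span fscale
     ({word (us @ (X + Y) # vs) - word (us @ X # vs) - word (us @ Y # vs) | us X Y vs.
         us @ X # vs \<in> words \<and> us @ Y # vs \<in> words} \<union>
      {word (us @ map_mat (scale c) X # vs) - fscale c (word (us @ X # vs)) | c us X vs.
         us @ X # vs \<in> words})"

definition tensor_rel :: "(('a mat list \<Rightarrow>\<^sub>0 'k) \<times> ('a mat list \<Rightarrow>\<^sub>0 'k)) set" where
  "tensor_rel = {(x, y). x \<in> free_on_words \<and> y \<in> free_on_words \<and> x - y \<in> multilinear_relations}"

definition pure :: "'a mat list \<Rightarrow> ('a mat list \<Rightarrow>\<^sub>0 'k) set" where
  "pure w = tensor_rel `` {word w}"

text \<open>The multihomogeneous component of a word in which exactly the letters at the positions in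
  \<open>P\<close> are odd. A pure tensor is the sum of these components over all \<open>P\<close>.\<close>

definition component :: "nat set \<Rightarrow> 'a mat list \<Rightarrow> 'a mat list" where
  "component P w = map (\<lambda>i. map_mat (if i \<in> P then odd_part else even_part) (w ! i)) [0..<d]"

text \<open>Multiplying \<open>x\<^sub>1 \<otimes> \<dots> \<otimes> x\<^sub>d\<close> by \<open>y\<^sub>1 \<otimes> \<dots> \<otimes> y\<^sub>d\<close> moves \<open>y\<^sub>l\<close> past all \<open>x\<^sub>k\<close> with \<open>k > l\<close>;
  \<open>P\<close> and \<open>Q\<close> are the sets of positions of the odd letters of the two words.\<close>

definition product_sign :: "nat set \<Rightarrow> nat set \<Rightarrow> 'k" where
  "product_sign P Q = (-1) ^ card {(k, l). k \<in> P \<and> l \<in> Q \<and> l < k}"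

definition word_mult :: "'a mat list \<Rightarrow> 'a mat list \<Rightarrow> ('a mat list \<Rightarrow>\<^sub>0 'k)" where
  "word_mult v w = (\<Sum>P\<in>Pow {..<d}. \<Sum>Q\<in>Pow {..<d}.
     fscale (product_sign P Q) (word (map2 (*) (component P v) (component Q w))))"

definition free_mult ::
    "('a mat list \<Rightarrow>\<^sub>0 'k) \<Rightarrow> ('a mat list \<Rightarrow>\<^sub>0 'k) \<Rightarrow> ('a mat list \<Rightarrow>\<^sub>0 'k)" where
  "free_mult x y = linear_extension (\<lambda>v. linear_extension (word_mult v) y) x"

definition perm_sign :: "(nat \<Rightarrow> nat) \<Rightarrow> nat set \<Rightarrow> 'k" where
  "perm_sign \<sigma> P = (-1) ^ card {(k, l). k \<in> P \<and> l \<in> P \<and> k < l \<and> inv_into UNIV \<sigma> k > inv_into UNIV \<sigma> l}"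

definition word_act :: "(nat \<Rightarrow> nat) \<Rightarrow> 'a mat list \<Rightarrow> ('a mat list \<Rightarrow>\<^sub>0 'k)" where
  "word_act \<sigma> w =
     (\<Sum>P\<in>Pow {..<d}. fscale (perm_sign \<sigma> P) (word (permute_list \<sigma> (component P w))))"

definition act :: "(nat \<Rightarrow> nat) \<Rightarrow> ('a mat list \<Rightarrow>\<^sub>0 'k) set \<Rightarrow> ('a mat list \<Rightarrow>\<^sub>0 'k) set" where
  "act \<sigma> X = (\<Union>x\<in>X. tensor_rel `` {linear_extension (word_act \<sigma>) x})"

definition matrix_unit :: "'a \<Rightarrow> nat \<Rightarrow> nat \<Rightarrow> 'a mat" where
  "matrix_unit a r s = mat n n (\<lambda>(i, j). if i = r \<and> j = s then a else 0)"

text \<open>The superalgebra \<open>M\<^sub>n(A)\<^bsup>\<otimes>d\<^esup>\<close>, where \<open>e\<close> is the unit of \<open>A\<close>.\<close>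

definition tensor_power :: "'a \<Rightarrow> ('k, ('a mat list \<Rightarrow>\<^sub>0 'k) set) module" where
  "tensor_power e =
    \<lparr>carrier = free_on_words // tensor_rel,
     monoid.mult = (\<lambda>X Y. \<Union>x\<in>X. \<Union>y\<in>Y. tensor_rel `` {free_mult x y}),
     one = pure (replicate d (mat n n (\<lambda>(i, j). if i = j then e else 0))),
     zero = tensor_rel `` {0},
     add = (\<lambda>X Y. \<Union>x\<in>X. \<Union>y\<in>Y. tensor_rel `` {x + y}),
     smult = (\<lambda>c X. \<Union>x\<in>X. tensor_rel `` {fscale c x})\<rparr>"

definition schur_algebra :: "'a \<Rightarrow> ('k, ('a mat list \<Rightarrow>\<^sub>0 'k) set) module" where
  "schur_algebra e = (tensor_power e)
     \<lparr>carrier := {X \<in> carrier (tensor_power e). \<forall>\<sigma>. \<sigma> permutes {..<d} \<longrightarrow> act \<sigma> X = X}\<rparr>"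

definition Tri :: "'a set \<Rightarrow> ('a list \<times> nat list \<times> nat list) set" where
  "Tri B = {(b, r, s). length b = d \<and> length r = d \<and> length s = d \<and>
     set b \<subseteq> B \<and> set r \<subseteq> {..<n} \<and> set s \<subseteq> {..<n} \<and>
     (\<forall>k<d. \<forall>l<d. k \<noteq> l \<and> (b ! k, r ! k, s ! k) = (b ! l, r ! l, s ! l) \<longrightarrow> b ! k \<in> A0)}"

definition stabilizer :: "'a list \<Rightarrow> nat list \<Rightarrow> nat list \<Rightarrow> (nat \<Rightarrow> nat) set" where
  "stabilizer b r s = {\<sigma>. \<sigma> permutes {..<d} \<and>
     permute_list \<sigma> b = b \<and> permute_list \<sigma> r = r \<and> permute_list \<sigma> s = s}"

definition stabilizer_cosets :: "'a list \<Rightarrow> nat list \<Rightarrow> nat list \<Rightarrow> (nat \<Rightarrow> nat) set set" where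
  "stabilizer_cosets b r s =
     (\<lambda>\<sigma>. (\<lambda>\<tau>. \<tau> \<circ> \<sigma>) ` stabilizer b r s) ` {\<sigma>. \<sigma> permutes {..<d}}"

definition \<xi> :: "'a \<Rightarrow> 'a list \<Rightarrow> nat list \<Rightarrow> nat list \<Rightarrow> ('a mat list \<Rightarrow>\<^sub>0 'k) set" where
  "\<xi> e b r s = (\<Oplus>\<^bsub>tensor_power e\<^esub>C\<in>stabilizer_cosets b r s.
     act (SOME \<sigma>. \<sigma> \<in> C) (pure (map (\<lambda>k. matrix_unit (b ! k) (r ! k) (s ! k)) [0..<d])))"

definition multiplicity_of ::
    "'a list \<Rightarrow> nat list \<Rightarrow> nat list \<Rightarrow> 'a \<Rightarrow> nat \<Rightarrow> nat \<Rightarrow> nat" where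
  "multiplicity_of b r s x i j = card {k. k < d \<and> (b ! k, r ! k, s ! k) = (x, i, j)}"

text \<open>\<open>B\<^sub>\<cc>\<close> may be infinite; the factors of elements not occurring in \<open>b\<close> equal \<open>1\<close>, and they have
  to be left out because a product over an infinite index set is \<open>1\<close> by convention.\<close>

definition \<cc>_factorial :: "'a set \<Rightarrow> 'a list \<Rightarrow> nat list \<Rightarrow> nat list \<Rightarrow> nat" where
  "\<cc>_factorial B\<^sub>\<cc> b r s =
     (\<Prod>x\<in>B\<^sub>\<cc> \<inter> set b. \<Prod>i<n. \<Prod>j<n. fact (multiplicity_of b r s x i j))"

definition \<eta> ::
    "'a \<Rightarrow> 'a set \<Rightarrow> 'a list \<Rightarrow> nat list \<Rightarrow> nat list \<Rightarrow> ('a mat list \<Rightarrow>\<^sub>0 'k) set" where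
  "\<eta> e B\<^sub>\<cc> b r s = of_nat (\<cc>_factorial B\<^sub>\<cc> b r s) \<odot>\<^bsub>tensor_power e\<^esub> \<xi> e b r s"

text \<open>The span \<open>T\<^bsup>A\<^esup>\<^bsub>\<aa>\<^esub>(n,d)\<close>; it depends on \<open>\<aa>\<close> through \<open>B\<^sub>\<aa>\<close> and \<open>B\<^sub>\<cc>\<close>.\<close>

definition T_span :: "'a \<Rightarrow> 'a set \<Rightarrow> 'a set \<Rightarrow> 'a set \<Rightarrow> ('a mat list \<Rightarrow>\<^sub>0 'k) set set" where
  "T_span e B\<^sub>\<aa> B\<^sub>\<cc> B\<^sub>1 =
     mspan (tensor_power e) {\<eta> e B\<^sub>\<cc> b r s | b r s. (b, r, s) \<in> Tri (B\<^sub>\<aa> \<union> B\<^sub>\<cc> \<union> B\<^sub>1)}"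

end

end

end

theory Submission
  imports Defs "HOL-Library.Function_Algebras"
begin

text \<open>A basis of \<open>A\<close> gives coordinates on the tensor power, indexed by words of triples
  \<open>(b, r, s)\<close>. In these coordinates \<open>S\<close> consists of the functions \<open>z\<close> that are invariant
  up to sign under permutation of the index, and \<open>T\<close> of those for which moreover \<open>z \<beta>\<close> is
  divisible, for every \<open>\<beta>\<close>, by the product of the factorials of the multiplicities in \<open>\<beta>\<close> of the
  triples with \<open>b\<close> in \<open>B\<^sub>\<cc>\<close>, which is the order of the group \<open>H\<close> of permutations of
  the \<open>B\<^sub>\<cc>\<close>-positions that stabilize \<open>\<beta>\<close>. The coordinate at \<open>\<beta>\<close> of a product is a sum over pairs
  \<open>(\<gamma>, \<delta>)\<close> whose terms are constant on the orbits of \<open>H\<close>, so it is divisible by \<open>|H|\<close> once each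
  term is divisible by the order of the stabilizer of \<open>(\<gamma>, \<delta>)\<close> in \<open>H\<close>. At every position moved by
  this stabilizer one of the letters of \<open>\<gamma>\<close> and \<open>\<delta>\<close> is in \<open>B\<^sub>\<cc>\<close>, because \<open>\<aa>\<close> is a subalgebra and
  odd letters do not repeat; hence its order divides the product of the factorials
  for \<open>\<gamma>\<close> and \<open>\<delta>\<close>.\<close>

section \<open>Stabilizers of functions\<close>

text \<open>\<open>T\<close> is given by generators, and multiplying two of them directly would
  require the structure constants of the orbit sums. A divisibility condition on single coordinates
  turns closure under products into a count of orbits, and no product of two generators is ever
  computed. The condition is also sufficient for membership because the coordinate of
  \<open>\<eta>\<close> at its own index is exactly the prescribed divisor, so that multiples of
  generators can be subtracted until nothing is left.

  Two points shape the count. A simultaneous permutation of \<beta>, \<gamma> and \<delta> changes a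
  term by the sign belonging to \<beta>; \<open>H\<close> moves only even positions of \<beta>, so
  its signs are 1 and the terms are really constant on orbits. Secondly, the sums run over all
  indices, including those with repeated odd letters. These drop out through the coordinates:
  exchanging two equal odd letters gives \<open>z \<gamma> = - z \<gamma>\<close>, hence 0 in a
  domain of characteristic 0.

  As the basis may be infinite, products are summed over indices with letters in a finite set that
  contains all letters of both factors.\<close>

definition fibre_stabilizer :: "nat set \<Rightarrow> (nat \<Rightarrow> 'b) \<Rightarrow> (nat \<Rightarrow> nat) set" where
  "fibre_stabilizer D f = {\<sigma>. \<sigma> permutes D \<and> f \<circ> \<sigma> = f}"

definition fibre_factorial :: "nat set \<Rightarrow> (nat \<Rightarrow> 'b) \<Rightarrow> nat" where
  "fibre_factorial D f = (\<Prod>y\<in>f ` D. fact (card {k \<in> D. f k = y}))"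

lemma finite_fibre_stabilizer: "finite D \<Longrightarrow> finite (fibre_stabilizer D f)"
  unfolding fibre_stabilizer_def by (rule finite_subset[OF _ finite_permutations[of D]]) auto

text \<open>Values that are not attained contribute \<open>fact 0 = 1\<close>, so the finite index
  set of the product may be enlarged at will.\<close>

lemma fibre_factorial_superset:
  assumes "finite S" "f ` D \<subseteq> S"
  shows "fibre_factorial D f = (\<Prod>y\<in>S. fact (card {k \<in> D. f k = y}))"
proof -
  have "(\<Prod>y\<in>f ` D. fact (card {k \<in> D. f k = y})) = (\<Prod>y\<in>S. fact (card {k \<in> D. f k = y}) :: nat)"
  proof (rule prod.mono_neutral_left[OF assms], rule ballI)
    fix y assume "y \<in> S - f ` D"
    then have "{k \<in> D. f k = y} = {}" by auto
    then show "fact (card {k \<in> D. f k = y}) = (1::nat)" by (simp only: card.empty fact_0)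
  qed
  then show ?thesis by (simp add: fibre_factorial_def)
qed

lemma fibre_factorial_insert:
  assumes "finite D" "x \<notin> D"
  shows "fibre_factorial (insert x D) f = card {k \<in> insert x D. f k = f x} * fibre_factorial D f"
proof -
  let ?S = "f ` insert x D"
  have fin: "finite ?S" using assms by simp
  have in1: "f x \<in> ?S" by simp
  have a: "{k \<in> insert x D. f k = y} = {k \<in> D. f k = y}" if "y \<noteq> f x" for y
    using that by auto
  have b: "{k \<in> insert x D. f k = f x} = insert x {k \<in> D. f k = f x}" by auto
  have c: "card {k \<in> insert x D. f k = f x} = Suc (card {k \<in> D. f k = f x})"
    unfolding b using assms by simp
  have "fibre_factorial (insert x D) f = fact (card {k \<in> insert x D. f k = f x}) *
      (\<Prod>y\<in>?S - {f x}. fact (card {k \<in> D. f k = y}))"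
    unfolding fibre_factorial_def prod.remove[OF fin in1]
    using a by (intro arg_cong2[where f="(*)"] prod.cong refl arg_cong[where f=fact] arg_cong[where f=card]) blast
  also have "\<dots> = card {k \<in> insert x D. f k = f x} * (fact (card {k \<in> D. f k = f x}) *
      (\<Prod>y\<in>?S - {f x}. fact (card {k \<in> D. f k = y})))"
    unfolding c by (simp add: algebra_simps)
  also have "fact (card {k \<in> D. f k = f x}) * (\<Prod>y\<in>?S - {f x}. fact (card {k \<in> D. f k = y}))
     = fibre_factorial D f"
    unfolding fibre_factorial_superset[OF fin subset_trans[OF image_mono[OF subset_insertI] subset_refl]]
    by (rule prod.remove[OF fin in1, symmetric])
  finally show ?thesis .
qed

text \<open>Induction on \<open>D\<close>: a stabilizing permutation of \<open>insert x D\<close> is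
  uniquely \<open>transpose x b \<circ> q\<close>, where \<open>b\<close> runs over the fibre of
  \<open>f x\<close> and \<open>q\<close> over the stabilizer on \<open>D\<close>. The order grows
  by the size of that fibre, as in \<open>fibre_factorial_insert\<close>.\<close>

lemma card_fibre_stabilizer:
  assumes "finite D"
  shows "card (fibre_stabilizer D f) = fibre_factorial D f"
  using assms
proof (induction D)
  case empty
  have "fibre_stabilizer {} f = {id}" by (auto simp: fibre_stabilizer_def)
  then show ?case by (simp add: fibre_factorial_def)
next
  case (insert x D)
  let ?F = "{k \<in> insert x D. f k = f x}"
  let ?g = "\<lambda>(b, p). transpose x b \<circ> p"
  have tr: "f \<circ> transpose x b = f" if "f b = f x" for b
    using that by (auto simp: fun_eq_iff transpose_def)
  have px: "p x = x" if "p permutes D" for p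
    using that insert.hyps by (auto simp: permutes_def)
  have eq: "fibre_stabilizer (insert x D) f = ?g ` (?F \<times> fibre_stabilizer D f)" (is "?L = ?R")
  proof
    show "?L \<subseteq> ?R"
    proof
      fix p assume "p \<in> ?L"
      then have p: "p permutes insert x D" "f \<circ> p = f" by (auto simp: fibre_stabilizer_def)
      let ?q = "transpose x (p x) \<circ> p"
      have fp: "f (p x) = f x" using p(2) by (metis comp_apply)
      have q: "?q permutes D" using permutes_insert_lemma[OF p(1)] .
      have "f \<circ> ?q = f" using tr[OF fp] p(2) by (metis comp_assoc)
      moreover have "p x \<in> insert x D" using permutes_in_image[OF p(1), of x] by simp
      moreover have "p = ?g (p x, ?q)" by (simp add: fun_eq_iff o_assoc)
      ultimately show "p \<in> ?R" using q fp unfolding fibre_stabilizer_def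
        by (intro image_eqI[of _ _ "(p x, ?q)"]) auto
    qed
    show "?R \<subseteq> ?L"
    proof
      fix p assume "p \<in> ?R"
      then obtain b q where bq: "p = transpose x b \<circ> q" "b \<in> insert x D" "f b = f x" "q permutes D" "f \<circ> q = f"
        by (auto simp: fibre_stabilizer_def)
      have "q permutes insert x D" using bq(4) permutes_subset by blast
      then have "p permutes insert x D"
        unfolding bq(1) by (rule permutes_compose) (use bq(2) in \<open>auto intro: permutes_swap_id\<close>)
      moreover have "f \<circ> p = f" unfolding bq(1) using tr[OF bq(3)] bq(5) by (metis comp_assoc)
      ultimately show "p \<in> ?L" by (simp add: fibre_stabilizer_def)
    qed
  qed
  have inj: "inj_on ?g (?F \<times> fibre_stabilizer D f)"
  proof (rule inj_onI, clarsimp simp del: comp_apply)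
    fix b p c q
    assume p: "p \<in> fibre_stabilizer D f" "q \<in> fibre_stabilizer D f"
      and eq: "transpose x b \<circ> p = transpose x c \<circ> q"
    have px: "p x = x" "q x = x" using p px by (auto simp: fibre_stabilizer_def)
    have "b = (transpose x b \<circ> p) x" using px by simp
    also have "\<dots> = c" unfolding eq using px by simp
    finally have bc: "b = c" .
    have "transpose x b \<circ> (transpose x b \<circ> p) = transpose x b \<circ> (transpose x b \<circ> q)"
      using eq bc by simp
    then have "p = q" by (simp add: fun_eq_iff o_assoc)
    with bc show "b = c \<and> p = q" by simp
  qed
  have "card (fibre_stabilizer (insert x D) f) = card ?F * card (fibre_stabilizer D f)"
    unfolding eq card_image[OF inj] by (simp add: card_cartesian_product)
  then show ?case using insert fibre_factorial_insert[OF insert.hyps(1,2), of f] by simp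
qed

text \<open>One orbit is removed at a time. The orbit of \<open>x\<close> contributes its length
  times \<open>f x\<close>, the order of the stabilizer divides \<open>f x\<close>, and length and
  order multiply to \<open>card H\<close>; the remaining set is again closed under \<open>H\<close>.
  Nothing is divided in the coefficients, so a commutative semiring suffices. The action is a right
  action because indices are composed with permutations on the right.\<close>

lemma orbit_sum_dvd:
  fixes f :: "'x \<Rightarrow> 'k::comm_semiring_1" and H :: "('n \<Rightarrow> 'n) set"
  assumes "finite H" "finite X" "id \<in> H"
    and bij: "\<And>\<sigma>. \<sigma> \<in> H \<Longrightarrow> bij \<sigma>"
    and inv: "\<And>\<sigma>. \<sigma> \<in> H \<Longrightarrow> inv_into UNIV \<sigma> \<in> H"
    and comp: "\<And>\<sigma> \<tau>. \<sigma> \<in> H \<Longrightarrow> \<tau> \<in> H \<Longrightarrow> \<sigma> \<circ> \<tau> \<in> H"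
    and act_id: "\<And>x. x \<in> X \<Longrightarrow> \<rho> id x = x"
    and act_comp: "\<And>\<sigma> \<tau> x. \<sigma> \<in> H \<Longrightarrow> \<tau> \<in> H \<Longrightarrow> x \<in> X \<Longrightarrow> \<rho> (\<sigma> \<circ> \<tau>) x = \<rho> \<tau> (\<rho> \<sigma> x)"
    and act_in: "\<And>\<sigma> x. \<sigma> \<in> H \<Longrightarrow> x \<in> X \<Longrightarrow> \<rho> \<sigma> x \<in> X"
    and f_inv: "\<And>\<sigma> x. \<sigma> \<in> H \<Longrightarrow> x \<in> X \<Longrightarrow> f (\<rho> \<sigma> x) = f x"
    and f_dvd: "\<And>x. x \<in> X \<Longrightarrow> of_nat (card {\<sigma> \<in> H. \<rho> \<sigma> x = x}) dvd f x"
  shows "of_nat (card H) dvd (\<Sum>x\<in>X. f x)"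
  using assms(2) act_id act_comp act_in f_inv f_dvd
proof (induction X rule: finite_psubset_induct)
  case (psubset X)
  note act_id = psubset.prems(1) and act_comp = psubset.prems(2) and act_in = psubset.prems(3)
    and f_inv = psubset.prems(4) and f_dvd = psubset.prems(5)
  show ?case
  proof (cases "X = {}")
    case False
    then obtain x where x: "x \<in> X" by auto
    let ?O = "(\<lambda>\<sigma>. \<rho> \<sigma> x) ` H"
    let ?K = "{\<sigma> \<in> H. \<rho> \<sigma> x = x}"
    have OX: "?O \<subseteq> X" using act_in x by auto
    have xO: "x \<in> ?O" using act_id[OF x] \<open>id \<in> H\<close> by (metis image_eqI)
    have invr: "\<sigma> \<circ> inv_into UNIV \<sigma> = id" and invl: "inv_into UNIV \<sigma> \<circ> \<sigma> = id" if "\<sigma> \<in> H" for \<sigma>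
      using bij[OF that] by (auto simp: fun_eq_iff bij_is_surj surj_f_inv_f bij_is_inj inv_f_f)
    have fib: "card {\<sigma> \<in> H. \<rho> \<sigma> x = y} = card ?K" if y: "y \<in> ?O" for y
    proof -
      from y obtain \<tau> where \<tau>: "\<tau> \<in> H" "y = \<rho> \<tau> x" by auto
      \<comment> \<open>Since \<tau> carries \<open>x\<close> to \<open>y\<close>, composing with
        its inverse turns the elements that carry \<open>x\<close> to \<open>y\<close> into the
        stabilizer of \<open>x\<close>.\<close>
      have "bij_betw (\<lambda>\<sigma>. \<sigma> \<circ> inv_into UNIV \<tau>) {\<sigma> \<in> H. \<rho> \<sigma> x = y} ?K"
      proof (rule bij_betw_byWitness[where f' = "\<lambda>\<sigma>. \<sigma> \<circ> \<tau>"])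
        show "\<forall>a\<in>{\<sigma> \<in> H. \<rho> \<sigma> x = y}. (a \<circ> inv_into UNIV \<tau>) \<circ> \<tau> = a"
          using invl[OF \<tau>(1)] by (simp add: comp_assoc)
        show "\<forall>a\<in>?K. (a \<circ> \<tau>) \<circ> inv_into UNIV \<tau> = a"
          using invr[OF \<tau>(1)] by (simp add: comp_assoc)
        have "\<rho> (\<sigma> \<circ> inv_into UNIV \<tau>) x = x" if "\<sigma> \<in> H" "\<rho> \<sigma> x = y" for \<sigma>
        proof -
          have "\<rho> (\<sigma> \<circ> inv_into UNIV \<tau>) x = \<rho> (inv_into UNIV \<tau>) (\<rho> \<tau> x)"
            unfolding act_comp[OF that(1) inv[OF \<tau>(1)] x] using that \<tau> by simp
          also have "\<dots> = \<rho> (\<tau> \<circ> inv_into UNIV \<tau>) x" unfolding act_comp[OF \<tau>(1) inv[OF \<tau>(1)] x] by simp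
          finally show ?thesis using invr[OF \<tau>(1)] act_id[OF x] by simp
        qed
        then show "(\<lambda>\<sigma>. \<sigma> \<circ> inv_into UNIV \<tau>) ` {\<sigma> \<in> H. \<rho> \<sigma> x = y} \<subseteq> ?K"
          using comp inv \<tau> by auto
        show "(\<lambda>\<sigma>. \<sigma> \<circ> \<tau>) ` ?K \<subseteq> {\<sigma> \<in> H. \<rho> \<sigma> x = y}"
          using comp \<tau> act_comp x by (auto simp del: comp_apply)
      qed
      then show ?thesis by (rule bij_betw_same_card)
    qed
    have "card H = card ?O * card ?K"
    proof -
      have "card H = (\<Sum>\<sigma>\<in>H. 1)" by simp
      also have "\<dots> = (\<Sum>y\<in>?O. sum (\<lambda>_. 1) {\<sigma> \<in> H. \<rho> \<sigma> x = y})"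
        by (rule sum.image_gen[OF \<open>finite H\<close>])
      also have "\<dots> = (\<Sum>y\<in>?O. card ?K)" using fib by (intro sum.cong) simp_all
      finally show ?thesis by simp
    qed
    moreover have "(\<Sum>y\<in>?O. f y) = of_nat (card ?O) * f x"
    proof -
      have "(\<Sum>y\<in>?O. f y) = (\<Sum>y\<in>?O. f x)" using f_inv x by (intro sum.cong) auto
      then show ?thesis by simp
    qed
    ultimately have d1: "of_nat (card H) dvd (\<Sum>y\<in>?O. f y)"
      using f_dvd[OF x] by (simp add: mult_dvd_mono)
    have closed: "\<rho> \<sigma> y \<in> X - ?O" if "\<sigma> \<in> H" "y \<in> X - ?O" for \<sigma> y
    proof -
      have "\<rho> \<sigma> y \<notin> ?O"
      proof
        assume "\<rho> \<sigma> y \<in> ?O"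
        then obtain \<tau> where \<tau>: "\<tau> \<in> H" "\<rho> \<sigma> y = \<rho> \<tau> x" by auto
        have "y = \<rho> (\<sigma> \<circ> inv_into UNIV \<sigma>) y" using invr[OF that(1)] act_id that by (metis DiffD1)
        also have "\<dots> = \<rho> (inv_into UNIV \<sigma>) (\<rho> \<tau> x)" using act_comp[OF that(1) inv[OF that(1)], of y] that \<tau> by (simp del: comp_apply)
        also have "\<dots> = \<rho> (\<tau> \<circ> inv_into UNIV \<sigma>) x" by (rule act_comp[OF \<tau>(1) inv[OF that(1)] x, symmetric])
        finally have "y \<in> ?O" using comp[OF \<tau>(1) inv[OF that(1)]] by auto
        with that show False by simp
      qed
      then show ?thesis using act_in that by auto
    qed
    have "of_nat (card H) dvd (\<Sum>y\<in>X - ?O. f y)"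
    proof (rule psubset.IH)
      show "X - ?O \<subset> X" using xO x by auto
      show "\<And>\<sigma> x. \<sigma> \<in> H \<Longrightarrow> x \<in> X - ?O \<Longrightarrow> \<rho> \<sigma> x \<in> X - ?O" by (rule closed)
    qed (use act_id act_comp f_inv f_dvd in auto)
    moreover have "(\<Sum>y\<in>X. f y) = (\<Sum>y\<in>X - ?O. f y) + (\<Sum>y\<in>?O. f y)"
      using OX psubset.hyps by (simp add: sum.subset_diff)
    ultimately show ?thesis using d1 by (simp add: dvd_add)
  qed simp
qed

lemma fibre_stabilizer_group:
  "id \<in> fibre_stabilizer D f"
  "\<sigma> \<in> fibre_stabilizer D f \<Longrightarrow> bij \<sigma>"
  "\<sigma> \<in> fibre_stabilizer D f \<Longrightarrow> inv_into UNIV \<sigma> \<in> fibre_stabilizer D f"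
  "\<sigma> \<in> fibre_stabilizer D f \<Longrightarrow> \<tau> \<in> fibre_stabilizer D f \<Longrightarrow> \<sigma> \<circ> \<tau> \<in> fibre_stabilizer D f"
proof -
  show "id \<in> fibre_stabilizer D f" by (simp add: fibre_stabilizer_def permutes_id)
  show "\<sigma> \<in> fibre_stabilizer D f \<Longrightarrow> bij \<sigma>" by (auto simp: fibre_stabilizer_def permutes_bij)
  show "inv_into UNIV \<sigma> \<in> fibre_stabilizer D f" if "\<sigma> \<in> fibre_stabilizer D f"
  proof -
    from that have s: "\<sigma> permutes D" "f \<circ> \<sigma> = f" by (auto simp: fibre_stabilizer_def)
    have "f \<circ> inv_into UNIV \<sigma> = (f \<circ> \<sigma>) \<circ> inv_into UNIV \<sigma>" using s by simp
    also have "\<dots> = f" using permutes_inv_o[OF s(1)] by (simp add: comp_assoc)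
    finally show ?thesis using permutes_inv[OF s(1)] by (simp add: fibre_stabilizer_def)
  qed
  show "\<sigma> \<circ> \<tau> \<in> fibre_stabilizer D f" if "\<sigma> \<in> fibre_stabilizer D f" "\<tau> \<in> fibre_stabilizer D f"
    using that by (auto simp: fibre_stabilizer_def permutes_compose comp_assoc[symmetric])
qed

text \<open>The smaller stabilizer acts freely on the larger one by composition.\<close>

lemma fibre_factorial_dvd:
  assumes "finite E" "D \<subseteq> E" and ref: "\<And>k l. k \<in> D \<Longrightarrow> l \<in> D \<Longrightarrow> f k = f l \<Longrightarrow> g k = g l"
  shows "fibre_factorial D f dvd fibre_factorial E g"
proof -
  have fD: "finite D" using assms finite_subset by blast
  have sub: "fibre_stabilizer D f \<subseteq> fibre_stabilizer E g"
  proof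
    fix \<sigma> assume "\<sigma> \<in> fibre_stabilizer D f"
    then have s: "\<sigma> permutes D" "f \<circ> \<sigma> = f" by (auto simp: fibre_stabilizer_def)
    have "g (\<sigma> k) = g k" for k
    proof (cases "k \<in> D")
      case True
      then show ?thesis using ref[of "\<sigma> k" k] s by (metis comp_apply permutes_in_image)
    next
      case False
      then show ?thesis using s by (simp add: permutes_not_in)
    qed
    then show "\<sigma> \<in> fibre_stabilizer E g"
      using permutes_subset[OF s(1) assms(2)] by (auto simp: fibre_stabilizer_def)
  qed
  \<comment> \<open>Lagrange's theorem as the case of the constant summand 1: all stabilizers are
    trivial, and the sum is the order of the larger group.\<close>
  have "of_nat (card (fibre_stabilizer D f)) dvd (\<Sum>x\<in>fibre_stabilizer E g. 1::nat)"
  proof (rule orbit_sum_dvd[where \<rho> = "\<lambda>\<sigma> \<tau>. \<tau> \<circ> \<sigma>"])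
    show "\<tau> \<circ> \<sigma> \<in> fibre_stabilizer E g" if "\<sigma> \<in> fibre_stabilizer D f" "\<tau> \<in> fibre_stabilizer E g" for \<sigma> \<tau>
      using that sub fibre_stabilizer_group(4) by blast
    show "of_nat (card {\<sigma> \<in> fibre_stabilizer D f. x \<circ> \<sigma> = x}) dvd (1::nat)"
      if x: "x \<in> fibre_stabilizer E g" for x
    proof -
      have "\<sigma> = id" if "x \<circ> \<sigma> = x" for \<sigma>
        using fibre_stabilizer_group(2)[OF x] that by (metis bij_is_inj comp_id fun.inj_map_strong inj_onD UNIV_I fun_eq_iff comp_apply id_apply)
      then have "{\<sigma> \<in> fibre_stabilizer D f. x \<circ> \<sigma> = x} = {id}" using fibre_stabilizer_group(1) by auto
      then show ?thesis by simp
    qed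
  qed (auto simp: fibre_stabilizer_group finite_fibre_stabilizer fD assms comp_assoc)
  then show ?thesis using card_fibre_stabilizer[OF fD] card_fibre_stabilizer[OF assms(1)] by (metis card_eq_sum of_nat_id)
qed

lemma fibre_factorial_union:
  assumes "finite C" "finite D" and disj: "f ` C \<inter> f ` D = {}"
  shows "fibre_factorial (C \<union> D) f = fibre_factorial C f * fibre_factorial D f"
proof -
  have a: "{k \<in> C \<union> D. f k = y} = {k \<in> C. f k = y}" if "y \<in> f ` C" for y
    using that disj by auto
  have b: "{k \<in> C \<union> D. f k = y} = {k \<in> D. f k = y}" if "y \<in> f ` D" for y
    using that disj by auto
  have "fibre_factorial (C \<union> D) f = (\<Prod>y\<in>f ` C. fact (card {k \<in> C \<union> D. f k = y})) *
      (\<Prod>y\<in>f ` D. fact (card {k \<in> C \<union> D. f k = y}))"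
    unfolding fibre_factorial_def image_Un by (rule prod.union_disjoint) (use assms in simp_all)
  then show ?thesis unfolding fibre_factorial_def by (simp only: a b cong: prod.cong)
qed

section \<open>Signs of permutations\<close>

definition pairs :: "nat \<Rightarrow> (nat \<times> nat) set" where
  "pairs d = {(k, l). k < l \<and> l < d}"

lemma finite_pairs: "finite (pairs d)"
  by (rule finite_subset[of _ "{..<d} \<times> {..<d}"]) (auto simp: pairs_def)

text \<open>Written as products over one fixed set of pairs, signs can be compared factor by factor
  instead of by counting modulo 2.\<close>

lemma minus_one_power_card:
  assumes "finite U" "S \<subseteq> U"
  shows "(-1) ^ card S = (\<Prod>p\<in>U. if p \<in> S then -1 else (1::'k::comm_ring_1))"
proof -
  have "(\<Prod>p\<in>U. if p \<in> S then -1 else (1::'k)) = (\<Prod>p\<in>U \<inter> S. -1)"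
    by (rule prod.inter_restrict[OF assms(1), symmetric])
  moreover have "U \<inter> S = S" using assms by auto
  ultimately show ?thesis by simp
qed

text \<open>A permutation of the positions permutes the two-element subsets, which
  \<open>pairs\<close> lists with the smaller element first. \<open>min\<close> and
  \<open>max\<close> restore that order, and the symmetry of \<open>g\<close> makes it immaterial to
  the factor.\<close>

lemma prod_pairs_permute:
  fixes g :: "nat \<Rightarrow> nat \<Rightarrow> 'k::comm_monoid_mult"
  assumes \<sigma>: "\<sigma> permutes {..<d}" and sym: "\<And>a b. a \<noteq> b \<Longrightarrow> g a b = g b a"
  shows "(\<Prod>(k, l)\<in>pairs d. g (\<sigma> k) (\<sigma> l)) = (\<Prod>(k, l)\<in>pairs d. g k l)"
proof -
  let ?i = "inv_into UNIV \<sigma>"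
  have lt: "\<sigma> k < d \<longleftrightarrow> k < d" "?i k < d \<longleftrightarrow> k < d" for k
    using permutes_in_image[OF \<sigma>, of k] permutes_in_image[OF permutes_inv[OF \<sigma>], of k] by auto
  have inj: "\<sigma> k = \<sigma> l \<longleftrightarrow> k = l" "?i k = ?i l \<longleftrightarrow> k = l" for k l
    using permutes_inj[OF \<sigma>] permutes_inj[OF permutes_inv[OF \<sigma>]] by (auto dest: injD)
  have io: "?i (\<sigma> k) = k" "\<sigma> (?i k) = k" for k
    using permutes_inverses[OF \<sigma>] by auto
  show ?thesis
  proof (rule prod.reindex_bij_witness[where
        j = "\<lambda>(k, l). (min (\<sigma> k) (\<sigma> l), max (\<sigma> k) (\<sigma> l))" and
        i = "\<lambda>(k, l). (min (?i k) (?i l), max (?i k) (?i l))"])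
    fix p assume "p \<in> pairs d"
    then obtain k l where p: "p = (k, l)" "k < l" "l < d" by (auto simp: pairs_def)
    have ne: "\<sigma> k \<noteq> \<sigma> l" "?i k \<noteq> ?i l" using p inj by auto
    show "(case case p of (k, l) \<Rightarrow> (min (\<sigma> k) (\<sigma> l), max (\<sigma> k) (\<sigma> l)) of
        (k, l) \<Rightarrow> (min (?i k) (?i l), max (?i k) (?i l))) = p"
      using p ne by (auto simp: min_def max_def io)
    show "(case p of (k, l) \<Rightarrow> (min (\<sigma> k) (\<sigma> l), max (\<sigma> k) (\<sigma> l))) \<in> pairs d"
      using p ne by (auto simp: pairs_def lt min_def max_def)
    show "(case case p of (k, l) \<Rightarrow> (min (?i k) (?i l), max (?i k) (?i l)) of
        (k, l) \<Rightarrow> (min (\<sigma> k) (\<sigma> l), max (\<sigma> k) (\<sigma> l))) = p"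
      using p ne by (auto simp: min_def max_def io)
    show "(case p of (k, l) \<Rightarrow> (min (?i k) (?i l), max (?i k) (?i l))) \<in> pairs d"
      using p ne by (auto simp: pairs_def lt min_def max_def)
    show "(case case p of (k, l) \<Rightarrow> (min (\<sigma> k) (\<sigma> l), max (\<sigma> k) (\<sigma> l)) of (k, l) \<Rightarrow> g k l) =
        (case p of (k, l) \<Rightarrow> g (\<sigma> k) (\<sigma> l))"
      using p ne sym[of "\<sigma> k" "\<sigma> l"] by (auto simp: min_def max_def)
  qed
qed

context superalgebra
begin

lemma perm_sign_prod:
  assumes "P \<subseteq> {..<d}"
  shows "perm_sign \<sigma> P = (\<Prod>(k, l)\<in>pairs d.
    if k \<in> P \<and> l \<in> P \<and> inv_into UNIV \<sigma> l < inv_into UNIV \<sigma> k then -1 else 1)"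
proof -
  let ?S = "{(k, l). k \<in> P \<and> l \<in> P \<and> k < l \<and> inv_into UNIV \<sigma> k > inv_into UNIV \<sigma> l}"
  have "?S \<subseteq> pairs d" using assms by (auto simp: pairs_def)
  from minus_one_power_card[OF finite_pairs this, where 'k = 'k] show ?thesis
    unfolding perm_sign_def by (auto intro!: prod.cong simp: pairs_def)
qed

lemma product_sign_prod:
  assumes "P \<subseteq> {..<d}"
  shows "product_sign P Q = (\<Prod>(k, l)\<in>pairs d. if l \<in> P \<and> k \<in> Q then -1 else 1)"
proof -
  let ?S = "{(k, l). l \<in> P \<and> k \<in> Q \<and> k < l}"
  have "?S \<subseteq> pairs d" using assms by (auto simp: pairs_def)
  note minus_one_power_card[OF finite_pairs this, where 'k = 'k]
  \<comment> \<open>The set in \<open>product_sign\<close> has the larger position first; swapping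
    the components puts its members into \<open>pairs\<close>.\<close>
  moreover have "{(k, l). k \<in> P \<and> l \<in> Q \<and> l < k} = prod.swap ` ?S" by auto
  then have "card {(k, l). k \<in> P \<and> l \<in> Q \<and> l < k} = card ?S" by (simp add: card_image)
  ultimately show ?thesis
    unfolding product_sign_def by (auto intro!: prod.cong simp: pairs_def)
qed

text \<open>The action by permutations respects the product: each sign is a product over the pairs
  \<open>k < l\<close>, and the identity holds for every factor.\<close>

lemma product_sign_permute:
  assumes \<sigma>: "\<sigma> permutes {..<d}" and P: "P \<subseteq> {..<d}" and Q: "Q \<subseteq> {..<d}"
  shows "perm_sign \<sigma> P * perm_sign \<sigma> Q * product_sign {k. \<sigma> k \<in> P} {k. \<sigma> k \<in> Q} =
    perm_sign \<sigma> ((P - Q) \<union> (Q - P)) * product_sign P Q"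
proof -
  let ?i = "inv_into UNIV \<sigma>"
  have inj: "?i k = ?i l \<longleftrightarrow> k = l" for k l
    using permutes_inj[OF permutes_inv[OF \<sigma>]] by (auto dest: injD)
  have io: "?i (\<sigma> k) = k" for k using permutes_inverses[OF \<sigma>] by auto
  have P': "{k. \<sigma> k \<in> P} \<subseteq> {..<d}"
  proof
    fix k assume "k \<in> {k. \<sigma> k \<in> P}"
    then show "k \<in> {..<d}" using P permutes_in_image[OF \<sigma>, of k] by auto
  qed
  \<comment> \<open>\<open>?G a b\<close> is the factor of the permuted words for the original
    positions \<open>a\<close> and \<open>b\<close>; \<open>?i\<close> tells which of the two comes
    first after the permutation. In this form it is symmetric for distinct positions.\<close>
  let ?G = "\<lambda>a b. if ?i a < ?i b then (if b \<in> P \<and> a \<in> Q then -1 else 1)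
      else (if a \<in> P \<and> b \<in> Q then -1 else (1::'k))"
  have "product_sign {k. \<sigma> k \<in> P} {k. \<sigma> k \<in> Q} = (\<Prod>(k, l)\<in>pairs d. ?G (\<sigma> k) (\<sigma> l))"
    unfolding product_sign_prod[OF P'] by (intro prod.cong) (auto simp: pairs_def io)
  also have "\<dots> = (\<Prod>(k, l)\<in>pairs d. ?G k l)"
  proof (rule prod_pairs_permute[OF \<sigma>])
    fix a b :: nat assume "a \<noteq> b"
    then have "?i a < ?i b \<longleftrightarrow> \<not> ?i b < ?i a" using inj[of a b] by linarith
    then show "?G a b = ?G b a" by auto
  qed
  finally have G: "product_sign {k. \<sigma> k \<in> P} {k. \<sigma> k \<in> Q} = (\<Prod>(k, l)\<in>pairs d. ?G k l)" .
  have PQ: "(P - Q) \<union> (Q - P) \<subseteq> {..<d}" using P Q by auto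
  show ?thesis
    unfolding G perm_sign_prod[OF P] perm_sign_prod[OF Q] perm_sign_prod[OF PQ] product_sign_prod[OF P]
      prod.distrib[symmetric]
  proof (rule prod.cong[OF refl])
    fix p assume "p \<in> pairs d"
    then obtain k l where p: "p = (k, l)" "k < l" by (auto simp: pairs_def)
    then have "?i k < ?i l \<longleftrightarrow> \<not> ?i l < ?i k" using inj[of k l] by linarith
    then show "(case p of (k, l) \<Rightarrow> if k \<in> P \<and> l \<in> P \<and> ?i l < ?i k then - 1 else 1) *
        (case p of (k, l) \<Rightarrow> if k \<in> Q \<and> l \<in> Q \<and> ?i l < ?i k then - 1 else 1) *
        (case p of (k, l) \<Rightarrow> ?G k l) =
        (case p of (k, l) \<Rightarrow> if k \<in> P - Q \<union> (Q - P) \<and> l \<in> P - Q \<union> (Q - P) \<and> ?i l < ?i k then - 1 else 1) *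
        (case p of (k, l) \<Rightarrow> if l \<in> P \<and> k \<in> Q then - 1 else (1::'k))"
      unfolding p prod.case by (cases "k \<in> P"; cases "k \<in> Q"; cases "l \<in> P"; cases "l \<in> Q") auto
  qed
qed

text \<open>The cocycle rule: the composite inverts two odd letters exactly if one of the two
  stages, but not both, inverts them.\<close>

lemma perm_sign_comp:
  assumes \<sigma>: "\<sigma> permutes {..<d}" and \<tau>: "\<tau> permutes {..<d}" and P: "P \<subseteq> {..<d}"
  shows "perm_sign (\<sigma> \<circ> \<tau>) P = perm_sign \<sigma> P * perm_sign \<tau> {k. \<sigma> k \<in> P}"
proof -
  let ?i = "inv_into UNIV \<sigma>" and ?j = "inv_into UNIV \<tau>"
  have inj: "?i k = ?i l \<longleftrightarrow> k = l" "?j k = ?j l \<longleftrightarrow> k = l" for k l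
    using permutes_inj[OF permutes_inv[OF \<sigma>]] permutes_inj[OF permutes_inv[OF \<tau>]] by (auto dest: injD)
  have io: "?i (\<sigma> k) = k" for k using permutes_inverses[OF \<sigma>] by auto
  have c: "inv_into UNIV (\<sigma> \<circ> \<tau>) k = ?j (?i k)" for k
    using o_inv_distrib[OF permutes_bij[OF \<sigma>] permutes_bij[OF \<tau>]] by simp
  have P': "{k. \<sigma> k \<in> P} \<subseteq> {..<d}"
  proof
    fix k assume "k \<in> {k. \<sigma> k \<in> P}"
    then show "k \<in> {..<d}" using P permutes_in_image[OF \<sigma>, of k] by auto
  qed
  \<comment> \<open>The inequality of the two comparisons says that the second stage inverts the
    letters which the first stage has moved to the places \<open>?i a\<close> and
    \<open>?i b\<close>.\<close>
  let ?G = "\<lambda>a b. if a \<in> P \<and> b \<in> P \<and> (?i a < ?i b) \<noteq> (?j (?i a) < ?j (?i b)) then -1 else (1::'k)"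
  have lin: "?i k < ?i l \<longleftrightarrow> \<not> ?i l < ?i k" "?j (?i k) < ?j (?i l) \<longleftrightarrow> \<not> ?j (?i l) < ?j (?i k)"
    if "k \<noteq> l" for k l
    using that inj(1)[of k l] inj(2)[of "?i k" "?i l"] by linarith+
  have "perm_sign \<tau> {k. \<sigma> k \<in> P} = (\<Prod>(k, l)\<in>pairs d. ?G (\<sigma> k) (\<sigma> l))"
    unfolding perm_sign_prod[OF P']
  proof (rule prod.cong[OF refl])
    fix p assume "p \<in> pairs d"
    then obtain k l where p: "p = (k, l)" "k < l" by (auto simp: pairs_def)
    moreover have "?j k \<noteq> ?j l" using inj p by simp
    ultimately show "(case p of (k, l) \<Rightarrow> if k \<in> {k. \<sigma> k \<in> P} \<and> l \<in> {k. \<sigma> k \<in> P} \<and> ?j l < ?j k then -1 else 1)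
       = (case p of (k, l) \<Rightarrow> ?G (\<sigma> k) (\<sigma> l))"
      by (auto simp: io)
  qed
  also have "\<dots> = (\<Prod>(k, l)\<in>pairs d. ?G k l)"
  proof (rule prod_pairs_permute[OF \<sigma>])
    fix a b :: nat assume "a \<noteq> b"
    then show "?G a b = ?G b a" using lin[of a b] by auto
  qed
  finally have G: "perm_sign \<tau> {k. \<sigma> k \<in> P} = (\<Prod>(k, l)\<in>pairs d. ?G k l)" .
  show ?thesis unfolding G perm_sign_prod[OF P] prod.distrib[symmetric]
  proof (rule prod.cong[OF refl])
    fix p assume "p \<in> pairs d"
    then obtain k l where p: "p = (k, l)" "k < l" by (auto simp: pairs_def)
    then show "(case p of (k, l) \<Rightarrow> if k \<in> P \<and> l \<in> P \<and> inv_into UNIV (\<sigma> \<circ> \<tau>) l < inv_into UNIV (\<sigma> \<circ> \<tau>) k then - 1 else 1) =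
        (case p of (k, l) \<Rightarrow> if k \<in> P \<and> l \<in> P \<and> ?i l < ?i k then - 1 else 1) *
        (case p of (k, l) \<Rightarrow> ?G k l)"
      unfolding p prod.case c using lin[of k l] by auto
  qed
qed

lemma perm_sign_fixed:
  assumes "\<sigma> permutes S" "\<And>k. k \<in> P \<Longrightarrow> \<sigma> k = k"
  shows "perm_sign \<sigma> P = 1"
proof -
  have "inv_into UNIV \<sigma> k = k" if "k \<in> P" for k
    using assms(2)[OF that] permutes_inverses(2)[OF assms(1), of k] by simp
  then have "{(k, l). k \<in> P \<and> l \<in> P \<and> k < l \<and> inv_into UNIV \<sigma> k > inv_into UNIV \<sigma> l} = {}"
    by auto
  then show ?thesis unfolding perm_sign_def by (simp only: card.empty power_0)
qed

text \<open>The inversions within \<open>P\<close> are the pair itself and, for every element of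
  \<open>P\<close> strictly between, its pairs with \<open>a\<close> and with \<open>b\<close>;
  their number is odd.\<close>

lemma perm_sign_transpose:
  assumes "finite P" "a \<in> P" "b \<in> P" "a \<noteq> b"
  shows "perm_sign (transpose a b) P = -1"
proof -
  have *: "perm_sign (transpose a b) P = -1" if P: "a \<in> P" "b \<in> P" "a < b" for a b
  proof -
    let ?M = "P \<inter> {a<..<b}"
    let ?X = "(\<lambda>m. (a, m)) ` ?M" and ?Y = "(\<lambda>m. (m, b)) ` ?M"
    have "{(k, l). k \<in> P \<and> l \<in> P \<and> k < l \<and> transpose a b k > transpose a b l} = insert (a, b) (?X \<union> ?Y)"
      using P by (auto simp: transpose_def split: if_splits)
    moreover have "card (insert (a, b) (?X \<union> ?Y)) = Suc (2 * card ?M)"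
    proof -
      have "card (insert (a, b) (?X \<union> ?Y)) = Suc (card (?X \<union> ?Y))"
        using assms(1) by (intro card_insert_disjoint) auto
      moreover have "card (?X \<union> ?Y) = card ?X + card ?Y"
        using assms(1) by (intro card_Un_disjoint) auto
      moreover have "card ?X = card ?M" "card ?Y = card ?M" by (auto intro!: card_image inj_onI)
      ultimately show ?thesis by simp
    qed
    ultimately show ?thesis unfolding perm_sign_def by simp
  qed
  show ?thesis
  proof (cases "a < b")
    case False
    then show ?thesis using *[of b a] assms by (simp add: transpose_commute)
  qed (use * assms in auto)
qed

end

section \<open>Coordinates of matrices\<close>

lemma (in Modules.module) independent_Un:
  assumes S: "independent S" and T: "independent T" and ST: "span S \<inter> span T \<subseteq> {0}"
  shows "independent (S \<union> T)"
proof -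
  have "\<forall>v\<in>t. u v = 0"
    if t: "finite t" "t \<subseteq> S \<union> T" and 0: "(\<Sum>v\<in>t. scale (u v) v) = 0" for t u
  proof -
    let ?s = "\<Sum>v\<in>t \<inter> S. scale (u v) v" and ?r = "\<Sum>v\<in>t - S. scale (u v) v"
    have s: "?s \<in> span S" by (intro span_sum span_scale span_base) auto
    have r: "?r \<in> span T" using t by (intro span_sum span_scale span_base) auto
    have sr: "?s + ?r = 0" using sum.Int_Diff[OF t(1), of "\<lambda>v. scale (u v) v" S] 0 by simp
    then have "?s = - ?r" by (simp add: eq_neg_iff_add_eq_0)
    then have "?s \<in> span T" using r by (simp add: span_neg)
    then have s0: "?s = 0" using s ST by auto
    then have r0: "?r = 0" using sr by simp
    have "u v = 0" if "v \<in> t \<inter> S" for v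
      using S s0 that t(1) unfolding independent_explicit_module by (metis Int_lower2 finite_Int)
    moreover have "u v = 0" if "v \<in> t - S" for v
      using T r0 that t unfolding independent_explicit_module by (metis Diff_subset_conv finite_Diff)
    ultimately show ?thesis by auto
  qed
  then show ?thesis unfolding independent_explicit_module by metis
qed

context superalgebra
begin

lemma even_part_eq:
  assumes y: "y \<in> A0" and z: "z \<in> A1"
  shows "even_part (y + z) = y"
  unfolding even_part_def
proof (rule the_equality)
  show "y \<in> A0 \<and> y + z - y \<in> A1" using assms by simp
  fix y' assume y': "y' \<in> A0 \<and> y + z - y' \<in> A1"
  then have "y - y' \<in> A0" using y subspace_A0 by (simp add: subspace_diff)
  moreover have "y - y' = (y + z - y') - z" by simp
  then have "y - y' \<in> A1" using y' z subspace_A1 by (metis subspace_diff)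
  ultimately have "y - y' \<in> A0 \<inter> A1" by simp
  then show "y' = y" unfolding A0_Int_A1 by simp
qed

lemma even_part_in: "even_part x \<in> A0"
  and odd_part_in: "odd_part x \<in> A1"
proof -
  obtain y z where "y \<in> A0" "z \<in> A1" "x = y + z" using A0_plus_A1 by metis
  then show "even_part x \<in> A0" "odd_part x \<in> A1" by (simp_all add: even_part_eq odd_part_def)
qed

end

locale schur_setup = unital_good_pair scale A0 A1 \<aa> e +
    good_pair_basis scale A0 A1 \<aa> \<cc> B\<^sub>\<aa> B\<^sub>\<cc> B\<^sub>1
  for scale :: "'k::{idom,ring_char_0} \<Rightarrow> 'a::ring \<Rightarrow> 'a"
    and A0 A1 \<aa> \<cc> B\<^sub>\<aa> B\<^sub>\<cc> B\<^sub>1 :: "'a set" and e :: 'a +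
  fixes n d :: nat
begin

definition basis :: "'a set" where
  "basis = B\<^sub>\<aa> \<union> B\<^sub>\<cc> \<union> B\<^sub>1"

lemma span_even_basis: "span (B\<^sub>\<aa> \<union> B\<^sub>\<cc>) = A0"
  unfolding span_Un \<aa>_plus_\<cc> using basis_\<aa> basis_\<cc> by (auto simp: is_basis_def)

lemma independent_even_basis: "independent (B\<^sub>\<aa> \<union> B\<^sub>\<cc>)"
  using basis_\<aa> basis_\<cc> \<aa>_Int_\<cc> by (intro independent_Un) (auto simp: is_basis_def)

lemma independent_basis: "independent basis"
  unfolding basis_def
proof (rule independent_Un[OF independent_even_basis])
  show "independent B\<^sub>1" using basis_A1 by (simp add: is_basis_def)
  show "span (B\<^sub>\<aa> \<union> B\<^sub>\<cc>) \<inter> span B\<^sub>1 \<subseteq> {0}"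
    unfolding span_even_basis using basis_A1 A0_Int_A1 by (simp add: is_basis_def)
qed

lemma span_basis: "span basis = UNIV"
proof -
  have "span basis = {x + y | x y. x \<in> A0 \<and> y \<in> A1}"
    unfolding basis_def span_Un[of "B\<^sub>\<aa> \<union> B\<^sub>\<cc>"] span_even_basis using basis_A1 by (auto simp: is_basis_def)
  also have "\<dots> = UNIV" using A0_plus_A1 by blast
  finally show ?thesis .
qed

lemma zero_notin_basis: "0 \<notin> basis"
  using independent_basis dependent_zero by blast

lemma B_sub: "B\<^sub>\<aa> \<subseteq> \<aa>" "B\<^sub>\<aa> \<subseteq> A0" "B\<^sub>\<cc> \<subseteq> A0" "B\<^sub>\<cc> \<subseteq> \<cc>" "B\<^sub>1 \<subseteq> A1"
  using basis_\<aa> basis_A1 basis_\<cc> span_superset[of "B\<^sub>\<aa>"] span_superset[of "B\<^sub>\<cc>"]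
    span_superset[of "B\<^sub>1"] span_superset[of "B\<^sub>\<aa> \<union> B\<^sub>\<cc>"]
  by (simp_all add: is_basis_def span_even_basis)

lemma B_disjoint: "B\<^sub>\<aa> \<inter> B\<^sub>\<cc> = {}" "B\<^sub>\<aa> \<inter> B\<^sub>1 = {}" "B\<^sub>\<cc> \<inter> B\<^sub>1 = {}"
proof -
  have *: "S \<inter> T = {}" if "S \<subseteq> V" "T \<subseteq> W" "V \<inter> W = {0}" "0 \<notin> S" for S T V W :: "'a set"
    using Int_mono[OF that(1,2)] that(3,4) by auto
  have "0 \<notin> B\<^sub>\<aa>" "0 \<notin> B\<^sub>\<cc>" using zero_notin_basis by (auto simp: basis_def)
  then show "B\<^sub>\<aa> \<inter> B\<^sub>\<cc> = {}" "B\<^sub>\<aa> \<inter> B\<^sub>1 = {}" "B\<^sub>\<cc> \<inter> B\<^sub>1 = {}"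
    using *[OF B_sub(1,4) \<aa>_Int_\<cc>] *[OF B_sub(2,5) A0_Int_A1] *[OF B_sub(3,5) A0_Int_A1] by simp_all
qed

abbreviation rep :: "'a \<Rightarrow> 'a \<Rightarrow> 'k" where
  "rep \<equiv> representation basis"

lemma rep_add: "rep (x + y) b = rep x b + rep y b"
  using representation_add[OF independent_basis] span_basis by simp

lemma rep_scale: "rep (scale c x) b = c * rep x b"
  using representation_scale[OF independent_basis] span_basis by simp

lemma rep_zero: "rep 0 b = 0"
  by (simp add: representation_zero)

text \<open>Through this lemma, membership in \<open>\<aa>\<close>, \<open>A0\<close> or
  \<open>A1\<close> becomes the vanishing of coordinates.\<close>

lemma rep_subspace:
  assumes "x \<in> span C" "C \<subseteq> basis" "b \<notin> C"
  shows "rep x b = 0"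
  using representation_extend[OF independent_basis assms(1,2)] representation_ne_zero[of C x b] assms(3)
  by metis

lemma rep_\<aa>: "x \<in> \<aa> \<Longrightarrow> b \<notin> B\<^sub>\<aa> \<Longrightarrow> rep x b = 0"
  using rep_subspace[of x "B\<^sub>\<aa>" b] basis_\<aa> by (auto simp: is_basis_def basis_def)

lemma rep_A0: "x \<in> A0 \<Longrightarrow> b \<in> B\<^sub>1 \<Longrightarrow> rep x b = 0"
  using rep_subspace[of x "B\<^sub>\<aa> \<union> B\<^sub>\<cc>" b] B_disjoint span_even_basis by (auto simp: basis_def)

lemma rep_A1: "x \<in> A1 \<Longrightarrow> b \<notin> B\<^sub>1 \<Longrightarrow> rep x b = 0"
  using rep_subspace[of x "B\<^sub>1" b] basis_A1 by (auto simp: is_basis_def basis_def)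

lemma rep_even_part: "rep (even_part x) b = (if b \<in> B\<^sub>1 then 0 else rep x b)"
  and rep_odd_part: "rep (odd_part x) b = (if b \<in> B\<^sub>1 then rep x b else 0)"
proof -
  have "rep x b = rep (even_part x) b + rep (odd_part x) b"
    unfolding rep_add[symmetric] by (simp add: odd_part_def)
  then show "rep (even_part x) b = (if b \<in> B\<^sub>1 then 0 else rep x b)"
    "rep (odd_part x) b = (if b \<in> B\<^sub>1 then rep x b else 0)"
    using rep_A0[OF even_part_in] rep_A1[OF odd_part_in] by auto
qed

lemma rep_basis: "b \<in> basis \<Longrightarrow> rep b b' = (if b' = b then 1 else 0)"
  using representation_basis[OF independent_basis] by simp

section \<open>Matrix units with basis entries as a basis of the matrix superalgebra\<close>

definition letters :: "('a \<times> nat \<times> nat) set" where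
  "letters = basis \<times> {..<n} \<times> {..<n}"

text \<open>The value 0 outside the index range, where \<open>$$\<close> is unspecified, confines
  the support to \<open>letters\<close>.\<close>

fun letter_coord :: "'a \<times> nat \<times> nat \<Rightarrow> 'a mat \<Rightarrow> 'k" where
  "letter_coord (b, r, s) X = (if r < n \<and> s < n then rep (X $$ (r, s)) b else 0)"

fun letter_matrix :: "'a \<times> nat \<times> nat \<Rightarrow> 'a mat" where
  "letter_matrix (b, r, s) = matrix_unit n b r s"

lemma letter_matrix_carrier [simp]: "letter_matrix t \<in> carrier_mat n n"
  by (cases t) (simp add: matrix_unit_def)

lemma letter_coord_letters: "letter_coord t X \<noteq> 0 \<Longrightarrow> t \<in> letters"
  by (cases t) (auto simp: letters_def split: if_splits dest: representation_ne_zero)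

lemma finite_letter_coord: "finite {t. letter_coord t X \<noteq> 0}"
proof (rule finite_subset)
  show "{t. letter_coord t X \<noteq> 0} \<subseteq> (\<Union>r<n. \<Union>s<n. {b. rep (X $$ (r, s)) b \<noteq> 0} \<times> {r} \<times> {s})"
    by (auto split: if_splits)
qed (auto intro: finite_representation)

lemma letter_coord_add:
  "X \<in> carrier_mat n n \<Longrightarrow> Y \<in> carrier_mat n n \<Longrightarrow> letter_coord t (X + Y) = letter_coord t X + letter_coord t Y"
  by (cases t) (auto simp: rep_add)

lemma letter_coord_scale: "X \<in> carrier_mat n n \<Longrightarrow> letter_coord t (map_mat (scale c) X) = c * letter_coord t X"
  by (cases t) (auto simp: rep_scale)

lemma letter_coord_part:
  "X \<in> carrier_mat n n \<Longrightarrow> letter_coord t (map_mat (if P then odd_part else even_part) X) =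
    (if (fst t \<in> B\<^sub>1) = P then letter_coord t X else 0)"
  by (cases t) (auto simp: rep_even_part rep_odd_part)

lemma letter_coord_letter_matrix: "t \<in> letters \<Longrightarrow> letter_coord t' (letter_matrix t) = (if t' = t then 1 else 0)"
  by (cases t; cases t') (auto simp: rep_basis letters_def matrix_unit_def rep_zero)

lemma sum_rep: "finite F \<Longrightarrow> {b. rep x b \<noteq> 0} \<subseteq> F \<Longrightarrow> (\<Sum>b\<in>F. scale (rep x b) b) = x"
proof -
  assume F: "finite F" "{b. rep x b \<noteq> 0} \<subseteq> F"
  have "(\<Sum>b\<in>F. scale (rep x b) b) = (\<Sum>b | rep x b \<noteq> 0. scale (rep x b) b)"
    by (rule sum.mono_neutral_right) (use F in auto)
  also have "\<dots> = x" using sum_nonzero_representation_eq[OF independent_basis] span_basis by simp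
  finally show ?thesis .
qed

text \<open>Additivity is only required modulo \<open>R\<close>: the lemma is used for linear functions and for
  a letter of a word modulo the multilinear relations.\<close>

lemma matrix_expansion:
  fixes sc :: "'k \<Rightarrow> 'm::ab_group_add \<Rightarrow> 'm"
  assumes mod: "Modules.module sc" and R: "Modules.module.subspace sc R"
    and add: "\<And>X Y. X \<in> carrier_mat n n \<Longrightarrow> Y \<in> carrier_mat n n \<Longrightarrow> h (X + Y) - h X - h Y \<in> R"
    and scl: "\<And>c X. X \<in> carrier_mat n n \<Longrightarrow> h (map_mat (scale c) X) - sc c (h X) \<in> R"
    and X: "X \<in> carrier_mat n n" and \<Delta>: "finite \<Delta>" "\<Delta> \<subseteq> letters" "{t. letter_coord t X \<noteq> 0} \<subseteq> \<Delta>"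
  shows "h X - (\<Sum>t\<in>\<Delta>. sc (letter_coord t X) (h (letter_matrix t))) \<in> R"
proof -
  interpret m: Modules.module sc by (rule mod)
  \<comment> \<open>The part of \<open>X\<close> formed by the terms with letters in
    \<open>G\<close>; the set \<open>G\<close> grows by one letter at a time until
    \<open>Y \<Delta> = X\<close>.\<close>
  define Y where "Y = (\<lambda>G. mat n n (\<lambda>(i, j). \<Sum>b\<in>{b. (b, i, j) \<in> G}. scale (rep (X $$ (i, j)) b) b))"
  have "h (Y G) - (\<Sum>t\<in>G. sc (letter_coord t X) (h (letter_matrix t))) \<in> R" if "finite G" "G \<subseteq> letters" for G
    using that
  proof (induction G)
    case empty
    have c: "Y {} \<in> carrier_mat n n" by (simp add: Y_def)
    \<comment> \<open>The zero matrix is 0 times itself, so compatibility with scalars alone puts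
      its image under \<open>h\<close> into \<open>R\<close>.\<close>
    have eq: "map_mat (scale 0) (Y {}) = Y {}" by (auto simp: mat_eq_iff Y_def)
    have "h (Y {}) - sc 0 (h (Y {})) \<in> R" using scl[OF c, of 0] unfolding eq .
    then show ?case by (simp only: m.scale_zero_left sum.empty)
  next
    case (insert t G)
    obtain b r s where t: "t = (b, r, s)" by (cases t)
    have rs: "r < n" "s < n" using insert.prems t by (auto simp: letters_def)
    have fin: "finite {b. (b, i, j) \<in> G}" for i j
      by (rule finite_subset[of _ "fst ` G"]) (use insert.hyps in force)+
    have Yi: "Y (insert t G) = Y G + map_mat (scale (letter_coord t X)) (letter_matrix t)"
    proof (rule eq_matI)
      fix i j assume "i < dim_row (Y G + map_mat (scale (letter_coord t X)) (letter_matrix t))"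
        "j < dim_col (Y G + map_mat (scale (letter_coord t X)) (letter_matrix t))"
      then have ij: "i < n" "j < n" by (simp_all add: t matrix_unit_def)
      have "(\<Sum>c\<in>{c. (c, i, j) \<in> insert t G}. scale (rep (X $$ (i, j)) c) c) =
        (\<Sum>c\<in>{c. (c, i, j) \<in> G}. scale (rep (X $$ (i, j)) c) c) +
        scale (rep (X $$ (r, s)) b) (if i = r \<and> j = s then b else 0)"
      proof (cases "i = r \<and> j = s")
        case True
        then have "{c. (c, i, j) \<in> insert t G} = insert b {c. (c, i, j) \<in> G}" using t by auto
        moreover have "b \<notin> {c. (c, i, j) \<in> G}" using insert.hyps t True by auto
        ultimately show ?thesis using fin[of i j] True by (simp add: add.commute)
      next
        case False
        then have "{c. (c, i, j) \<in> insert t G} = {c. (c, i, j) \<in> G}" using t by auto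
        then show ?thesis using False by auto
      qed
      then show "Y (insert t G) $$ (i, j) = (Y G + map_mat (scale (letter_coord t X)) (letter_matrix t)) $$ (i, j)"
        using ij rs by (simp add: t matrix_unit_def Y_def)
    qed (auto simp: t matrix_unit_def Y_def)
    have a: "h (Y G + map_mat (scale (letter_coord t X)) (letter_matrix t)) - h (Y G)
        - h (map_mat (scale (letter_coord t X)) (letter_matrix t)) \<in> R" (is "?a \<in> R") by (rule add) (simp_all add: Y_def)
    have b: "h (map_mat (scale (letter_coord t X)) (letter_matrix t)) - sc (letter_coord t X) (h (letter_matrix t)) \<in> R" (is "?b \<in> R")
      by (rule scl) simp
    have c: "h (Y G) - (\<Sum>t\<in>G. sc (letter_coord t X) (h (letter_matrix t))) \<in> R" (is "?c \<in> R")
      using insert by simp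
    have "h (Y (insert t G)) - (\<Sum>t\<in>insert t G. sc (letter_coord t X) (h (letter_matrix t))) = ?a + ?b + ?c"
      unfolding Yi using insert.hyps by simp
    then show ?case using m.subspace_add[OF R m.subspace_add[OF R a b] c] by simp
  qed
  from this[OF \<Delta>(1,2)] have "h (Y \<Delta>) - (\<Sum>t\<in>\<Delta>. sc (letter_coord t X) (h (letter_matrix t))) \<in> R" .
  moreover have "Y \<Delta> = X"
  proof (rule eq_matI)
    fix i j assume "i < dim_row X" "j < dim_col X"
    then have ij: "i < n" "j < n" using X by auto
    have "finite {b. (b, i, j) \<in> \<Delta>}"
      by (rule finite_subset[of _ "fst ` \<Delta>"]) (use \<Delta> in force)+
    moreover have "{b. rep (X $$ (i, j)) b \<noteq> 0} \<subseteq> {b. (b, i, j) \<in> \<Delta>}"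
      using \<Delta>(3) ij by force
    ultimately show "Y \<Delta> $$ (i, j) = X $$ (i, j)" using ij sum_rep by (simp add: Y_def)
  qed (use X in \<open>auto simp: Y_def\<close>)
  ultimately show ?thesis by simp
qed

text \<open>The structure constants of the matrix algebra in the basis indexed by
  \<open>letters\<close>: the coefficient of \<open>t\<close> in the product of \<open>u\<close> and
  \<open>v\<close>.\<close>

definition \<kappa> :: "'a \<times> nat \<times> nat \<Rightarrow> 'a \<times> nat \<times> nat \<Rightarrow> 'a \<times> nat \<times> nat \<Rightarrow> 'k" where
  "\<kappa> t u v = letter_coord t (letter_matrix u * letter_matrix v)"

text \<open>A product of two matrix units is 0 or the matrix unit carrying the product of their
  entries. Only the condition on the entries is retained, because the divisibility argument looks at
  rows and columns no further.\<close>

lemma \<kappa>_nonzero: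
  assumes "\<kappa> t u v \<noteq> 0"
  shows "rep (fst u * fst v) (fst t) \<noteq> 0"
proof -
  obtain b r s where t: "t = (b, r, s)" by (cases t)
  obtain b1 r1 s1 where u: "u = (b1, r1, s1)" by (cases u)
  obtain b2 r2 s2 where v: "v = (b2, r2, s2)" by (cases v)
  have rs: "r < n" "s < n" and ne: "rep ((letter_matrix u * letter_matrix v) $$ (r, s)) b \<noteq> 0"
    using assms by (auto simp: \<kappa>_def t split: if_splits)
  have "(letter_matrix u * letter_matrix v) $$ (r, s) =
      (\<Sum>i<n. (if r = r1 \<and> i = s1 then b1 else 0) * (if i = r2 \<and> s = s2 then b2 else 0))"
    using rs by (simp add: u v matrix_unit_def scalar_prod_def atLeast0LessThan)
  also have "\<dots> = (\<Sum>i<n. if i = s1 then (if r = r1 \<and> s1 = r2 \<and> s = s2 then b1 * b2 else 0) else 0)"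
    by (rule sum.cong) auto
  also have "\<dots> \<in> {0, b1 * b2}" by (simp add: sum.delta)
  finally show ?thesis using ne by (auto simp: t u v rep_zero)
qed

text \<open>\<open>matrix_expansion\<close> is applied to one factor after the other, with the
  scalars as target module and \<open>R = {0}\<close>, so that congruence modulo \<open>R\<close> is
  equality.\<close>

lemma letter_coord_mult:
  assumes X: "X \<in> carrier_mat n n" and Y: "Y \<in> carrier_mat n n" and \<Delta>: "finite \<Delta>" "\<Delta> \<subseteq> letters"
    and X\<Delta>: "{t. letter_coord t X \<noteq> 0} \<subseteq> \<Delta>" and Y\<Delta>: "{t. letter_coord t Y \<noteq> 0} \<subseteq> \<Delta>"
  shows "letter_coord t (X * Y) = (\<Sum>u\<in>\<Delta>. \<Sum>v\<in>\<Delta>. letter_coord u X * letter_coord v Y * \<kappa> t u v)"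
proof -
  interpret m: Modules.module "(*) :: 'k \<Rightarrow> 'k \<Rightarrow> 'k"
    by unfold_locales (auto simp: algebra_simps)
  have mm: "Modules.module ((*) :: 'k \<Rightarrow> 'k \<Rightarrow> 'k)" by unfold_locales
  have sl: "map_mat (scale c) X * Y = map_mat (scale c) (X * Y)"
    if "X \<in> carrier_mat n n" "Y \<in> carrier_mat n n" for c X Y
    using that by (auto intro!: eq_matI simp: scalar_prod_def scale_mult_left scale_sum_right)
  have sr: "X * map_mat (scale c) Y = map_mat (scale c) (X * Y)"
    if "X \<in> carrier_mat n n" "Y \<in> carrier_mat n n" for c X Y
    using that by (auto intro!: eq_matI simp: scalar_prod_def scale_mult_right scale_sum_right)
  have left: "letter_coord t (X * Y) = (\<Sum>u\<in>\<Delta>. letter_coord u X * letter_coord t (letter_matrix u * Y))"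
  proof -
    have "letter_coord t (X * Y) - (\<Sum>u\<in>\<Delta>. letter_coord u X * letter_coord t (letter_matrix u * Y)) \<in> {0}"
      by (rule matrix_expansion[OF mm m.subspace_single_0 _ _ X \<Delta> X\<Delta>, of "\<lambda>X. letter_coord t (X * Y)"])
        (use Y in \<open>auto simp: sl letter_coord_scale add_mult_distrib_mat[of _ n n] letter_coord_add mult_carrier_mat[of _ n n _ n]\<close>)
    then show ?thesis by simp
  qed
  have right: "letter_coord t (letter_matrix u * Y) = (\<Sum>v\<in>\<Delta>. letter_coord v Y * letter_coord t (letter_matrix u * letter_matrix v))" for u
  proof -
    have "letter_coord t (letter_matrix u * Y) - (\<Sum>v\<in>\<Delta>. letter_coord v Y * letter_coord t (letter_matrix u * letter_matrix v)) \<in> {0}"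
      by (rule matrix_expansion[OF mm m.subspace_single_0 _ _ Y \<Delta> Y\<Delta>, of "\<lambda>X. letter_coord t (letter_matrix u * X)"])
        (use Y in \<open>auto simp: sr letter_coord_scale mult_add_distrib_mat[of _ n n] letter_coord_add mult_carrier_mat[of _ n n _ n]\<close>)
    then show ?thesis by simp
  qed
  show ?thesis unfolding left right \<kappa>_def by (simp add: sum_distrib_left)
qed

end

section \<open>Coordinates of tensors\<close>

lemma lookup_fscale: "Poly_Mapping.lookup (fscale c x) k = c * Poly_Mapping.lookup x k"
  by (simp add: fscale_def Poly_Mapping.map.rep_eq when_def)

lemma module_fscale: "Modules.module (fscale :: 'k::comm_ring_1 \<Rightarrow> ('w \<Rightarrow>\<^sub>0 'k) \<Rightarrow> _)"
  by unfold_locales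
    (auto intro!: poly_mapping_eqI simp: lookup_fscale lookup_add algebra_simps)

interpretation fs: Modules.module "fscale :: 'k::comm_ring_1 \<Rightarrow> ('w \<Rightarrow>\<^sub>0 'k) \<Rightarrow> _"
  by (rule module_fscale)

lemma fscale_single: "fscale c (Poly_Mapping.single w a) = Poly_Mapping.single w (c * a)"
  by (rule poly_mapping_eqI) (simp add: lookup_fscale lookup_single when_def)

lemma sum_fscale_single:
  "(\<Sum>w\<in>Poly_Mapping.keys x. fscale (Poly_Mapping.lookup x w) (Poly_Mapping.single w 1)) = x"
proof (rule poly_mapping_eqI)
  fix k
  have "(\<Sum>w\<in>Poly_Mapping.keys x. Poly_Mapping.lookup x w * (if w = k then 1 else 0)) =
      (\<Sum>w\<in>Poly_Mapping.keys x. if w = k then Poly_Mapping.lookup x w else 0)"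
    by (rule sum.cong) auto
  then show "Poly_Mapping.lookup (\<Sum>w\<in>Poly_Mapping.keys x.
      fscale (Poly_Mapping.lookup x w) (Poly_Mapping.single w 1)) k = Poly_Mapping.lookup x k"
    by (simp add: lookup_sum lookup_fscale lookup_single when_def sum.delta in_keys_iff)
qed

context superalgebra
begin

lemma free_on_words_subspace: "Modules.module.subspace fscale (free_on_words n d)"
  unfolding fs.subspace_def free_on_words_def
proof (intro conjI ballI allI; clarsimp)
  fix x y :: "'a mat list \<Rightarrow>\<^sub>0 'k" and w
  assume "Poly_Mapping.keys x \<subseteq> words n d" "Poly_Mapping.keys y \<subseteq> words n d"
    "w \<in> Poly_Mapping.keys (x + y)"
  then show "w \<in> words n d" using Poly_Mapping.keys_add[of x y] by auto
next
  fix c and x :: "'a mat list \<Rightarrow>\<^sub>0 'k" and w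
  assume "Poly_Mapping.keys x \<subseteq> words n d" "w \<in> Poly_Mapping.keys (fscale c x)"
  then show "w \<in> words n d" by (auto simp: in_keys_iff lookup_fscale)
qed

lemmas free_add = fs.subspace_add[OF free_on_words_subspace]
  and free_fscale = fs.subspace_scale[OF free_on_words_subspace]
  and free_sum = fs.subspace_sum[OF free_on_words_subspace]
  and free_zero = fs.subspace_0[OF free_on_words_subspace]

lemma free_word: "w \<in> words n d \<Longrightarrow> word w \<in> free_on_words n d"
  by (simp add: free_on_words_def)

lemma free_linear_extension:
  assumes "x \<in> free_on_words n d" "\<And>w. w \<in> words n d \<Longrightarrow> f w \<in> free_on_words n d"
  shows "linear_extension f x \<in> free_on_words n d"
  using assms unfolding linear_extension_def free_on_words_def[of n d, THEN eq_reflection, symmetric]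
  by (intro free_sum free_fscale) (auto simp: free_on_words_def)

lemma component_words: "w \<in> words n d \<Longrightarrow> component d P w \<in> words n d"
  by (auto simp: words_def component_def intro: nth_mem[THEN rev_subsetD])

lemma free_word_act: "\<sigma> permutes {..<d} \<Longrightarrow> w \<in> words n d \<Longrightarrow> word_act d \<sigma> w \<in> free_on_words n d"
  unfolding word_act_def
  by (intro free_sum free_fscale free_word)
    (use component_words[of w n d] in \<open>auto simp: words_def\<close>)

lemma free_word_mult:
  assumes "v \<in> words n d" "w \<in> words n d"
  shows "word_mult d v w \<in> free_on_words n d"
  unfolding word_mult_def
proof (intro free_sum free_fscale free_word)
  fix P Q
  have "component d P v \<in> words n d" "component d Q w \<in> words n d" using assms component_words by auto
  then show "map2 (*) (component d P v) (component d Q w) \<in> words n d"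
    by (auto simp: words_def intro!: mult_carrier_mat[of _ n n _ n] dest: set_zip_leftD set_zip_rightD)
qed

lemma free_free_mult:
  "x \<in> free_on_words n d \<Longrightarrow> y \<in> free_on_words n d \<Longrightarrow> free_mult d x y \<in> free_on_words n d"
  unfolding free_mult_def by (intro free_linear_extension free_word_mult)

end

context schur_setup
begin

text \<open>Indices are functions instead of lists, so that permutations act by composition.\<close>

definition Ind :: "('a \<times> nat \<times> nat) set \<Rightarrow> (nat \<Rightarrow> 'a \<times> nat \<times> nat) set" where
  "Ind \<Delta> = PiE {..<d} (\<lambda>_. \<Delta>)"

lemma finite_Ind: "finite \<Delta> \<Longrightarrow> finite (Ind \<Delta>)"
  by (simp add: Ind_def finite_PiE)

lemma Ind_mono: "\<Delta> \<subseteq> \<Delta>' \<Longrightarrow> Ind \<Delta> \<subseteq> Ind \<Delta>'"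
  by (auto simp: Ind_def)

lemma Ind_nth: "\<beta> \<in> Ind \<Delta> \<Longrightarrow> k < d \<Longrightarrow> \<beta> k \<in> \<Delta>"
  by (auto simp: Ind_def)

lemma Ind_permute: "\<sigma> permutes {..<d} \<Longrightarrow> \<beta> \<in> Ind \<Delta> \<Longrightarrow> \<beta> \<circ> \<sigma> \<in> Ind \<Delta>"
  using permutes_in_image[of \<sigma> "{..<d}"] by (auto simp: Ind_def PiE_def extensional_def permutes_not_in)

definition odds :: "(nat \<Rightarrow> 'a \<times> nat \<times> nat) \<Rightarrow> nat set" where
  "odds \<beta> = {k. k < d \<and> fst (\<beta> k) \<in> B\<^sub>1}"

lemma odds_sub: "odds \<beta> \<subseteq> {..<d}"
  by (auto simp: odds_def)

lemma odds_permute: "\<sigma> permutes {..<d} \<Longrightarrow> odds (\<beta> \<circ> \<sigma>) = {k. \<sigma> k \<in> odds \<beta>}"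
  using permutes_in_image[of \<sigma> "{..<d}"] by (auto simp: odds_def)

text \<open>Members of \<open>Ind letters\<close> are \<open>undefined\<close> outside
  \<open>{..<d}\<close>, so every word of letters has one index only. The value 0 elsewhere allows
  tensors to be compared by equality of functions on the whole type.\<close>

definition word_coord :: "'a mat list \<Rightarrow> (nat \<Rightarrow> 'a \<times> nat \<times> nat) \<Rightarrow> 'k" where
  "word_coord w \<beta> = (if \<beta> \<in> Ind letters then \<Prod>k<d. letter_coord (\<beta> k) (w ! k) else 0)"

definition \<Phi> :: "('a mat list \<Rightarrow>\<^sub>0 'k) \<Rightarrow> (nat \<Rightarrow> 'a \<times> nat \<times> nat) \<Rightarrow> 'k" where
  "\<Phi> x \<beta> = (\<Sum>w\<in>Poly_Mapping.keys x. Poly_Mapping.lookup x w * word_coord w \<beta>)"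

lemma \<Phi>_superset:
  "finite S \<Longrightarrow> Poly_Mapping.keys x \<subseteq> S \<Longrightarrow> \<Phi> x \<beta> = (\<Sum>w\<in>S. Poly_Mapping.lookup x w * word_coord w \<beta>)"
  unfolding \<Phi>_def by (rule sum.mono_neutral_left) (auto simp: in_keys_iff)

lemma \<Phi>_add: "\<Phi> (x + y) = \<Phi> x + \<Phi> y"
proof
  fix \<beta>
  let ?S = "Poly_Mapping.keys x \<union> Poly_Mapping.keys y"
  have "Poly_Mapping.keys (x + y) \<subseteq> ?S" by (rule Poly_Mapping.keys_add)
  then show "\<Phi> (x + y) \<beta> = (\<Phi> x + \<Phi> y) \<beta>"
    by (simp add: \<Phi>_superset[of ?S] lookup_add sum.distrib algebra_simps)
qed

lemma \<Phi>_fscale: "\<Phi> (fscale c x) \<beta> = c * \<Phi> x \<beta>"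
proof -
  have "Poly_Mapping.keys (fscale c x) \<subseteq> Poly_Mapping.keys x" by (auto simp: in_keys_iff lookup_fscale)
  then show ?thesis
    by (simp add: \<Phi>_superset[of "Poly_Mapping.keys x"] lookup_fscale sum_distrib_left mult.assoc)
qed

lemma \<Phi>_zero: "\<Phi> 0 = 0"
  by (simp add: fun_eq_iff \<Phi>_def)

lemma \<Phi>_diff: "\<Phi> (x - y) = \<Phi> x - \<Phi> y"
  using \<Phi>_add[of "x - y" y] by simp

lemma \<Phi>_sum: "\<Phi> (\<Sum>i\<in>I. f i) = (\<Sum>i\<in>I. \<Phi> (f i))"
  by (induction I rule: infinite_finite_induct) (auto simp: \<Phi>_zero \<Phi>_add)

lemma \<Phi>_word: "\<Phi> (word w) \<beta> = word_coord w \<beta>"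
  by (simp add: \<Phi>_def)

lemma sum_fun_apply: "(\<Sum>i\<in>I. f i) \<beta> = (\<Sum>i\<in>I. f i \<beta> :: 'k)"
  by (induction I rule: infinite_finite_induct) auto

lemma \<Phi>_linear_extension:
  "\<Phi> (linear_extension f x) \<beta> =
    (\<Sum>w\<in>Poly_Mapping.keys x. Poly_Mapping.lookup x w * \<Phi> (f w) \<beta>)"
  by (simp add: linear_extension_def \<Phi>_sum sum_fun_apply \<Phi>_fscale)

text \<open>The second factor contains an arbitrary \<open>Z\<close>, so that words differing only
  at this position share it and linearity in that letter becomes visible.\<close>

lemma word_coord_split:
  assumes "length us + length vs + 1 = d" "\<beta> \<in> Ind letters"
  shows "word_coord (us @ X # vs) \<beta> = letter_coord (\<beta> (length us)) X *
    (\<Prod>k\<in>{..<d} - {length us}. letter_coord (\<beta> k) ((us @ Z # vs) ! k))"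
proof -
  have "word_coord (us @ X # vs) \<beta> = letter_coord (\<beta> (length us)) ((us @ X # vs) ! length us) *
     (\<Prod>k\<in>{..<d} - {length us}. letter_coord (\<beta> k) ((us @ X # vs) ! k))"
    using assms by (simp add: word_coord_def prod.remove[of "{..<d}" "length us"])
  moreover have "(us @ X # vs) ! k = (us @ Z # vs) ! k" if "k \<noteq> length us" for k
    using that by (simp add: nth_append nth_Cons split: nat.split)
  ultimately show ?thesis by simp
qed

lemma \<Phi>_relations:
  assumes "x \<in> multilinear_relations n d"
  shows "\<Phi> x = 0"
proof -
  let ?N = "{x. \<Phi> x = 0}"
  have "multilinear_relations n d \<subseteq> ?N"
    unfolding multilinear_relations_def
  proof (rule fs.span_minimal)
    show "fs.subspace ?N"
      by (auto simp: fs.subspace_def \<Phi>_zero \<Phi>_add \<Phi>_fscale fun_eq_iff)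
    have 1: "\<Phi> (word (us @ (X + Y) # vs) - word (us @ X # vs) - word (us @ Y # vs)) \<beta> = 0"
      if "us @ X # vs \<in> words n d" "us @ Y # vs \<in> words n d" for us X Y vs \<beta>
    proof (cases "\<beta> \<in> Ind letters")
      case True
      have d: "length us + length vs + 1 = d" and XY: "X \<in> carrier_mat n n" "Y \<in> carrier_mat n n"
        using that by (auto simp: words_def)
      show ?thesis
        unfolding \<Phi>_diff fun_diff_def \<Phi>_word word_coord_split[OF d True, of _ X] letter_coord_add[OF XY]
        by (simp add: algebra_simps)
    next
      case False
      then show ?thesis by (simp add: \<Phi>_diff \<Phi>_word word_coord_def)
    qed
    have 2: "\<Phi> (word (us @ map_mat (scale c) X # vs) - fscale c (word (us @ X # vs))) \<beta> = 0"
      if "us @ X # vs \<in> words n d" for us X c vs \<beta>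
    proof (cases "\<beta> \<in> Ind letters")
      case True
      have d: "length us + length vs + 1 = d" and X: "X \<in> carrier_mat n n"
        using that by (auto simp: words_def)
      show ?thesis
        unfolding \<Phi>_diff fun_diff_def \<Phi>_fscale \<Phi>_word word_coord_split[OF d True, of _ X] letter_coord_scale[OF X]
        by (simp add: algebra_simps)
    next
      case False
      then show ?thesis by (simp add: \<Phi>_diff \<Phi>_fscale \<Phi>_word word_coord_def)
    qed
    show "{word (us @ (X + Y) # vs) - word (us @ X # vs) - word (us @ Y # vs) | us X Y vs.
         us @ X # vs \<in> words n d \<and> us @ Y # vs \<in> words n d} \<union>
      {word (us @ map_mat (scale c) X # vs) - fscale c (word (us @ X # vs)) | c us X vs.
         us @ X # vs \<in> words n d} \<subseteq> ?N"
      using 1 2 by (auto simp: fun_eq_iff)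
  qed
  then show ?thesis using assms by auto
qed

lemma relations_subspace: "Modules.module.subspace fscale (multilinear_relations n d)"
  unfolding multilinear_relations_def by (rule fs.subspace_span)

text \<open>The basis may be infinite; a finite \<Delta> that contains all letters occurring in a
  word keeps the sums over \<open>Ind \<Delta>\<close> finite.\<close>

definition supports :: "('a \<times> nat \<times> nat) set \<Rightarrow> 'a mat list \<Rightarrow> bool" where
  "supports \<Delta> w \<longleftrightarrow> finite \<Delta> \<and> \<Delta> \<subseteq> letters \<and> (\<forall>X\<in>set w. {t. letter_coord t X \<noteq> 0} \<subseteq> \<Delta>)"

lemma ex_supports:
  assumes "finite W"
  shows "\<exists>\<Delta>. finite \<Delta> \<and> \<Delta> \<subseteq> letters \<and> (\<forall>w\<in>W. supports \<Delta> w)"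
proof -
  let ?D = "\<Union>w\<in>W. \<Union>X\<in>set w. {t. letter_coord t X \<noteq> 0}"
  have "finite ?D" using assms finite_letter_coord by blast
  moreover have "?D \<subseteq> letters" using letter_coord_letters by auto
  ultimately show ?thesis by (intro exI[of _ ?D]) (auto simp: supports_def)
qed

lemma expand_position:
  assumes w: "us @ X # vs \<in> words n d" and \<Delta>: "finite \<Delta>" "\<Delta> \<subseteq> letters" "{t. letter_coord t X \<noteq> 0} \<subseteq> \<Delta>"
  shows "word (us @ X # vs) - (\<Sum>t\<in>\<Delta>. fscale (letter_coord t X) (word (us @ letter_matrix t # vs))) \<in> multilinear_relations n d"
proof (rule matrix_expansion[OF module_fscale relations_subspace, of "\<lambda>X. word (us @ X # vs)"])
  have *: "us @ Y # vs \<in> words n d" if "Y \<in> carrier_mat n n" for Y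
    using w that by (auto simp: words_def)
  show "word (us @ (X + Y) # vs) - word (us @ X # vs) - word (us @ Y # vs) \<in> multilinear_relations n d"
    if "X \<in> carrier_mat n n" "Y \<in> carrier_mat n n" for X Y
    unfolding multilinear_relations_def by (rule fs.span_base) (use * that in blast)
  show "word (us @ map_mat (scale c) X # vs) - fscale c (word (us @ X # vs)) \<in> multilinear_relations n d"
    if "X \<in> carrier_mat n n" for c X
    unfolding multilinear_relations_def by (rule fs.span_base) (use * that in blast)
qed (use w \<Delta> in \<open>auto simp: words_def\<close>)

definition basis_word :: "(nat \<Rightarrow> 'a \<times> nat \<times> nat) \<Rightarrow> 'a mat list" where
  "basis_word \<beta> = map (\<lambda>k. letter_matrix (\<beta> k)) [0..<d]"

lemma basis_word_words: "basis_word \<beta> \<in> words n d"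
  by (auto simp: basis_word_def words_def)

text \<open>The matrices are expanded from left to right: after \<open>j\<close> steps the first
  \<open>j\<close> entries of each word are basis letters and the others are unchanged. Each step
  alters the sum only by multilinear relations.\<close>

lemma expand_word:
  assumes w: "w \<in> words n d" and \<Delta>: "supports \<Delta> w"
  shows "word w - (\<Sum>\<beta>\<in>Ind \<Delta>. fscale (word_coord w \<beta>) (word (basis_word \<beta>))) \<in> multilinear_relations n d"
proof -
  let ?R = "multilinear_relations n d"
  have fin: "finite \<Delta>" "\<Delta> \<subseteq> letters" using \<Delta> by (auto simp: supports_def)
  have len: "length w = d" using w by (simp add: words_def)
  let ?c = "\<lambda>j \<beta>. \<Prod>k<j. letter_coord (\<beta> k) (w ! k)"
  let ?v = "\<lambda>j \<beta>. map (\<lambda>k. letter_matrix (\<beta> k)) [0..<j]"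
  have "word w - (\<Sum>\<beta>\<in>PiE {..<j} (\<lambda>_. \<Delta>). fscale (?c j \<beta>) (word (?v j \<beta> @ drop j w))) \<in> ?R"
    if "j \<le> d" for j
    using that
  proof (induction j)
    case 0
    then show ?case using fs.subspace_0[OF relations_subspace] by simp
  next
    case (Suc j)
    let ?P = "PiE {..<j} (\<lambda>_. \<Delta>)"
    have drop: "drop j w = w ! j # drop (Suc j) w" using Suc.prems len by (simp add: Cons_nth_drop_Suc)
    let ?x = "\<lambda>\<beta>. \<Sum>t\<in>\<Delta>. fscale (letter_coord t (w ! j)) (word (?v j \<beta> @ letter_matrix t # drop (Suc j) w))"
    have pos: "word (?v j \<beta> @ drop j w) - ?x \<beta> \<in> ?R" if "\<beta> \<in> ?P" for \<beta>
      unfolding drop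
    proof (rule expand_position[OF _ fin])
      show "?v j \<beta> @ w ! j # drop (Suc j) w \<in> words n d"
        using w Suc.prems by (auto simp: words_def dest: in_set_dropD)
      show "{t. letter_coord t (w ! j) \<noteq> 0} \<subseteq> \<Delta>" using \<Delta> Suc.prems len by (auto simp: supports_def)
    qed
    have "(\<Sum>\<beta>\<in>?P. fscale (?c j \<beta>) (word (?v j \<beta> @ drop j w) - ?x \<beta>)) \<in> ?R"
      by (intro fs.subspace_sum[OF relations_subspace] fs.subspace_scale[OF relations_subspace] pos)
    moreover have "word w - (\<Sum>\<beta>\<in>?P. fscale (?c j \<beta>) (word (?v j \<beta> @ drop j w))) \<in> ?R"
      using Suc by simp
    ultimately have "(word w - (\<Sum>\<beta>\<in>?P. fscale (?c j \<beta>) (word (?v j \<beta> @ drop j w)))) +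
        (\<Sum>\<beta>\<in>?P. fscale (?c j \<beta>) (word (?v j \<beta> @ drop j w) - ?x \<beta>)) \<in> ?R"
      by (intro fs.subspace_add[OF relations_subspace])
    then have *: "word w - (\<Sum>\<beta>\<in>?P. fscale (?c j \<beta>) (?x \<beta>)) \<in> ?R"
      by (simp add: fs.scale_right_diff_distrib sum_subtractf)
    \<comment> \<open>An index on \<open>{..<Suc j}\<close> is a letter at place \<open>j\<close>
      together with an index on \<open>{..<j}\<close>.\<close>
    have "(\<Sum>\<beta>\<in>PiE {..<Suc j} (\<lambda>_. \<Delta>). fscale (?c (Suc j) \<beta>) (word (?v (Suc j) \<beta> @ drop (Suc j) w))) =
      (\<Sum>(t, \<beta>)\<in>\<Delta> \<times> ?P. fscale (?c (Suc j) (\<beta>(j := t))) (word (?v (Suc j) (\<beta>(j := t)) @ drop (Suc j) w)))"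
      unfolding lessThan_Suc PiE_insert_eq
      by (subst sum.reindex[OF inj_combinator]) (auto simp: case_prod_unfold)
    also have "\<dots> = (\<Sum>(t, \<beta>)\<in>\<Delta> \<times> ?P. fscale (?c j \<beta>) (fscale (letter_coord t (w ! j)) (word (?v j \<beta> @ letter_matrix t # drop (Suc j) w))))"
    proof (rule sum.cong[OF refl], clarify)
      fix t \<beta>
      have "?c (Suc j) (\<beta>(j := t)) = ?c j \<beta> * letter_coord t (w ! j)" by simp
      moreover have "?v (Suc j) (\<beta>(j := t)) @ drop (Suc j) w = ?v j \<beta> @ letter_matrix t # drop (Suc j) w" by simp
      ultimately show "fscale (?c (Suc j) (\<beta>(j := t))) (word (?v (Suc j) (\<beta>(j := t)) @ drop (Suc j) w)) =
        fscale (?c j \<beta>) (fscale (letter_coord t (w ! j)) (word (?v j \<beta> @ letter_matrix t # drop (Suc j) w)))"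
        by (simp only: fs.scale_scale)
    qed
    also have "\<dots> = (\<Sum>\<beta>\<in>?P. fscale (?c j \<beta>) (?x \<beta>))"
      unfolding sum.cartesian_product[symmetric] by (subst sum.swap) (simp add: fs.scale_sum_right)
    finally show ?case using * by simp
  qed
  from this[of d] have "word w - (\<Sum>\<beta>\<in>Ind \<Delta>. fscale (?c d \<beta>) (word (basis_word \<beta>))) \<in> ?R"
    using len by (simp add: Ind_def basis_word_def)
  moreover have "?c d \<beta> = word_coord w \<beta>" if "\<beta> \<in> Ind \<Delta>" for \<beta>
    using that Ind_mono[OF fin(2)] by (auto simp: word_coord_def)
  ultimately show ?thesis by (simp cong: sum.cong)
qed

text \<open>By \<open>expand_word\<close>, modulo the relations \<open>x\<close> is the combination
  of basis words with coefficients \<open>\<Phi> x \<beta>\<close>, so it is itself a relation once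
  these vanish. Hence passing to coordinates loses nothing.\<close>

lemma \<Phi>_eq_zero_iff:
  assumes x: "x \<in> free_on_words n d"
  shows "\<Phi> x = 0 \<longleftrightarrow> x \<in> multilinear_relations n d"
proof
  assume 0: "\<Phi> x = 0"
  let ?R = "multilinear_relations n d" and ?K = "Poly_Mapping.keys x"
  obtain \<Delta> where \<Delta>: "finite \<Delta>" "\<Delta> \<subseteq> letters" "\<And>w. w \<in> ?K \<Longrightarrow> supports \<Delta> w"
    using ex_supports[of ?K] by auto
  have kw: "?K \<subseteq> words n d" using x by (simp add: free_on_words_def)
  have "(\<Sum>w\<in>?K. fscale (Poly_Mapping.lookup x w)
     (word w - (\<Sum>\<beta>\<in>Ind \<Delta>. fscale (word_coord w \<beta>) (word (basis_word \<beta>))))) \<in> ?R"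
    by (intro fs.subspace_sum[OF relations_subspace] fs.subspace_scale[OF relations_subspace] expand_word)
      (use kw \<Delta> in auto)
  also have "(\<Sum>w\<in>?K. fscale (Poly_Mapping.lookup x w)
     (word w - (\<Sum>\<beta>\<in>Ind \<Delta>. fscale (word_coord w \<beta>) (word (basis_word \<beta>))))) =
     x - (\<Sum>w\<in>?K. \<Sum>\<beta>\<in>Ind \<Delta>. fscale (Poly_Mapping.lookup x w * word_coord w \<beta>) (word (basis_word \<beta>)))"
    by (simp add: fs.scale_right_diff_distrib sum_subtractf sum_fscale_single fs.scale_sum_right)
  also have "(\<Sum>w\<in>?K. \<Sum>\<beta>\<in>Ind \<Delta>. fscale (Poly_Mapping.lookup x w * word_coord w \<beta>) (word (basis_word \<beta>))) =
     (\<Sum>\<beta>\<in>Ind \<Delta>. fscale (\<Phi> x \<beta>) (word (basis_word \<beta>)))"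
    by (subst sum.swap) (simp add: \<Phi>_def fs.scale_sum_left)
  finally show "x \<in> ?R" using 0 by simp
qed (rule \<Phi>_relations)

text \<open>From here on the quotient is handled as equality of coordinates: an operation is well
  defined if the coordinates of its result depend only on those of its arguments.\<close>

lemma tensor_rel_iff:
  "(x, y) \<in> tensor_rel n d \<longleftrightarrow>
    x \<in> free_on_words n d \<and> y \<in> free_on_words n d \<and> \<Phi> x = \<Phi> y"
  using \<Phi>_eq_zero_iff[of "x - y"] fs.subspace_diff[OF free_on_words_subspace, of x n d y]
  by (auto simp: tensor_rel_def \<Phi>_diff)

end

section \<open>Action, product and module operations in coordinates\<close>

lemma sum_swap_pairs:
  "(\<Sum>v\<in>V. \<Sum>w\<in>W. \<Sum>x\<in>X. \<Sum>y\<in>Y. f v w x y) =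
    (\<Sum>x\<in>X. \<Sum>y\<in>Y. \<Sum>v\<in>V. \<Sum>w\<in>W. f v w x y)"
proof -
  have "(\<Sum>v\<in>V. \<Sum>w\<in>W. \<Sum>x\<in>X. \<Sum>y\<in>Y. f v w x y) =
      (\<Sum>v\<in>V. \<Sum>x\<in>X. \<Sum>w\<in>W. \<Sum>y\<in>Y. f v w x y)"
    by (rule sum.cong[OF refl], rule sum.swap)
  also have "\<dots> = (\<Sum>x\<in>X. \<Sum>v\<in>V. \<Sum>w\<in>W. \<Sum>y\<in>Y. f v w x y)"
    by (rule sum.swap)
  also have "\<dots> = (\<Sum>x\<in>X. \<Sum>v\<in>V. \<Sum>y\<in>Y. \<Sum>w\<in>W. f v w x y)"
    by (rule sum.cong[OF refl], rule sum.cong[OF refl], rule sum.swap)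
  also have "\<dots> = (\<Sum>x\<in>X. \<Sum>y\<in>Y. \<Sum>v\<in>V. \<Sum>w\<in>W. f v w x y)"
    by (rule sum.cong[OF refl], rule sum.swap)
  finally show ?thesis .
qed

context schur_setup
begin

text \<open>Each letter of a component is purely even or purely odd and has no coordinates of the
  other parity. The sums over all \<open>P\<close> that define the action and the product therefore
  collapse to a single term at each index.\<close>

lemma word_coord_component:
  assumes w: "w \<in> words n d" and P: "P \<subseteq> {..<d}" and \<beta>: "\<beta> \<in> Ind letters"
  shows "word_coord (component d P w) \<beta> = (if P = odds \<beta> then word_coord w \<beta> else 0)"
proof -
  have c: "letter_coord (\<beta> k) (component d P w ! k) = (if (k \<in> odds \<beta>) = (k \<in> P) then letter_coord (\<beta> k) (w ! k) else 0)"
    if "k < d" for k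
  proof -
    have "w ! k \<in> carrier_mat n n" using w that by (auto simp: words_def intro: nth_mem[THEN rev_subsetD])
    then show ?thesis using that by (simp add: component_def letter_coord_part odds_def)
  qed
  show ?thesis
  proof (cases "P = odds \<beta>")
    case True
    then show ?thesis using \<beta> c by (simp add: word_coord_def)
  next
    case False
    then obtain k where k: "k < d" "(k \<in> odds \<beta>) \<noteq> (k \<in> P)" using P odds_sub[of \<beta>] by blast
    then have "(\<Prod>k<d. letter_coord (\<beta> k) (component d P w ! k)) = 0"
      using c[OF k(1)] by (intro prod_zero) auto
    then show ?thesis using False by (simp add: word_coord_def)
  qed
qed

lemma word_coord_permute:
  assumes \<sigma>: "\<sigma> permutes {..<d}" and v: "length v = d" and \<beta>: "\<beta> \<in> Ind letters"
  shows "word_coord (permute_list \<sigma> v) (\<beta> \<circ> \<sigma>) = word_coord v \<beta>"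
proof -
  have "(\<Prod>k<d. letter_coord ((\<beta> \<circ> \<sigma>) k) (permute_list \<sigma> v ! k)) = (\<Prod>k<d. letter_coord (\<beta> (\<sigma> k)) (v ! \<sigma> k))"
    using \<sigma> v by (intro prod.cong) (auto simp: permute_list_nth)
  also have "\<dots> = (\<Prod>k<d. letter_coord (\<beta> k) (v ! k))"
    using prod.permute[OF \<sigma>, of "\<lambda>k. letter_coord (\<beta> k) (v ! k)"] by (simp add: o_def)
  finally show ?thesis using \<beta> Ind_permute[OF \<sigma> \<beta>] by (simp add: word_coord_def)
qed

lemma \<Phi>_outside: "\<beta> \<notin> Ind letters \<Longrightarrow> \<Phi> x \<beta> = 0"
  by (simp add: \<Phi>_def word_coord_def)

text \<open>Of the components summed in \<open>word_act\<close>, only the one with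
  \<open>P = odds \<beta>\<close> reaches this index. Evaluation at
  \<open>\<beta> \<circ> \<sigma>\<close> keeps the inverse of \<sigma> out of the index.\<close>

lemma \<Phi>_act:
  assumes x: "x \<in> free_on_words n d" and \<sigma>: "\<sigma> permutes {..<d}" and \<beta>: "\<beta> \<in> Ind letters"
  shows "\<Phi> (linear_extension (word_act d \<sigma>) x) (\<beta> \<circ> \<sigma>) = perm_sign \<sigma> (odds \<beta>) * \<Phi> x \<beta>"
proof -
  have w: "\<Phi> (word_act d \<sigma> w) (\<beta> \<circ> \<sigma>) = perm_sign \<sigma> (odds \<beta>) * word_coord w \<beta>" if "w \<in> words n d" for w
  proof -
    have "\<Phi> (word_act d \<sigma> w) (\<beta> \<circ> \<sigma>) =
        (\<Sum>P\<in>Pow {..<d}. perm_sign \<sigma> P * word_coord (permute_list \<sigma> (component d P w)) (\<beta> \<circ> \<sigma>))"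
      by (simp add: word_act_def \<Phi>_sum sum_fun_apply \<Phi>_fscale \<Phi>_word)
    also have "\<dots> = (\<Sum>P\<in>Pow {..<d}. if P = odds \<beta> then perm_sign \<sigma> P * word_coord w \<beta> else 0)"
    proof (rule sum.cong[OF refl])
      fix P assume "P \<in> Pow {..<d}"
      then have "P \<subseteq> {..<d}" by simp
      moreover have "length (component d P w) = d" by (simp add: component_def)
      ultimately show "perm_sign \<sigma> P * word_coord (permute_list \<sigma> (component d P w)) (\<beta> \<circ> \<sigma>) =
          (if P = odds \<beta> then perm_sign \<sigma> P * word_coord w \<beta> else 0)"
        by (simp only: word_coord_permute[OF \<sigma> _ \<beta>] word_coord_component[OF that _ \<beta>]) simp
    qed
    also have "\<dots> = perm_sign \<sigma> (odds \<beta>) * word_coord w \<beta>"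
      using odds_sub[of \<beta>] by (simp add: sum.delta)
    finally show ?thesis .
  qed
  have "\<Phi> (linear_extension (word_act d \<sigma>) x) (\<beta> \<circ> \<sigma>) =
      (\<Sum>w\<in>Poly_Mapping.keys x. Poly_Mapping.lookup x w * (perm_sign \<sigma> (odds \<beta>) * word_coord w \<beta>))"
    unfolding \<Phi>_linear_extension using x by (intro sum.cong) (auto simp: w free_on_words_def)
  then show ?thesis by (simp add: \<Phi>_def sum_distrib_left algebra_simps)
qed

section \<open>The product and its structure constants\<close>

definition structure_const :: "(nat \<Rightarrow> 'a \<times> nat \<times> nat) \<Rightarrow> (nat \<Rightarrow> 'a \<times> nat \<times> nat) \<Rightarrow> (nat \<Rightarrow> 'a \<times> nat \<times> nat) \<Rightarrow> 'k" where
  "structure_const \<beta> \<gamma> \<delta> = product_sign (odds \<gamma>) (odds \<delta>) * (\<Prod>k<d. \<kappa> (\<beta> k) (\<gamma> k) (\<delta> k))"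

lemma supports_component:
  assumes "w \<in> words n d" "supports \<Delta> w"
  shows "supports \<Delta> (component d P w)"
proof -
  have "letter_coord t X = 0 \<or> t \<in> \<Delta>" if "X \<in> set (component d P w)" for X t
  proof -
    from that obtain k where k: "k < d" "X = map_mat (if k \<in> P then odd_part else even_part) (w ! k)"
      by (auto simp: component_def)
    then have wk: "w ! k \<in> set w" "w ! k \<in> carrier_mat n n"
      using assms by (auto simp: words_def intro: nth_mem[THEN rev_subsetD])
    have "letter_coord t (w ! k) \<noteq> 0" if "letter_coord t X \<noteq> 0"
      using that unfolding k(2) letter_coord_part[OF wk(2)] by (auto split: if_splits)
    then show ?thesis using assms(2) wk(1) by (auto simp: supports_def)
  qed
  then show ?thesis using assms(2) unfolding supports_def by blast
qed

lemma word_coord_map2_mult: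
  assumes v: "v \<in> words n d" "supports \<Delta> v" and w: "w \<in> words n d" "supports \<Delta> w" and \<beta>: "\<beta> \<in> Ind letters"
  shows "word_coord (map2 (*) v w) \<beta> =
    (\<Sum>\<gamma>\<in>Ind \<Delta>. \<Sum>\<delta>\<in>Ind \<Delta>. word_coord v \<gamma> * word_coord w \<delta> * (\<Prod>k<d. \<kappa> (\<beta> k) (\<gamma> k) (\<delta> k)))"
proof -
  have \<Delta>: "finite \<Delta>" "\<Delta> \<subseteq> letters" using v by (auto simp: supports_def)
  let ?f = "\<lambda>k u t. letter_coord u (v ! k) * letter_coord t (w ! k) * \<kappa> (\<beta> k) u t"
  have "word_coord (map2 (*) v w) \<beta> = (\<Prod>k<d. \<Sum>u\<in>\<Delta>. \<Sum>t\<in>\<Delta>. ?f k u t)"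
  proof -
    have "letter_coord (\<beta> k) (map2 (*) v w ! k) = (\<Sum>u\<in>\<Delta>. \<Sum>t\<in>\<Delta>. ?f k u t)" if "k < d" for k
    proof -
      have "v ! k \<in> set v" "w ! k \<in> set w" using v w that by (auto simp: words_def)
      then show ?thesis
        using v w that by (subst letter_coord_mult[OF _ _ \<Delta>, symmetric]) (auto simp: words_def supports_def)
    qed
    then show ?thesis using \<beta> by (simp add: word_coord_def)
  qed
  \<comment> \<open>Distributivity: a choice of one letter of \<Delta> at every position is an index
    in \<open>Ind \<Delta>\<close>.\<close>
  also have "\<dots> = (\<Sum>\<gamma>\<in>Ind \<Delta>. \<Sum>\<delta>\<in>Ind \<Delta>. \<Prod>k<d. ?f k (\<gamma> k) (\<delta> k))"
    using \<Delta> by (simp add: prod_sum_PiE Ind_def)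
  also have "\<dots> = (\<Sum>\<gamma>\<in>Ind \<Delta>. \<Sum>\<delta>\<in>Ind \<Delta>. word_coord v \<gamma> * word_coord w \<delta> * (\<Prod>k<d. \<kappa> (\<beta> k) (\<gamma> k) (\<delta> k)))"
    using Ind_mono[OF \<Delta>(2)] by (intro sum.cong refl) (auto simp: word_coord_def prod.distrib)
  finally show ?thesis .
qed

text \<open>After interchanging summations, each pair of indices carries a sum over \<open>P\<close>
  and \<open>Q\<close> in which only \<open>P = odds \<gamma>\<close> and
  \<open>Q = odds \<delta>\<close> survive; this is the origin of the sign in
  \<open>structure_const\<close>.\<close>

lemma \<Phi>_word_mult:
  assumes v: "v \<in> words n d" "supports \<Delta> v" and w: "w \<in> words n d" "supports \<Delta> w" and \<beta>: "\<beta> \<in> Ind letters"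
  shows "\<Phi> (word_mult d v w) \<beta> =
    (\<Sum>\<gamma>\<in>Ind \<Delta>. \<Sum>\<delta>\<in>Ind \<Delta>. word_coord v \<gamma> * word_coord w \<delta> * structure_const \<beta> \<gamma> \<delta>)"
proof -
  have \<Delta>: "finite \<Delta>" "\<Delta> \<subseteq> letters" using v by (auto simp: supports_def)
  let ?D = "Pow {..<d}" and ?K = "\<lambda>\<gamma> \<delta>. \<Prod>k<d. \<kappa> (\<beta> k) (\<gamma> k) (\<delta> k)"
  have "\<Phi> (word_mult d v w) \<beta> =
      (\<Sum>P\<in>?D. \<Sum>Q\<in>?D. product_sign P Q * word_coord (map2 (*) (component d P v) (component d Q w)) \<beta>)"
    by (simp add: word_mult_def \<Phi>_sum sum_fun_apply \<Phi>_fscale \<Phi>_word)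
  also have "\<dots> = (\<Sum>P\<in>?D. \<Sum>Q\<in>?D. \<Sum>\<gamma>\<in>Ind \<Delta>. \<Sum>\<delta>\<in>Ind \<Delta>.
      product_sign P Q * (word_coord (component d P v) \<gamma> * word_coord (component d Q w) \<delta> * ?K \<gamma> \<delta>))"
    by (simp add: word_coord_map2_mult[OF component_words[OF v(1)] supports_component[OF v]
      component_words[OF w(1)] supports_component[OF w] \<beta>] sum_distrib_left)
  also have "\<dots> = (\<Sum>\<gamma>\<in>Ind \<Delta>. \<Sum>\<delta>\<in>Ind \<Delta>. \<Sum>P\<in>?D. \<Sum>Q\<in>?D.
      product_sign P Q * (word_coord (component d P v) \<gamma> * word_coord (component d Q w) \<delta> * ?K \<gamma> \<delta>))"
    by (rule sum_swap_pairs)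
  also have "\<dots> = (\<Sum>\<gamma>\<in>Ind \<Delta>. \<Sum>\<delta>\<in>Ind \<Delta>. word_coord v \<gamma> * word_coord w \<delta> * structure_const \<beta> \<gamma> \<delta>)"
  proof (intro sum.cong refl)
    fix \<gamma> \<delta> assume "\<gamma> \<in> Ind \<Delta>" "\<delta> \<in> Ind \<Delta>"
    then have g: "\<gamma> \<in> Ind letters" "\<delta> \<in> Ind letters" using Ind_mono[OF \<Delta>(2)] by auto
    have "(\<Sum>P\<in>?D. \<Sum>Q\<in>?D.
        product_sign P Q * (word_coord (component d P v) \<gamma> * word_coord (component d Q w) \<delta> * ?K \<gamma> \<delta>)) =
      (\<Sum>P\<in>?D. \<Sum>Q\<in>?D. if Q = odds \<delta> then if P = odds \<gamma> then
        product_sign P Q * (word_coord v \<gamma> * word_coord w \<delta> * ?K \<gamma> \<delta>) else 0 else 0)"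
      using g by (intro sum.cong refl) (simp add: word_coord_component[OF v(1)] word_coord_component[OF w(1)])
    also have "\<dots> = word_coord v \<gamma> * word_coord w \<delta> * structure_const \<beta> \<gamma> \<delta>"
      using odds_sub[of \<gamma>] odds_sub[of \<delta>] by (simp add: sum.delta structure_const_def algebra_simps)
    finally show "(\<Sum>P\<in>?D. \<Sum>Q\<in>?D.
        product_sign P Q * (word_coord (component d P v) \<gamma> * word_coord (component d Q w) \<delta> * ?K \<gamma> \<delta>)) =
      word_coord v \<gamma> * word_coord w \<delta> * structure_const \<beta> \<gamma> \<delta>" .
  qed
  finally show ?thesis .
qed

lemma \<Phi>_free_mult:
  assumes x: "x \<in> free_on_words n d" "\<And>w. w \<in> Poly_Mapping.keys x \<Longrightarrow> supports \<Delta> w"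
    and y: "y \<in> free_on_words n d" "\<And>w. w \<in> Poly_Mapping.keys y \<Longrightarrow> supports \<Delta> w"
    and \<beta>: "\<beta> \<in> Ind letters"
  shows "\<Phi> (free_mult d x y) \<beta> = (\<Sum>\<gamma>\<in>Ind \<Delta>. \<Sum>\<delta>\<in>Ind \<Delta>. \<Phi> x \<gamma> * \<Phi> y \<delta> * structure_const \<beta> \<gamma> \<delta>)"
proof -
  let ?X = "Poly_Mapping.keys x" and ?Y = "Poly_Mapping.keys y"
  let ?l = "Poly_Mapping.lookup"
  have w: "?X \<subseteq> words n d" "?Y \<subseteq> words n d" using x y by (auto simp: free_on_words_def)
  have "\<Phi> (free_mult d x y) \<beta> = (\<Sum>v\<in>?X. \<Sum>w\<in>?Y. ?l x v * (?l y w * \<Phi> (word_mult d v w) \<beta>))"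
    by (simp add: free_mult_def \<Phi>_linear_extension sum_distrib_left)
  also have "\<dots> = (\<Sum>v\<in>?X. \<Sum>w\<in>?Y. \<Sum>\<gamma>\<in>Ind \<Delta>. \<Sum>\<delta>\<in>Ind \<Delta>.
      (?l x v * word_coord v \<gamma>) * (?l y w * word_coord w \<delta>) * structure_const \<beta> \<gamma> \<delta>)"
    using w x y by (intro sum.cong refl)
      (auto simp: \<Phi>_word_mult[OF _ _ _ _ \<beta>, of _ \<Delta>] sum_distrib_left subset_iff mult_ac)
  also have "\<dots> = (\<Sum>\<gamma>\<in>Ind \<Delta>. \<Sum>\<delta>\<in>Ind \<Delta>. \<Sum>v\<in>?X. \<Sum>w\<in>?Y.
      (?l x v * word_coord v \<gamma>) * (?l y w * word_coord w \<delta>) * structure_const \<beta> \<gamma> \<delta>)"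
    by (rule sum_swap_pairs)
  also have "\<dots> = (\<Sum>\<gamma>\<in>Ind \<Delta>. \<Sum>\<delta>\<in>Ind \<Delta>. \<Phi> x \<gamma> * \<Phi> y \<delta> * structure_const \<beta> \<gamma> \<delta>)"
    unfolding \<Phi>_def sum_product by (simp only: sum_distrib_right)
  finally show ?thesis .
qed

lemma ex_supports4:
  fixes x y x' y' :: "'a mat list \<Rightarrow>\<^sub>0 'k"
  obtains \<Delta> where "finite \<Delta>" "\<Delta> \<subseteq> letters"
    "\<And>w z. z \<in> {x, y, x', y'} \<Longrightarrow> w \<in> Poly_Mapping.keys z \<Longrightarrow> supports \<Delta> w"
  using ex_supports[of "\<Union>z\<in>{x, y, x', y'}. Poly_Mapping.keys z"] by auto

text \<open>A single \<Delta> that supports the words of all four arguments gives both products the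
  same range of summation, and the summands depend on the coordinates only.\<close>

lemma \<Phi>_free_mult_cong:
  assumes x: "x \<in> free_on_words n d" "x' \<in> free_on_words n d" "\<Phi> x' = \<Phi> x"
    and y: "y \<in> free_on_words n d" "y' \<in> free_on_words n d" "\<Phi> y' = \<Phi> y"
  shows "\<Phi> (free_mult d x' y') = \<Phi> (free_mult d x y)"
proof
  fix \<beta>
  obtain \<Delta> where \<Delta>: "finite \<Delta>" "\<Delta> \<subseteq> letters"
    "\<And>w z. z \<in> {x, y, x', y'} \<Longrightarrow> w \<in> Poly_Mapping.keys z \<Longrightarrow> supports \<Delta> w"
    by (rule ex_supports4[of x y x' y']) blast
  show "\<Phi> (free_mult d x' y') \<beta> = \<Phi> (free_mult d x y) \<beta>"
  proof (cases "\<beta> \<in> Ind letters")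
    case True
    have "\<Phi> (free_mult d x y) \<beta> = (\<Sum>\<gamma>\<in>Ind \<Delta>. \<Sum>\<delta>\<in>Ind \<Delta>. \<Phi> x \<gamma> * \<Phi> y \<delta> * structure_const \<beta> \<gamma> \<delta>)"
      by (rule \<Phi>_free_mult[OF x(1) _ y(1) _ True]) (use \<Delta>(3) in blast)+
    moreover have "\<Phi> (free_mult d x' y') \<beta> = (\<Sum>\<gamma>\<in>Ind \<Delta>. \<Sum>\<delta>\<in>Ind \<Delta>. \<Phi> x' \<gamma> * \<Phi> y' \<delta> * structure_const \<beta> \<gamma> \<delta>)"
      by (rule \<Phi>_free_mult[OF x(2) _ y(2) _ True]) (use \<Delta>(3) in blast)+
    ultimately show ?thesis by (simp only: x(3) y(3))
  qed (simp add: \<Phi>_outside)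
qed

lemma \<Phi>_act_cong:
  assumes "x \<in> free_on_words n d" "x' \<in> free_on_words n d" "\<Phi> x' = \<Phi> x" and \<sigma>: "\<sigma> permutes {..<d}"
  shows "\<Phi> (linear_extension (word_act d \<sigma>) x') = \<Phi> (linear_extension (word_act d \<sigma>) x)"
proof
  fix \<beta> :: "nat \<Rightarrow> 'a \<times> nat \<times> nat"
  let ?i = "inv_into UNIV \<sigma>"
  have eq: "\<beta> = (\<beta> \<circ> ?i) \<circ> \<sigma>" using permutes_inv_o[OF \<sigma>] by (simp add: comp_assoc)
  show "\<Phi> (linear_extension (word_act d \<sigma>) x') \<beta> = \<Phi> (linear_extension (word_act d \<sigma>) x) \<beta>"
  proof (cases "\<beta> \<in> Ind letters")
    case True
    note H = Ind_permute[OF permutes_inv[OF \<sigma>] True]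
    have "\<Phi> (linear_extension (word_act d \<sigma>) x') ((\<beta> \<circ> ?i) \<circ> \<sigma>) =
        \<Phi> (linear_extension (word_act d \<sigma>) x) ((\<beta> \<circ> ?i) \<circ> \<sigma>)"
      by (simp only: \<Phi>_act[OF assms(1) \<sigma> H] \<Phi>_act[OF assms(2) \<sigma> H] assms(3))
    then show ?thesis by (simp only: eq[symmetric])
  qed (simp add: \<Phi>_outside)
qed

section \<open>Tensor classes and their coordinates\<close>

definition tensor_class :: "('a mat list \<Rightarrow>\<^sub>0 'k) \<Rightarrow> ('a mat list \<Rightarrow>\<^sub>0 'k) set" where
  "tensor_class x = tensor_rel n d `` {x}"

text \<open>The choice of a representative is harmless, since all members of a class have the same
  coordinates.\<close>

definition \<psi> :: "('a mat list \<Rightarrow>\<^sub>0 'k) set \<Rightarrow> (nat \<Rightarrow> 'a \<times> nat \<times> nat) \<Rightarrow> 'k" where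
  "\<psi> X = \<Phi> (SOME x. x \<in> X)"

lemma mem_tensor_class: "x' \<in> tensor_class x \<longleftrightarrow> x \<in> free_on_words n d \<and> x' \<in> free_on_words n d \<and> \<Phi> x' = \<Phi> x"
  by (auto simp: tensor_class_def tensor_rel_iff)

lemma self_mem_tensor_class: "x \<in> free_on_words n d \<Longrightarrow> x \<in> tensor_class x"
  by (simp add: mem_tensor_class)

lemma tensor_class_eq: "x \<in> free_on_words n d \<Longrightarrow> y \<in> free_on_words n d \<Longrightarrow> tensor_class x = tensor_class y \<longleftrightarrow> \<Phi> x = \<Phi> y"
  using self_mem_tensor_class[of x] by (auto simp: set_eq_iff mem_tensor_class)

lemma \<psi>_tensor_class: "x \<in> free_on_words n d \<Longrightarrow> \<psi> (tensor_class x) = \<Phi> x"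
  unfolding \<psi>_def using someI[of "\<lambda>y. y \<in> tensor_class x", OF self_mem_tensor_class] by (simp add: mem_tensor_class)

text \<open>The operations of \<open>tensor_power\<close> are unions over all representatives. When
  every representative gives the same result, the union is that result.\<close>

lemma UN_tensor_class:
  assumes "x \<in> free_on_words n d" "\<And>x'. x' \<in> free_on_words n d \<Longrightarrow> \<Phi> x' = \<Phi> x \<Longrightarrow> F x' = F x"
  shows "(\<Union>x'\<in>tensor_class x. F x') = F x"
proof -
  have "(\<Union>x'\<in>tensor_class x. F x') = (\<Union>x'\<in>tensor_class x. F x)"
    by (intro SUP_cong refl assms(2)) (simp_all add: mem_tensor_class)
  then show ?thesis using self_mem_tensor_class[OF assms(1)] by auto
qed

lemma UN_cl2:
  assumes "x \<in> free_on_words n d" "y \<in> free_on_words n d"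
    "\<And>x' y'. x' \<in> free_on_words n d \<Longrightarrow> \<Phi> x' = \<Phi> x \<Longrightarrow>
      y' \<in> free_on_words n d \<Longrightarrow> \<Phi> y' = \<Phi> y \<Longrightarrow> F x' y' = F x y"
  shows "(\<Union>x'\<in>tensor_class x. \<Union>y'\<in>tensor_class y. F x' y') = F x y"
proof -
  have "(\<Union>x'\<in>tensor_class x. \<Union>y'\<in>tensor_class y. F x' y') = (\<Union>x'\<in>tensor_class x. \<Union>y'\<in>tensor_class y. F x y)"
    by (intro SUP_cong refl assms(3)) (simp_all add: mem_tensor_class)
  then show ?thesis using self_mem_tensor_class[OF assms(1)] self_mem_tensor_class[OF assms(2)] by auto
qed

abbreviation TP :: "('k, ('a mat list \<Rightarrow>\<^sub>0 'k) set) module" where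
  "TP \<equiv> tensor_power n d e"

lemma TP_carrier: "carrier TP = tensor_class ` free_on_words n d"
  by (auto simp: tensor_power_def quotient_def tensor_class_def)

lemma TP_zero: "\<zero>\<^bsub>TP\<^esub> = tensor_class 0"
  by (simp add: tensor_power_def tensor_class_def)

lemma TP_add: "x \<in> free_on_words n d \<Longrightarrow> y \<in> free_on_words n d \<Longrightarrow> tensor_class x \<oplus>\<^bsub>TP\<^esub> tensor_class y = tensor_class (x + y)"
  unfolding tensor_power_def ring_record_simps tensor_class_def[symmetric]
  by (rule UN_cl2) (auto simp: tensor_class_eq free_add \<Phi>_add)

lemma TP_smult: "x \<in> free_on_words n d \<Longrightarrow> c \<odot>\<^bsub>TP\<^esub> tensor_class x = tensor_class (fscale c x)"
  unfolding tensor_power_def module.simps tensor_class_def[symmetric]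
  by (rule UN_tensor_class) (auto simp: tensor_class_eq free_fscale \<Phi>_fscale fun_eq_iff)

lemma TP_mult: "x \<in> free_on_words n d \<Longrightarrow> y \<in> free_on_words n d \<Longrightarrow> tensor_class x \<otimes>\<^bsub>TP\<^esub> tensor_class y = tensor_class (free_mult d x y)"
  unfolding tensor_power_def monoid.simps tensor_class_def[symmetric]
  by (rule UN_cl2, assumption, assumption, rule iffD2[OF tensor_class_eq])
    (assumption | rule free_free_mult \<Phi>_free_mult_cong)+

lemma act_tensor_class: "x \<in> free_on_words n d \<Longrightarrow> \<sigma> permutes {..<d} \<Longrightarrow>
    act n d \<sigma> (tensor_class x) = tensor_class (linear_extension (word_act d \<sigma>) x)"
  unfolding act_def tensor_class_def[symmetric]
  by (rule UN_tensor_class, assumption, rule iffD2[OF tensor_class_eq])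
    (assumption | rule free_linear_extension free_word_act \<Phi>_act_cong)+

end

section \<open>Divisible invariant functions\<close>

lemma fibre_factorial_inj_on:
  assumes "inj_on f D"
  shows "fibre_factorial D f = 1"
proof -
  have "card {k \<in> D. f k = y} = 1" if "y \<in> f ` D" for y
  proof -
    from that obtain k where "k \<in> D" "y = f k" by auto
    then have "{k \<in> D. f k = y} = {k}" using assms unfolding inj_on_def by blast
    then show ?thesis by simp
  qed
  then show ?thesis unfolding fibre_factorial_def by simp
qed

context schur_setup
begin

definition \<cc>_positions :: "(nat \<Rightarrow> 'a \<times> nat \<times> nat) \<Rightarrow> nat set" where
  "\<cc>_positions \<beta> = {k. k < d \<and> fst (\<beta> k) \<in> B\<^sub>\<cc>}"

text \<open>This is the order of \<open>H\<close> by \<open>card_fibre_stabilizer\<close>, and the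
  scalar factor in \<open>\<eta>\<close> by \<open>\<cc>_factorial_index_of\<close>; the two
  readings link the group argument with the generators.\<close>

definition \<cc>_stabilizer_order :: "(nat \<Rightarrow> 'a \<times> nat \<times> nat) \<Rightarrow> nat" where
  "\<cc>_stabilizer_order \<beta> = fibre_factorial (\<cc>_positions \<beta>) \<beta>"

text \<open>The condition in \<open>Tri\<close> expressed by \<open>B\<^sub>1\<close>: a basis
  element lies in \<open>A0\<close> exactly if it is not in \<open>B\<^sub>1\<close>, because 0 is
  not a basis element.\<close>

definition odd_distinct :: "(nat \<Rightarrow> 'a \<times> nat \<times> nat) \<Rightarrow> bool" where
  "odd_distinct \<beta> \<longleftrightarrow> (\<forall>k<d. \<forall>l<d. k \<noteq> l \<and> \<beta> k = \<beta> l \<longrightarrow> fst (\<beta> k) \<notin> B\<^sub>1)"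

definition invariant :: "((nat \<Rightarrow> 'a \<times> nat \<times> nat) \<Rightarrow> 'k) \<Rightarrow> bool" where
  "invariant z \<longleftrightarrow> (\<forall>\<beta>. \<beta> \<notin> Ind letters \<longrightarrow> z \<beta> = 0) \<and>
    (\<forall>\<sigma> \<beta>. \<sigma> permutes {..<d} \<longrightarrow> \<beta> \<in> Ind letters \<longrightarrow> z (\<beta> \<circ> \<sigma>) = perm_sign \<sigma> (odds \<beta>) * z \<beta>)"

definition admissible :: "((nat \<Rightarrow> 'a \<times> nat \<times> nat) \<Rightarrow> 'k) \<Rightarrow> bool" where
  "admissible z \<longleftrightarrow> invariant z \<and> (\<forall>\<beta>\<in>Ind letters. of_nat (\<cc>_stabilizer_order \<beta>) dvd z \<beta>)"

lemma finite_\<cc>_positions [simp]: "finite (\<cc>_positions \<beta>)"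
  by (simp add: \<cc>_positions_def)

text \<open>The permutation carries the fibres of \<open>\<beta> \<circ> \<sigma>\<close>
  bijectively onto those of \<beta>.\<close>

lemma \<cc>_stabilizer_order_permute:
  assumes \<sigma>: "\<sigma> permutes {..<d}"
  shows "\<cc>_stabilizer_order (\<beta> \<circ> \<sigma>) = \<cc>_stabilizer_order \<beta>"
proof -
  let ?i = "inv_into UNIV \<sigma>"
  have lt: "\<sigma> k < d \<longleftrightarrow> k < d" for k using permutes_in_image[OF \<sigma>, of k] by simp
  have C: "\<sigma> ` \<cc>_positions (\<beta> \<circ> \<sigma>) = \<cc>_positions \<beta>"
  proof
    show "\<sigma> ` \<cc>_positions (\<beta> \<circ> \<sigma>) \<subseteq> \<cc>_positions \<beta>" by (auto simp: \<cc>_positions_def lt)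
    show "\<cc>_positions \<beta> \<subseteq> \<sigma> ` \<cc>_positions (\<beta> \<circ> \<sigma>)"
    proof
      fix k assume k: "k \<in> \<cc>_positions \<beta>"
      have "k = \<sigma> (?i k)" using permutes_inverses[OF \<sigma>] by simp
      moreover have "?i k \<in> \<cc>_positions (\<beta> \<circ> \<sigma>)"
        using k lt[of "?i k"] permutes_inverses[OF \<sigma>] by (simp add: \<cc>_positions_def)
      ultimately show "k \<in> \<sigma> ` \<cc>_positions (\<beta> \<circ> \<sigma>)" by blast
    qed
  qed
  have "card {k \<in> \<cc>_positions (\<beta> \<circ> \<sigma>). (\<beta> \<circ> \<sigma>) k = y} = card {k \<in> \<cc>_positions \<beta>. \<beta> k = y}" for y
  proof -
    have "\<sigma> ` {k \<in> \<cc>_positions (\<beta> \<circ> \<sigma>). (\<beta> \<circ> \<sigma>) k = y} = {k \<in> \<cc>_positions \<beta>. \<beta> k = y}"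
      using C by auto
    then show ?thesis
      using card_image[OF inj_on_subset[OF permutes_inj[OF \<sigma>] subset_UNIV],
        of "{k \<in> \<cc>_positions (\<beta> \<circ> \<sigma>). (\<beta> \<circ> \<sigma>) k = y}"] by simp
  qed
  moreover have "(\<beta> \<circ> \<sigma>) ` \<cc>_positions (\<beta> \<circ> \<sigma>) = \<beta> ` \<cc>_positions \<beta>"
    unfolding C[symmetric] by (rule image_comp[symmetric])
  ultimately show ?thesis by (simp only: \<cc>_stabilizer_order_def fibre_factorial_def)
qed

text \<open>Exchanging two equal odd letters fixes \<beta> but has sign -1, so
  \<open>2 * z \<beta> = 0\<close>, and 2 can be cancelled in a domain of characteristic 0.\<close>

lemma invariant_not_odd_distinct:
  assumes z: "invariant z" and \<beta>: "\<beta> \<in> Ind letters" and "\<not> odd_distinct \<beta>"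
  shows "z \<beta> = 0"
proof -
  obtain k l where kl: "k < d" "l < d" "k \<noteq> l" "\<beta> k = \<beta> l" "fst (\<beta> k) \<in> B\<^sub>1"
    using assms(3) by (auto simp: odd_distinct_def)
  have odd: "k \<in> odds \<beta>" "l \<in> odds \<beta>" using kl by (auto simp: odds_def)
  have "finite (odds \<beta>)" using odds_sub finite_subset by blast
  then have s: "perm_sign (transpose k l) (odds \<beta>) = -1"
    using perm_sign_transpose odd kl by simp
  have p: "transpose k l permutes {..<d}" using kl by (auto intro: permutes_swap_id)
  have b: "\<beta> \<circ> transpose k l = \<beta>" using kl by (auto simp: fun_eq_iff transpose_def)
  have "z (\<beta> \<circ> transpose k l) = perm_sign (transpose k l) (odds \<beta>) * z \<beta>"
    using z p \<beta> unfolding invariant_def by blast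
  then have "z \<beta> = - z \<beta>" unfolding b s by simp
  then have "z \<beta> + z \<beta> = 0" by (simp only: eq_neg_iff_add_eq_0)
  then have "2 * z \<beta> = 0" by (simp only: mult_2)
  then show ?thesis by simp
qed

lemma rep_mult_parity:
  assumes "b1 \<in> basis" "b2 \<in> basis" "rep (b1 * b2) b \<noteq> 0"
  shows "b \<in> B\<^sub>1 \<longleftrightarrow> (b1 \<in> B\<^sub>1) \<noteq> (b2 \<in> B\<^sub>1)"
proof -
  have p: "x \<in> A1 \<and> x \<in> B\<^sub>1 \<or> x \<in> A0 \<and> x \<notin> B\<^sub>1" if "x \<in> basis" for x
    using that B_sub B_disjoint by (auto simp: basis_def)
  show ?thesis
    using p[OF assms(1)] p[OF assms(2)] mult_00[of b1 b2] mult_01[of b1 b2] mult_10[of b1 b2] mult_11[of b1 b2]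
      rep_A0[of "b1 * b2" b] rep_A1[of "b1 * b2" b] assms(3)
    by auto
qed

lemma fst_Ind: "\<gamma> \<in> Ind letters \<Longrightarrow> k < d \<Longrightarrow> fst (\<gamma> k) \<in> basis"
  using Ind_nth[of \<gamma> letters k] by (auto simp: letters_def)

lemma structure_const_nonzero:
  assumes "\<gamma> \<in> Ind letters" "\<delta> \<in> Ind letters" "structure_const \<beta> \<gamma> \<delta> \<noteq> 0" "k < d"
  shows "rep (fst (\<gamma> k) * fst (\<delta> k)) (fst (\<beta> k)) \<noteq> 0"
    "fst (\<beta> k) \<in> B\<^sub>1 \<longleftrightarrow> (fst (\<gamma> k) \<in> B\<^sub>1) \<noteq> (fst (\<delta> k) \<in> B\<^sub>1)"
proof -
  have "\<kappa> (\<beta> k) (\<gamma> k) (\<delta> k) \<noteq> 0" using assms(3,4) by (auto simp: structure_const_def)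
  then show *: "rep (fst (\<gamma> k) * fst (\<delta> k)) (fst (\<beta> k)) \<noteq> 0" by (rule \<kappa>_nonzero)
  show "fst (\<beta> k) \<in> B\<^sub>1 \<longleftrightarrow> (fst (\<gamma> k) \<in> B\<^sub>1) \<noteq> (fst (\<delta> k) \<in> B\<^sub>1)"
    using rep_mult_parity[OF _ _ *] fst_Ind assms by blast
qed

text \<open>\<open>product_sign_permute\<close> requires the odd positions of \<beta> to be the
  symmetric difference of those of \<gamma> and \<delta>. Parity forces this when the constant is
  nonzero. Otherwise the product of the \<open>\<kappa>\<close> is 0, the permutation does not
  change that product, and both sides vanish.\<close>

lemma structure_const_permute:
  assumes \<sigma>: "\<sigma> permutes {..<d}" and g: "\<gamma> \<in> Ind letters" "\<delta> \<in> Ind letters"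
  shows "perm_sign \<sigma> (odds \<gamma>) * perm_sign \<sigma> (odds \<delta>) * structure_const (\<beta> \<circ> \<sigma>) (\<gamma> \<circ> \<sigma>) (\<delta> \<circ> \<sigma>) =
    perm_sign \<sigma> (odds \<beta>) * structure_const \<beta> \<gamma> \<delta>"
proof -
  have K: "(\<Prod>k<d. \<kappa> ((\<beta> \<circ> \<sigma>) k) ((\<gamma> \<circ> \<sigma>) k) ((\<delta> \<circ> \<sigma>) k)) = (\<Prod>k<d. \<kappa> (\<beta> k) (\<gamma> k) (\<delta> k))"
    using prod.permute[OF \<sigma>, of "\<lambda>k. \<kappa> (\<beta> k) (\<gamma> k) (\<delta> k)"] by (simp add: o_def)
  show ?thesis
  proof (cases "structure_const \<beta> \<gamma> \<delta> = 0")
    case True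
    have "product_sign (odds \<gamma>) (odds \<delta>) \<noteq> 0" by (simp add: product_sign_def)
    then have "(\<Prod>k<d. \<kappa> (\<beta> k) (\<gamma> k) (\<delta> k)) = 0" using True by (simp add: structure_const_def)
    then show ?thesis unfolding structure_const_def K by simp
  next
    case False
    have "odds \<beta> = (odds \<gamma> - odds \<delta>) \<union> (odds \<delta> - odds \<gamma>)"
      using structure_const_nonzero(2)[OF g False] by (auto simp: odds_def)
    then have "perm_sign \<sigma> (odds \<gamma>) * perm_sign \<sigma> (odds \<delta>) * product_sign (odds (\<gamma> \<circ> \<sigma>)) (odds (\<delta> \<circ> \<sigma>)) =
        perm_sign \<sigma> (odds \<beta>) * product_sign (odds \<gamma>) (odds \<delta>)"
      using product_sign_permute[OF \<sigma> odds_sub odds_sub] by (simp only: odds_permute[OF \<sigma>])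
    then show ?thesis unfolding structure_const_def K by (simp only: mult.assoc[symmetric])
  qed
qed

text \<open>At a position of \<open>\<beta>\<close> with letter in \<open>B\<^sub>\<cc>\<close> the letters of \<open>\<gamma>\<close> and \<open>\<delta>\<close> cannot both be in
  \<open>B\<^sub>\<aa>\<close>, so one of them is in \<open>B\<^sub>\<cc>\<close> or both are odd, and odd letters are fixed.\<close>

lemma stabilizer_dvd_term:
  assumes z: "admissible z" and w: "admissible w" and g: "\<beta> \<in> Ind letters" "\<gamma> \<in> Ind letters" "\<delta> \<in> Ind letters"
  shows "of_nat (fibre_factorial (\<cc>_positions \<beta>) (\<lambda>k. (\<beta> k, \<gamma> k, \<delta> k))) dvd z \<gamma> * w \<delta> * structure_const \<beta> \<gamma> \<delta>"
proof (cases "z \<gamma> * w \<delta> * structure_const \<beta> \<gamma> \<delta> = 0")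
  case False
  then have ne: "z \<gamma> \<noteq> 0" "structure_const \<beta> \<gamma> \<delta> \<noteq> 0" by auto
  let ?f = "\<lambda>k. (\<beta> k, \<gamma> k, \<delta> k)"
  let ?C1 = "{k \<in> \<cc>_positions \<beta>. fst (\<gamma> k) \<in> B\<^sub>\<cc>}"
  let ?C2 = "{k \<in> \<cc>_positions \<beta>. fst (\<gamma> k) \<notin> B\<^sub>\<cc> \<and> fst (\<delta> k) \<in> B\<^sub>\<cc>}"
  let ?C3 = "{k \<in> \<cc>_positions \<beta>. fst (\<gamma> k) \<notin> B\<^sub>\<cc> \<and> fst (\<delta> k) \<notin> B\<^sub>\<cc>}"
  have odd_distinct: "odd_distinct \<gamma>" using invariant_not_odd_distinct[of z \<gamma>] z ne g by (auto simp: admissible_def)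
  have odd3: "fst (\<gamma> k) \<in> B\<^sub>1" if k: "k \<in> ?C3" for k
  proof -
    have kd: "k < d" and bk: "fst (\<beta> k) \<in> B\<^sub>\<cc>" using k by (auto simp: \<cc>_positions_def)
    note nz = structure_const_nonzero[OF g(2,3) ne(2) kd]
    have "fst (\<beta> k) \<notin> B\<^sub>\<aa>" "fst (\<beta> k) \<notin> B\<^sub>1" using bk B_disjoint by auto
    moreover have "fst (\<gamma> k) \<in> B\<^sub>\<aa> \<union> B\<^sub>1" "fst (\<delta> k) \<in> B\<^sub>\<aa> \<union> B\<^sub>1"
      using fst_Ind[OF g(2) kd] fst_Ind[OF g(3) kd] k by (auto simp: basis_def)
    ultimately show ?thesis
      using nz rep_\<aa>[of "fst (\<gamma> k) * fst (\<delta> k)" "fst (\<beta> k)"] mult_\<aa>[of "fst (\<gamma> k)" "fst (\<delta> k)"]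
        B_sub(1) by blast
  qed
  have inj3: "inj_on ?f ?C3"
  proof (rule inj_onI)
    fix k l assume kl: "k \<in> ?C3" "l \<in> ?C3" "?f k = ?f l"
    then have "\<gamma> k = \<gamma> l" "k < d" "l < d" by (auto simp: \<cc>_positions_def)
    then show "k = l" using odd_distinct odd3[OF kl(1)] unfolding odd_distinct_def by blast
  qed
  have "\<cc>_positions \<beta> = (?C1 \<union> ?C2) \<union> ?C3" by auto
  then have "fibre_factorial (\<cc>_positions \<beta>) ?f = fibre_factorial ((?C1 \<union> ?C2) \<union> ?C3) ?f" by simp
  \<comment> \<open>The value of \<open>?f\<close> at a position tells which of the three sets
    contains it, so no fibre is split. The factor for \<open>?C3\<close> is then 1 by
    injectivity.\<close>
  also have "\<dots> = fibre_factorial (?C1 \<union> ?C2) ?f * fibre_factorial ?C3 ?f"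
    by (rule fibre_factorial_union) auto
  also have "\<dots> = fibre_factorial ?C1 ?f * fibre_factorial ?C2 ?f"
    by (subst fibre_factorial_union) (auto simp: fibre_factorial_inj_on[OF inj3])
  \<comment> \<open>All members of \<open>?C1\<close> are \<open>\<cc>\<close>-positions of
    \<gamma>, and equal values of \<open>?f\<close> entail equal values of \<gamma>; the same holds
    for \<open>?C2\<close> and \<delta>.\<close>
  also have "\<dots> dvd \<cc>_stabilizer_order \<gamma> * \<cc>_stabilizer_order \<delta>"
    unfolding \<cc>_stabilizer_order_def
    by (intro mult_dvd_mono fibre_factorial_dvd) (auto simp: \<cc>_positions_def)
  finally obtain q where q: "\<cc>_stabilizer_order \<gamma> * \<cc>_stabilizer_order \<delta> = fibre_factorial (\<cc>_positions \<beta>) ?f * q"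
    by (rule dvdE)
  have "of_nat (fibre_factorial (\<cc>_positions \<beta>) ?f) dvd (of_nat (\<cc>_stabilizer_order \<gamma> * \<cc>_stabilizer_order \<delta>) :: 'k)"
    unfolding q of_nat_mult by (rule dvd_triv_left)
  also have "of_nat (\<cc>_stabilizer_order \<gamma> * \<cc>_stabilizer_order \<delta>) dvd z \<gamma> * w \<delta>"
    using z w g by (auto simp: admissible_def intro: mult_dvd_mono)
  finally show ?thesis by (rule dvd_mult2)
next
  case True
  then show ?thesis by (simp only: dvd_0_right)
qed

text \<open>For invariance, \<gamma> and \<delta> are replaced by
  \<open>\<gamma> \<circ> \<sigma>\<close> and \<open>\<delta> \<circ> \<sigma>\<close> in the sums;
  the signs of \<open>z\<close> and \<open>w\<close> combine with
  \<open>structure_const_permute\<close> to the sign for \<beta>. For divisibility,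
  \<open>orbit_sum_dvd\<close> is applied to \<open>H\<close> acting diagonally on the pairs of
  indices.\<close>

lemma admissible_product:
  assumes z: "admissible z" and w: "admissible w" and \<Delta>: "finite \<Delta>" "\<Delta> \<subseteq> letters"
    and p: "\<And>\<beta>. \<beta> \<in> Ind letters \<Longrightarrow> p \<beta> = (\<Sum>\<gamma>\<in>Ind \<Delta>. \<Sum>\<delta>\<in>Ind \<Delta>. z \<gamma> * w \<delta> * structure_const \<beta> \<gamma> \<delta>)"
    and p0: "\<And>\<beta>. \<beta> \<notin> Ind letters \<Longrightarrow> p \<beta> = 0"
  shows "admissible p"
proof -
  let ?t = "\<lambda>\<beta> \<gamma> \<delta>. z \<gamma> * w \<delta> * structure_const \<beta> \<gamma> \<delta>"
  have L: "\<gamma> \<in> Ind letters" if "\<gamma> \<in> Ind \<Delta>" for \<gamma> using that Ind_mono[OF \<Delta>(2)] by auto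
  have t: "?t (\<beta> \<circ> \<sigma>) (\<gamma> \<circ> \<sigma>) (\<delta> \<circ> \<sigma>) = perm_sign \<sigma> (odds \<beta>) * ?t \<beta> \<gamma> \<delta>"
    if \<sigma>: "\<sigma> permutes {..<d}" and g: "\<gamma> \<in> Ind letters" "\<delta> \<in> Ind letters" for \<sigma> \<beta> \<gamma> \<delta>
  proof -
    have zw: "z (\<gamma> \<circ> \<sigma>) = perm_sign \<sigma> (odds \<gamma>) * z \<gamma>" "w (\<delta> \<circ> \<sigma>) = perm_sign \<sigma> (odds \<delta>) * w \<delta>"
      using z w \<sigma> g by (auto simp: admissible_def invariant_def)
    have "?t (\<beta> \<circ> \<sigma>) (\<gamma> \<circ> \<sigma>) (\<delta> \<circ> \<sigma>) = z \<gamma> * w \<delta> *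
      (perm_sign \<sigma> (odds \<gamma>) * perm_sign \<sigma> (odds \<delta>) * structure_const (\<beta> \<circ> \<sigma>) (\<gamma> \<circ> \<sigma>) (\<delta> \<circ> \<sigma>))"
      unfolding zw by (simp add: mult_ac)
    also have "\<dots> = perm_sign \<sigma> (odds \<beta>) * ?t \<beta> \<gamma> \<delta>"
      unfolding structure_const_permute[OF \<sigma> g] by (simp add: mult_ac)
    finally show ?thesis .
  qed
  have bij: "bij_betw (\<lambda>\<gamma>. \<gamma> \<circ> \<sigma>) (Ind \<Delta>) (Ind \<Delta>)" if \<sigma>: "\<sigma> permutes {..<d}" for \<sigma>
  proof (rule bij_betw_byWitness[where f' = "\<lambda>\<gamma>. \<gamma> \<circ> inv_into UNIV \<sigma>"])
    show "\<forall>\<gamma>\<in>Ind \<Delta>. \<gamma> \<circ> \<sigma> \<circ> inv_into UNIV \<sigma> = \<gamma>" "\<forall>\<gamma>\<in>Ind \<Delta>. \<gamma> \<circ> inv_into UNIV \<sigma> \<circ> \<sigma> = \<gamma>"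
      by (simp_all add: comp_assoc permutes_inv_o[OF \<sigma>])
    show "(\<lambda>\<gamma>. \<gamma> \<circ> \<sigma>) ` Ind \<Delta> \<subseteq> Ind \<Delta>" "(\<lambda>\<gamma>. \<gamma> \<circ> inv_into UNIV \<sigma>) ` Ind \<Delta> \<subseteq> Ind \<Delta>"
      using Ind_permute[OF \<sigma>] Ind_permute[OF permutes_inv[OF \<sigma>]] by auto
  qed
  have "p (\<beta> \<circ> \<sigma>) = perm_sign \<sigma> (odds \<beta>) * p \<beta>"
    if \<sigma>: "\<sigma> permutes {..<d}" and \<beta>: "\<beta> \<in> Ind letters" for \<sigma> \<beta>
  proof -
    have "p (\<beta> \<circ> \<sigma>) = (\<Sum>\<gamma>\<in>Ind \<Delta>. \<Sum>\<delta>\<in>Ind \<Delta>. ?t (\<beta> \<circ> \<sigma>) \<gamma> \<delta>)"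
      by (rule p[OF Ind_permute[OF \<sigma> \<beta>]])
    also have "\<dots> = (\<Sum>\<gamma>\<in>Ind \<Delta>. \<Sum>\<delta>\<in>Ind \<Delta>. ?t (\<beta> \<circ> \<sigma>) (\<gamma> \<circ> \<sigma>) \<delta>)"
      by (rule sum.reindex_bij_betw[OF bij[OF \<sigma>], symmetric])
    also have "\<dots> = (\<Sum>\<gamma>\<in>Ind \<Delta>. \<Sum>\<delta>\<in>Ind \<Delta>. ?t (\<beta> \<circ> \<sigma>) (\<gamma> \<circ> \<sigma>) (\<delta> \<circ> \<sigma>))"
      by (rule sum.cong[OF refl], rule sum.reindex_bij_betw[OF bij[OF \<sigma>], symmetric])
    also have "\<dots> = (\<Sum>\<gamma>\<in>Ind \<Delta>. \<Sum>\<delta>\<in>Ind \<Delta>. perm_sign \<sigma> (odds \<beta>) * ?t \<beta> \<gamma> \<delta>)"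
      by (intro sum.cong refl t[OF \<sigma>] L)
    also have "\<dots> = perm_sign \<sigma> (odds \<beta>) * p \<beta>" by (simp add: p[OF \<beta>] sum_distrib_left)
    finally show ?thesis .
  qed
  moreover have "of_nat (\<cc>_stabilizer_order \<beta>) dvd p \<beta>" if \<beta>: "\<beta> \<in> Ind letters" for \<beta>
  proof -
    let ?H = "fibre_stabilizer (\<cc>_positions \<beta>) \<beta>"
    have H: "\<sigma> permutes {..<d}" "\<beta> \<circ> \<sigma> = \<beta>" "perm_sign \<sigma> (odds \<beta>) = 1" if "\<sigma> \<in> ?H" for \<sigma>
    proof -
      from that have s: "\<sigma> permutes \<cc>_positions \<beta>" "\<beta> \<circ> \<sigma> = \<beta>" by (auto simp: fibre_stabilizer_def)
      then show "\<sigma> permutes {..<d}" "\<beta> \<circ> \<sigma> = \<beta>"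
        by (auto intro: permutes_subset simp: \<cc>_positions_def)
      \<comment> \<open>Odd positions of \<beta> are not moved, so the terms are constant on orbits
        and not merely constant up to sign.\<close>
      show "perm_sign \<sigma> (odds \<beta>) = 1"
      proof (rule perm_sign_fixed[OF s(1)])
        fix k assume "k \<in> odds \<beta>"
        then have "k \<notin> \<cc>_positions \<beta>" using B_disjoint by (auto simp: odds_def \<cc>_positions_def)
        then show "\<sigma> k = k" using s(1) by (simp add: permutes_not_in)
      qed
    qed
    have "of_nat (card ?H) dvd (\<Sum>x\<in>Ind \<Delta> \<times> Ind \<Delta>. ?t \<beta> (fst x) (snd x))"
    proof (rule orbit_sum_dvd[where \<rho> = "\<lambda>\<sigma> x. (fst x \<circ> \<sigma>, snd x \<circ> \<sigma>)"])
      show "finite ?H" by (simp add: finite_fibre_stabilizer)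
      show "finite (Ind \<Delta> \<times> Ind \<Delta>)" using finite_Ind[OF \<Delta>(1)] by simp
      show "(fst x \<circ> \<sigma>, snd x \<circ> \<sigma>) \<in> Ind \<Delta> \<times> Ind \<Delta>" if "\<sigma> \<in> ?H" "x \<in> Ind \<Delta> \<times> Ind \<Delta>" for \<sigma> x
        using Ind_permute H(1) that by auto
      show "?t \<beta> (fst (fst x \<circ> \<sigma>, snd x \<circ> \<sigma>)) (snd (fst x \<circ> \<sigma>, snd x \<circ> \<sigma>)) = ?t \<beta> (fst x) (snd x)"
        if "\<sigma> \<in> ?H" "x \<in> Ind \<Delta> \<times> Ind \<Delta>" for \<sigma> x
        using t[OF H(1)[OF that(1)], of "fst x" "snd x" \<beta>] L that(2) H(2,3)[OF that(1)] by auto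
      show "of_nat (card {\<sigma> \<in> ?H. (fst x \<circ> \<sigma>, snd x \<circ> \<sigma>) = x}) dvd ?t \<beta> (fst x) (snd x)"
        if x: "x \<in> Ind \<Delta> \<times> Ind \<Delta>" for x
      proof -
        \<comment> \<open>Fixing \<beta> and both members of \<open>x\<close> is the same as fixing
          one function into triples, which is the form treated in
          \<open>stabilizer_dvd_term\<close>.\<close>
        have "{\<sigma> \<in> ?H. (fst x \<circ> \<sigma>, snd x \<circ> \<sigma>) = x} =
            fibre_stabilizer (\<cc>_positions \<beta>) (\<lambda>k. (\<beta> k, fst x k, snd x k))"
          by (cases x) (auto simp: fibre_stabilizer_def fun_eq_iff)
        then have "card {\<sigma> \<in> ?H. (fst x \<circ> \<sigma>, snd x \<circ> \<sigma>) = x} =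
            fibre_factorial (\<cc>_positions \<beta>) (\<lambda>k. (\<beta> k, fst x k, snd x k))"
          by (simp only: card_fibre_stabilizer[OF finite_\<cc>_positions])
        then show ?thesis using stabilizer_dvd_term[OF z w \<beta>, of "fst x" "snd x"] L x by auto
      qed
    qed (auto simp: fibre_stabilizer_group comp_assoc)
    then show ?thesis
      by (simp add: p[OF \<beta>] sum.cartesian_product case_prod_unfold card_fibre_stabilizer \<cc>_stabilizer_order_def)
  qed
  ultimately show ?thesis using p0 by (auto simp: admissible_def invariant_def)
qed

end

section \<open>Orbit sums\<close>

interpretation fm: Modules.module "\<lambda>(c::'k::comm_ring_1) (z::'w \<Rightarrow> 'k) \<beta>. c * z \<beta>"
  by unfold_locales (auto simp: fun_eq_iff algebra_simps)

context schur_setup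
begin

lemma admissible_subspace: "fm.subspace {z. admissible z}"
  unfolding fm.subspace_def admissible_def invariant_def by (auto simp: algebra_simps)

text \<open>All letters at an index of the support belong to one finite set. Finiteness is what
  permits the induction on the size of the support in \<open>admissible_in_span\<close>.\<close>

lemma \<Phi>_finite_support:
  assumes x: "x \<in> free_on_words n d"
  shows "finite {\<beta>. \<Phi> x \<beta> \<noteq> 0}"
proof -
  obtain \<Delta> where \<Delta>: "finite \<Delta>" "\<And>w. w \<in> Poly_Mapping.keys x \<Longrightarrow> supports \<Delta> w"
    using ex_supports[of "Poly_Mapping.keys x"] by auto
  have "\<beta> \<in> Ind \<Delta>" if ne: "\<Phi> x \<beta> \<noteq> 0" for \<beta>
  proof -
    obtain w where w: "w \<in> Poly_Mapping.keys x" "word_coord w \<beta> \<noteq> 0"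
      using ne unfolding \<Phi>_def by (metis (no_types, lifting) mult_zero_right sum.neutral)
    have len: "length w = d" using w(1) x by (auto simp: free_on_words_def words_def)
    have \<beta>: "\<beta> \<in> Ind letters" "\<And>k. k < d \<Longrightarrow> letter_coord (\<beta> k) (w ! k) \<noteq> 0"
      using w(2) by (auto simp: word_coord_def split: if_splits)
    have "\<beta> k \<in> \<Delta>" if "k < d" for k
      using \<Delta>(2)[OF w(1)] \<beta>(2)[OF that] that len by (auto simp: supports_def)
    then show ?thesis using \<beta>(1) by (auto simp: Ind_def PiE_def)
  qed
  then show ?thesis using finite_Ind[OF \<Delta>(1)] by (rule_tac finite_subset[of _ "Ind \<Delta>"]) auto
qed

lemma TP_abelian_monoid: "abelian_monoid TP"
  by (rule abelian_monoidI)
    (auto simp: TP_carrier TP_add TP_zero free_add free_zero ac_simps)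

lemma \<psi>_add: "X \<in> carrier TP \<Longrightarrow> Y \<in> carrier TP \<Longrightarrow> \<psi> (X \<oplus>\<^bsub>TP\<^esub> Y) = \<psi> X + \<psi> Y"
  by (auto simp: TP_carrier TP_add \<psi>_tensor_class free_add \<Phi>_add)

lemma \<psi>_zero: "\<psi> \<zero>\<^bsub>TP\<^esub> = 0"
  by (simp add: TP_zero \<psi>_tensor_class free_zero \<Phi>_zero)

lemma \<psi>_smult: "X \<in> carrier TP \<Longrightarrow> \<psi> (c \<odot>\<^bsub>TP\<^esub> X) = (\<lambda>\<beta>. c * \<psi> X \<beta>)"
  by (auto simp: TP_carrier TP_smult \<psi>_tensor_class free_fscale \<Phi>_fscale fun_eq_iff)

lemma smult_closed: "X \<in> carrier TP \<Longrightarrow> c \<odot>\<^bsub>TP\<^esub> X \<in> carrier TP"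
  by (auto simp: TP_carrier TP_smult free_fscale)

lemma \<psi>_inj: "X \<in> carrier TP \<Longrightarrow> Y \<in> carrier TP \<Longrightarrow> \<psi> X = \<psi> Y \<Longrightarrow> X = Y"
  unfolding TP_carrier by clarify (simp only: \<psi>_tensor_class tensor_class_eq)

lemma \<psi>_finsum:
  assumes "finite F" "f \<in> F \<rightarrow> carrier TP"
  shows "\<psi> (finsum TP f F) = (\<Sum>i\<in>F. \<psi> (f i))" "finsum TP f F \<in> carrier TP"
proof -
  interpret TP: abelian_monoid TP by (rule TP_abelian_monoid)
  show "finsum TP f F \<in> carrier TP" using assms(2) by (rule TP.finsum_closed)
  show "\<psi> (finsum TP f F) = (\<Sum>i\<in>F. \<psi> (f i))"
    using assms
  proof (induction F)
    case empty
    then show ?case by (simp add: \<psi>_zero)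
  next
    case (insert i F)
    have f: "f \<in> F \<rightarrow> carrier TP" "f i \<in> carrier TP" using insert.prems by auto
    have "finsum TP f (insert i F) = f i \<oplus>\<^bsub>TP\<^esub> finsum TP f F"
      using TP.finsum_insert[OF insert.hyps f] .
    then show ?case using \<psi>_add[OF f(2) TP.finsum_closed[OF f(1)]] insert.IH[OF f(1)] insert.hyps by simp
  qed
qed

lemma word_coord_basis_word:
  assumes \<beta>: "\<beta> \<in> Ind letters" and \<gamma>: "\<gamma> \<in> Ind letters"
  shows "word_coord (basis_word \<beta>) \<gamma> = (if \<gamma> = \<beta> then 1 else 0)"
proof -
  have c: "letter_coord (\<gamma> k) (basis_word \<beta> ! k) = (if \<gamma> k = \<beta> k then 1 else 0)" if "k < d" for k
    using that letter_coord_letter_matrix[OF Ind_nth[OF \<beta> that]] by (simp add: basis_word_def)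
  show ?thesis
  proof (cases "\<gamma> = \<beta>")
    case True
    then show ?thesis using c \<beta> by (simp add: word_coord_def)
  next
    case False
    then obtain k where k: "k < d" "\<gamma> k \<noteq> \<beta> k"
      using \<beta> \<gamma> PiE_ext[of \<gamma> "{..<d}" "\<lambda>_. letters" \<beta>] unfolding Ind_def by blast
    then have "(\<Prod>k<d. letter_coord (\<gamma> k) (basis_word \<beta> ! k)) = 0"
      using c[OF k(1)] by (intro prod_zero) auto
    then show ?thesis using False by (simp add: word_coord_def)
  qed
qed

lemma \<Phi>_act_basis_word:
  assumes \<sigma>: "\<sigma> permutes {..<d}" and \<beta>: "\<beta> \<in> Ind letters"
  shows "\<Phi> (linear_extension (word_act d \<sigma>) (word (basis_word \<beta>))) \<gamma> =
    (if \<gamma> = \<beta> \<circ> \<sigma> then perm_sign \<sigma> (odds \<beta>) else 0)"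
proof (cases "\<gamma> \<in> Ind letters")
  case True
  let ?g = "\<gamma> \<circ> inv_into UNIV \<sigma>"
  have g: "?g \<circ> \<sigma> = \<gamma>" by (simp add: comp_assoc permutes_inv_o[OF \<sigma>])
  have eq: "?g = \<beta> \<longleftrightarrow> \<gamma> = \<beta> \<circ> \<sigma>"
    using g by (auto simp: comp_assoc permutes_inv_o[OF \<sigma>])
  have G: "?g \<in> Ind letters" by (rule Ind_permute[OF permutes_inv[OF \<sigma>] True])
  have "\<Phi> (linear_extension (word_act d \<sigma>) (word (basis_word \<beta>))) (?g \<circ> \<sigma>) =
      perm_sign \<sigma> (odds ?g) * (if ?g = \<beta> then 1 else 0)"
    unfolding \<Phi>_act[OF free_word[OF basis_word_words] \<sigma> G] \<Phi>_word word_coord_basis_word[OF \<beta> G] ..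
  then have "\<Phi> (linear_extension (word_act d \<sigma>) (word (basis_word \<beta>))) \<gamma> =
      (if ?g = \<beta> then perm_sign \<sigma> (odds ?g) else 0)"
    unfolding g by simp
  also have "\<dots> = (if ?g = \<beta> then perm_sign \<sigma> (odds \<beta>) else 0)"
    by (cases "?g = \<beta>") (simp_all del: comp_apply)
  finally show ?thesis by (simp only: eq)
next
  case False
  then have "\<gamma> \<noteq> \<beta> \<circ> \<sigma>" using Ind_permute[OF \<sigma> \<beta>] by auto
  then show ?thesis using False by (simp add: \<Phi>_outside)
qed

text \<open>The two permutations differ by one that stabilizes \<beta>. As odd letters are distinct,
  it fixes every odd position and has sign 1. The sign thus belongs to the point of the orbit and
  not to the permutation that reaches it.\<close>

lemma perm_sign_orbit:
  assumes t: "odd_distinct \<beta>" and \<sigma>: "\<sigma> permutes {..<d}" and \<sigma>': "\<sigma>' permutes {..<d}"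
    and eq: "\<beta> \<circ> \<sigma> = \<beta> \<circ> \<sigma>'"
  shows "perm_sign \<sigma>' (odds \<beta>) = perm_sign \<sigma> (odds \<beta>)"
proof -
  let ?\<tau> = "\<sigma>' \<circ> inv_into UNIV \<sigma>"
  have \<tau>: "?\<tau> permutes {..<d}" by (rule permutes_compose[OF permutes_inv[OF \<sigma>] \<sigma>'])
  have "\<beta> \<circ> ?\<tau> = (\<beta> \<circ> \<sigma>) \<circ> inv_into UNIV \<sigma>" by (simp only: eq comp_assoc)
  then have b: "\<beta> \<circ> ?\<tau> = \<beta>" by (simp add: comp_assoc permutes_inv_o[OF \<sigma>])
  have s: "\<sigma>' = ?\<tau> \<circ> \<sigma>" by (simp add: comp_assoc permutes_inv_o[OF \<sigma>])
  have fixed: "?\<tau> k = k" if k: "k \<in> odds \<beta>" for k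
  proof -
    have "\<beta> (?\<tau> k) = \<beta> k" using fun_cong[OF b, of k] by simp
    moreover have "k < d" "?\<tau> k < d" using k permutes_in_image[OF \<tau>, of k] by (auto simp: odds_def)
    moreover have "fst (\<beta> k) \<in> B\<^sub>1" using k by (simp add: odds_def)
    ultimately show ?thesis using t unfolding odd_distinct_def by metis
  qed
  have "perm_sign \<sigma>' (odds \<beta>) = perm_sign ?\<tau> (odds \<beta>) * perm_sign \<sigma> {k. ?\<tau> k \<in> odds \<beta>}"
    by (subst s) (rule perm_sign_comp[OF \<tau> \<sigma> odds_sub])
  also have "perm_sign ?\<tau> (odds \<beta>) = 1" by (rule perm_sign_fixed[OF \<tau> fixed])
  also have "{k. ?\<tau> k \<in> odds \<beta>} = odds \<beta>" unfolding odds_permute[OF \<tau>, symmetric] b ..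
  finally show ?thesis by simp
qed

text \<open>The signed indicator function of the orbit of \<beta>. Its values are consistent when
  the sign depends on \<open>\<beta> \<circ> \<sigma>\<close> alone, which
  \<open>perm_sign_orbit\<close> provides for \<open>odd_distinct \<beta>\<close>.\<close>

definition orbit_coordinates :: "(nat \<Rightarrow> 'a \<times> nat \<times> nat) \<Rightarrow> ((nat \<Rightarrow> 'a \<times> nat \<times> nat) \<Rightarrow> 'k) \<Rightarrow> bool" where
  "orbit_coordinates \<beta> z \<longleftrightarrow> (\<forall>\<sigma>. \<sigma> permutes {..<d} \<longrightarrow> z (\<beta> \<circ> \<sigma>) = perm_sign \<sigma> (odds \<beta>)) \<and>
    (\<forall>\<gamma>. (\<nexists>\<sigma>. \<sigma> permutes {..<d} \<and> \<gamma> = \<beta> \<circ> \<sigma>) \<longrightarrow> z \<gamma> = 0)"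

text \<open>Invariance is the cocycle rule \<open>perm_sign_comp\<close>. As the required divisor is
  constant on the orbit, a single scalar factor satisfies the divisibility condition at every
  point.\<close>

lemma admissible_orbit_coordinates:
  assumes z: "orbit_coordinates \<beta> z" and \<beta>: "\<beta> \<in> Ind letters"
  shows "admissible (\<lambda>\<gamma>. of_nat (\<cc>_stabilizer_order \<beta>) * z \<gamma>)"
proof -
  have z1: "z (\<beta> \<circ> \<sigma>) = perm_sign \<sigma> (odds \<beta>)" if "\<sigma> permutes {..<d}" for \<sigma>
    using z that by (simp add: orbit_coordinates_def)
  have z2: "z \<gamma> = 0" if "\<nexists>\<sigma>. \<sigma> permutes {..<d} \<and> \<gamma> = \<beta> \<circ> \<sigma>" for \<gamma>
    using z that by (simp add: orbit_coordinates_def)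
  have "z \<gamma> = 0" if "\<gamma> \<notin> Ind letters" for \<gamma>
    using z2[of \<gamma>] Ind_permute[OF _ \<beta>] that by blast
  moreover have "z (\<gamma> \<circ> \<sigma>) = perm_sign \<sigma> (odds \<gamma>) * z \<gamma>" if \<sigma>: "\<sigma> permutes {..<d}" for \<gamma> \<sigma>
  proof (cases "\<exists>\<tau>. \<tau> permutes {..<d} \<and> \<gamma> = \<beta> \<circ> \<tau>")
    case True
    then obtain \<tau> where \<tau>: "\<tau> permutes {..<d}" "\<gamma> = \<beta> \<circ> \<tau>" by auto
    have "z (\<gamma> \<circ> \<sigma>) = perm_sign (\<tau> \<circ> \<sigma>) (odds \<beta>)"
      unfolding \<tau>(2) comp_assoc by (rule z1[OF permutes_compose[OF \<sigma> \<tau>(1)]])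
    also have "\<dots> = perm_sign \<tau> (odds \<beta>) * perm_sign \<sigma> (odds \<gamma>)"
      unfolding perm_sign_comp[OF \<tau>(1) \<sigma> odds_sub] \<tau>(2) odds_permute[OF \<tau>(1)] ..
    finally show ?thesis using z1[OF \<tau>(1)] \<tau>(2) by (simp add: mult.commute)
  next
    case False
    have "\<nexists>\<tau>. \<tau> permutes {..<d} \<and> \<gamma> \<circ> \<sigma> = \<beta> \<circ> \<tau>"
    proof
      assume "\<exists>\<tau>. \<tau> permutes {..<d} \<and> \<gamma> \<circ> \<sigma> = \<beta> \<circ> \<tau>"
      then obtain \<tau> where \<tau>: "\<tau> permutes {..<d}" "\<gamma> \<circ> \<sigma> = \<beta> \<circ> \<tau>" by auto
      have "\<gamma> = (\<gamma> \<circ> \<sigma>) \<circ> inv_into UNIV \<sigma>" by (simp add: comp_assoc permutes_inv_o[OF \<sigma>])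
      then have "\<gamma> = \<beta> \<circ> (\<tau> \<circ> inv_into UNIV \<sigma>)" unfolding \<tau>(2) by (simp only: comp_assoc)
      moreover have "\<tau> \<circ> inv_into UNIV \<sigma> permutes {..<d}"
        by (rule permutes_compose[OF permutes_inv[OF \<sigma>] \<tau>(1)])
      ultimately show False using False by blast
    qed
    then show ?thesis using z2[of "\<gamma> \<circ> \<sigma>"] z2[OF False] by simp
  qed
  moreover have "of_nat (\<cc>_stabilizer_order \<gamma>) dvd of_nat (\<cc>_stabilizer_order \<beta>) * z \<gamma>" for \<gamma>
  proof (cases "\<exists>\<tau>. \<tau> permutes {..<d} \<and> \<gamma> = \<beta> \<circ> \<tau>")
    case True
    then have "\<cc>_stabilizer_order \<gamma> = \<cc>_stabilizer_order \<beta>" using \<cc>_stabilizer_order_permute by blast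
    then show ?thesis by simp
  next
    case False
    then show ?thesis using z2[of \<gamma>] by simp
  qed
  ultimately show ?thesis by (simp add: admissible_def invariant_def mult_ac)
qed

section \<open>Triples as indices\<close>

definition index_of :: "'a list \<Rightarrow> nat list \<Rightarrow> nat list \<Rightarrow> nat \<Rightarrow> 'a \<times> nat \<times> nat" where
  "index_of b r s = restrict (\<lambda>k. (b ! k, r ! k, s ! k)) {..<d}"

lemma Tri_index_of:
  assumes "(b, r, s) \<in> Tri n d basis"
  shows "index_of b r s \<in> Ind letters" "odd_distinct (index_of b r s)"
proof -
  have t: "length b = d" "length r = d" "length s = d" "set b \<subseteq> basis" "set r \<subseteq> {..<n}" "set s \<subseteq> {..<n}"
    "\<And>k l. k < d \<Longrightarrow> l < d \<Longrightarrow> k \<noteq> l \<Longrightarrow> (b ! k, r ! k, s ! k) = (b ! l, r ! l, s ! l) \<Longrightarrow> b ! k \<in> A0"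
    using assms by (auto simp: Tri_def)
  have in_set: "b ! k \<in> basis" "r ! k < n" "s ! k < n" if "k < d" for k
  proof -
    have "b ! k \<in> set b" "r ! k \<in> set r" "s ! k \<in> set s" using that t(1-3) by simp_all
    then show "b ! k \<in> basis" "r ! k < n" "s ! k < n" using t(4-6) by auto
  qed
  then show "index_of b r s \<in> Ind letters" by (auto simp: index_of_def Ind_def letters_def)
  have "b ! k \<notin> B\<^sub>1" if "k < d" "b ! k \<in> A0" for k
  proof
    assume "b ! k \<in> B\<^sub>1"
    then have "b ! k \<in> A0 \<inter> A1" using that(2) B_sub(5) by auto
    then have "b ! k = 0" unfolding A0_Int_A1 by simp
    then show False using in_set(1)[OF that(1)] zero_notin_basis by simp
  qed
  then show "odd_distinct (index_of b r s)" using t(7) by (auto simp: odd_distinct_def index_of_def)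
qed

lemma index_of_surj:
  assumes \<beta>: "\<beta> \<in> Ind letters" and t: "odd_distinct \<beta>"
  obtains b r s where "(b, r, s) \<in> Tri n d basis" "index_of b r s = \<beta>"
proof -
  let ?b = "map (\<lambda>k. fst (\<beta> k)) [0..<d]" and ?r = "map (\<lambda>k. fst (snd (\<beta> k))) [0..<d]"
    and ?s = "map (\<lambda>k. snd (snd (\<beta> k))) [0..<d]"
  have l: "fst (\<beta> k) \<in> basis" "fst (snd (\<beta> k)) < n" "snd (snd (\<beta> k)) < n" if "k < d" for k
    using Ind_nth[OF \<beta> that] by (auto simp: letters_def)
  have "fst (\<beta> k) \<in> A0" if "k < d" "l < d" "k \<noteq> l" "\<beta> k = \<beta> l" for k l
  proof -
    have "fst (\<beta> k) \<notin> B\<^sub>1" using t that unfolding odd_distinct_def by blast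
    then show ?thesis using l(1)[OF that(1)] B_sub(2,3) by (auto simp: basis_def)
  qed
  then have "(?b, ?r, ?s) \<in> Tri n d basis"
    using l by (auto simp: Tri_def prod_eq_iff)
  moreover have "index_of ?b ?r ?s = \<beta>"
    using \<beta> by (auto simp: index_of_def Ind_def PiE_def extensional_def fun_eq_iff)
  ultimately show ?thesis by (rule that)
qed

text \<open>The product in \<open>\<cc>_factorial\<close> includes triples that do not occur;
  \<open>fibre_factorial_superset\<close> accounts for their factors 1.\<close>

lemma \<cc>_factorial_index_of:
  assumes "(b, r, s) \<in> Tri n d basis"
  shows "\<cc>_factorial n d B\<^sub>\<cc> b r s = \<cc>_stabilizer_order (index_of b r s)"
proof -
  have t: "length b = d" "length r = d" "length s = d" "set r \<subseteq> {..<n}" "set s \<subseteq> {..<n}"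
    using assms by (auto simp: Tri_def)
  let ?\<beta> = "index_of b r s"
  have "r ! k < n" "s ! k < n" if "k < d" for k
  proof -
    have "r ! k \<in> set r" "s ! k \<in> set s" using that t(2,3) by simp_all
    then show "r ! k < n" "s ! k < n" using t(4,5) by auto
  qed
  then have sub: "?\<beta> ` \<cc>_positions ?\<beta> \<subseteq> (B\<^sub>\<cc> \<inter> set b) \<times> {..<n} \<times> {..<n}"
    using t by (auto simp: \<cc>_positions_def index_of_def)
  have "\<cc>_stabilizer_order ?\<beta> = (\<Prod>y\<in>(B\<^sub>\<cc> \<inter> set b) \<times> {..<n} \<times> {..<n}. fact (card {k \<in> \<cc>_positions ?\<beta>. ?\<beta> k = y}))"
    unfolding \<cc>_stabilizer_order_def by (rule fibre_factorial_superset[OF _ sub]) simp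
  also have "\<dots> = (\<Prod>(x, i, j)\<in>(B\<^sub>\<cc> \<inter> set b) \<times> {..<n} \<times> {..<n}. fact (multiplicity_of d b r s x i j))"
  proof (rule prod.cong[OF refl])
    fix y assume "y \<in> (B\<^sub>\<cc> \<inter> set b) \<times> {..<n} \<times> {..<n}"
    then obtain x i j where y: "y = (x, i, j)" "x \<in> B\<^sub>\<cc>" by auto
    have "{k \<in> \<cc>_positions ?\<beta>. ?\<beta> k = y} = {k. k < d \<and> (b ! k, r ! k, s ! k) = (x, i, j)}"
      using y by (auto simp: \<cc>_positions_def index_of_def)
    then show "fact (card {k \<in> \<cc>_positions ?\<beta>. ?\<beta> k = y}) =
        (case y of (x, i, j) \<Rightarrow> fact (multiplicity_of d b r s x i j))"
      by (simp add: y multiplicity_of_def)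
  qed
  also have "\<dots> = \<cc>_factorial n d B\<^sub>\<cc> b r s"
    unfolding \<cc>_factorial_def by (simp add: prod.cartesian_product case_prod_unfold)
  finally show ?thesis by simp
qed

lemma permute_list_eq_self_iff:
  assumes "\<sigma> permutes {..<d}" "length xs = d"
  shows "permute_list \<sigma> xs = xs \<longleftrightarrow> (\<forall>k<d. xs ! \<sigma> k = xs ! k)"
  using assms by (auto simp: list_eq_iff_nth_eq permute_list_nth)

lemma stabilizer_index_of:
  assumes "length b = d" "length r = d" "length s = d"
  shows "stabilizer d b r s = {\<sigma>. \<sigma> permutes {..<d} \<and> index_of b r s \<circ> \<sigma> = index_of b r s}"
proof -
  have "(permute_list \<sigma> b = b \<and> permute_list \<sigma> r = r \<and> permute_list \<sigma> s = s) \<longleftrightarrow> index_of b r s \<circ> \<sigma> = index_of b r s"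
    if \<sigma>: "\<sigma> permutes {..<d}" for \<sigma>
  proof -
    have lt: "\<sigma> k < d \<longleftrightarrow> k < d" for k using permutes_in_image[OF \<sigma>, of k] by simp
    show ?thesis
      unfolding permute_list_eq_self_iff[OF \<sigma> assms(1)] permute_list_eq_self_iff[OF \<sigma> assms(2)]
        permute_list_eq_self_iff[OF \<sigma> assms(3)]
      by (auto simp: fun_eq_iff index_of_def lt)
  qed
  then show ?thesis unfolding stabilizer_def by blast
qed

text \<open>The cosets of the stabilizer are the fibres of
  \<open>\<tau> \<mapsto> index_of b r s \<circ> \<tau>\<close>, so they correspond to the points of
  the orbit.\<close>

lemma coset_eq:
  assumes "length b = d" "length r = d" "length s = d" and \<sigma>: "\<sigma> permutes {..<d}"
  shows "(\<lambda>\<tau>. \<tau> \<circ> \<sigma>) ` stabilizer d b r s = {\<tau>. \<tau> permutes {..<d} \<and> index_of b r s \<circ> \<tau> = index_of b r s \<circ> \<sigma>}"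
    (is "?L = ?R")
proof
  show "?L \<subseteq> ?R"
    unfolding stabilizer_index_of[OF assms(1-3)] using permutes_compose[OF \<sigma>] by (auto simp: comp_assoc[symmetric])
  show "?R \<subseteq> ?L"
  proof
    fix \<tau> assume "\<tau> \<in> ?R"
    then have \<tau>: "\<tau> permutes {..<d}" "index_of b r s \<circ> \<tau> = index_of b r s \<circ> \<sigma>" by auto
    let ?\<rho> = "\<tau> \<circ> inv_into UNIV \<sigma>"
    have "index_of b r s \<circ> ?\<rho> = (index_of b r s \<circ> \<sigma>) \<circ> inv_into UNIV \<sigma>" by (simp only: \<tau>(2)[symmetric] comp_assoc)
    then have "index_of b r s \<circ> ?\<rho> = index_of b r s" by (simp add: comp_assoc permutes_inv_o[OF \<sigma>])
    moreover have "?\<rho> permutes {..<d}" by (rule permutes_compose[OF permutes_inv[OF \<sigma>] \<tau>(1)])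
    ultimately have r: "?\<rho> \<in> stabilizer d b r s" unfolding stabilizer_index_of[OF assms(1-3)] by simp
    have eq: "\<tau> = ?\<rho> \<circ> \<sigma>" by (simp add: comp_assoc permutes_inv_o[OF \<sigma>])
    show "\<tau> \<in> ?L" by (rule image_eqI[of _ "\<lambda>\<tau>. \<tau> \<circ> \<sigma>", OF eq r])
  qed
qed

text \<open>The sum over cosets has exactly one term for each point of the orbit, and by
  \<open>perm_sign_orbit\<close> the sign of that term is independent of the representative picked
  by \<open>SOME\<close>.\<close>

lemma \<xi>_coordinates:
  assumes T: "(b, r, s) \<in> Tri n d basis"
  shows "\<xi> n d e b r s \<in> carrier TP" "orbit_coordinates (index_of b r s) (\<psi> (\<xi> n d e b r s))"
proof -
  have len: "length b = d" "length r = d" "length s = d" using T by (auto simp: Tri_def)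
  let ?\<beta> = "index_of b r s" and ?Cs = "stabilizer_cosets d b r s" and ?rp = "\<lambda>C. SOME \<sigma>. \<sigma> \<in> (C :: (nat \<Rightarrow> nat) set)"
  let ?perms = "{\<sigma>. \<sigma> permutes {..<d}}" and ?orb = "\<lambda>\<sigma>. {\<tau>. \<tau> permutes {..<d} \<and> ?\<beta> \<circ> \<tau> = ?\<beta> \<circ> \<sigma>}"
  have \<beta>: "?\<beta> \<in> Ind letters" "odd_distinct ?\<beta>" using Tri_index_of[OF T] .
  have Cs: "?Cs = ?orb ` ?perms"
    unfolding stabilizer_cosets_def by (intro image_cong refl coset_eq[OF len]) simp
  have fin: "finite ?Cs" unfolding Cs by (intro finite_imageI finite_permutations) simp
  have rp: "?rp (?orb \<sigma>) permutes {..<d} \<and> ?\<beta> \<circ> ?rp (?orb \<sigma>) = ?\<beta> \<circ> \<sigma>" if "\<sigma> permutes {..<d}" for \<sigma>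
    using someI[of "\<lambda>\<tau>. \<tau> \<in> ?orb \<sigma>" \<sigma>] that by simp
  have rpC: "?rp C permutes {..<d}" if "C \<in> ?Cs" for C using that rp unfolding Cs by blast
  have w: "map (\<lambda>k. matrix_unit n (b ! k) (r ! k) (s ! k)) [0..<d] = basis_word ?\<beta>"
    by (simp add: basis_word_def index_of_def)
  let ?x = "\<lambda>C. linear_extension (word_act d (?rp C)) (word (basis_word ?\<beta>))"
  have free: "?x C \<in> free_on_words n d" if "C \<in> ?Cs" for C
    by (intro free_linear_extension free_word_act free_word basis_word_words rpC that)
  let ?X = "\<lambda>C. act n d (?rp C) (pure n d (map (\<lambda>k. matrix_unit n (b ! k) (r ! k) (s ! k)) [0..<d]))"
  have X: "?X C = tensor_class (?x C)" if "C \<in> ?Cs" for C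
    unfolding w pure_def tensor_class_def[symmetric] by (rule act_tensor_class[OF free_word[OF basis_word_words] rpC[OF that]])
  have XF: "?X \<in> ?Cs \<rightarrow> carrier TP" using X free by (auto simp: TP_carrier)
  show "\<xi> n d e b r s \<in> carrier TP" unfolding \<xi>_def by (rule \<psi>_finsum(2)[OF fin XF])
  have "\<psi> (\<xi> n d e b r s) = (\<Sum>C\<in>?Cs. \<psi> (?X C))" unfolding \<xi>_def by (rule \<psi>_finsum(1)[OF fin XF])
  also have "\<dots> = (\<Sum>C\<in>?Cs. \<Phi> (?x C))" by (rule sum.cong[OF refl]) (simp only: X \<psi>_tensor_class free)
  finally have v: "\<psi> (\<xi> n d e b r s) \<gamma> =
      (\<Sum>C\<in>?Cs. if \<gamma> = ?\<beta> \<circ> ?rp C then perm_sign (?rp C) (odds ?\<beta>) else 0)" for \<gamma>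
    by (simp add: sum_fun_apply \<Phi>_act_basis_word[OF rpC \<beta>(1)] cong: sum.cong)
  have "\<psi> (\<xi> n d e b r s) (?\<beta> \<circ> \<sigma>) = perm_sign \<sigma> (odds ?\<beta>)" if \<sigma>: "\<sigma> permutes {..<d}" for \<sigma>
  proof -
    have eq: "?\<beta> \<circ> \<sigma> = ?\<beta> \<circ> ?rp C \<longleftrightarrow> C = ?orb \<sigma>" if "C \<in> ?Cs" for C
    proof -
      from that obtain \<tau> where \<tau>: "\<tau> permutes {..<d}" "C = ?orb \<tau>" unfolding Cs by auto
      have r: "?\<beta> \<circ> ?rp C = ?\<beta> \<circ> \<tau>" unfolding \<tau>(2) using rp[OF \<tau>(1)] by (rule conjunct2)
      show ?thesis
      proof
        assume "?\<beta> \<circ> \<sigma> = ?\<beta> \<circ> ?rp C"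
        then show "C = ?orb \<sigma>" unfolding \<tau>(2)[symmetric] r using \<tau>(2) by simp
      next
        assume "C = ?orb \<sigma>"
        then show "?\<beta> \<circ> \<sigma> = ?\<beta> \<circ> ?rp C" using conjunct2[OF rp[OF \<sigma>]] by simp
      qed
    qed
    have "\<psi> (\<xi> n d e b r s) (?\<beta> \<circ> \<sigma>) = (\<Sum>C\<in>?Cs. if C = ?orb \<sigma> then perm_sign (?rp C) (odds ?\<beta>) else 0)"
      unfolding v by (rule sum.cong[OF refl]) (simp only: eq)
    also have "\<dots> = perm_sign (?rp (?orb \<sigma>)) (odds ?\<beta>)"
      using fin \<sigma> unfolding Cs by (subst sum.delta) auto
    also have "\<dots> = perm_sign \<sigma> (odds ?\<beta>)"
      using perm_sign_orbit[OF \<beta>(2) \<sigma> conjunct1[OF rp[OF \<sigma>]]] rp[OF \<sigma>] by simp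
    finally show ?thesis .
  qed
  moreover have "\<psi> (\<xi> n d e b r s) \<gamma> = 0" if "\<nexists>\<sigma>. \<sigma> permutes {..<d} \<and> \<gamma> = ?\<beta> \<circ> \<sigma>" for \<gamma>
    unfolding v by (rule sum.neutral) (use that rpC in auto)
  ultimately show "orbit_coordinates ?\<beta> (\<psi> (\<xi> n d e b r s))" unfolding orbit_coordinates_def by blast
qed

end

section \<open>The span of the scaled orbit sums\<close>

context schur_setup
begin

definition etas :: "('a mat list \<Rightarrow>\<^sub>0 'k) set set" where
  "etas = {\<eta> n d e B\<^sub>\<cc> b r s | b r s. (b, r, s) \<in> Tri n d basis}"

lemma T_span_etas: "T_span n d e B\<^sub>\<aa> B\<^sub>\<cc> B\<^sub>1 = mspan TP etas"
  by (simp add: T_span_def etas_def basis_def)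

lemma \<psi>_\<eta>:
  assumes T: "(b, r, s) \<in> Tri n d basis"
  shows "\<eta> n d e B\<^sub>\<cc> b r s \<in> carrier TP"
    "\<psi> (\<eta> n d e B\<^sub>\<cc> b r s) = (\<lambda>\<gamma>. of_nat (\<cc>_stabilizer_order (index_of b r s)) * \<psi> (\<xi> n d e b r s) \<gamma>)"
  unfolding \<eta>_def
  using \<psi>_smult[OF \<xi>_coordinates(1)[OF T]] smult_closed[OF \<xi>_coordinates(1)[OF T]] \<cc>_factorial_index_of[OF T]
  by simp_all

lemma etas_carrier: "etas \<subseteq> carrier TP"
  using \<psi>_\<eta>(1) by (auto simp: etas_def)

lemma admissible_etas: "\<psi> ` etas \<subseteq> {z. admissible z}"
proof -
  have "admissible (\<psi> (\<eta> n d e B\<^sub>\<cc> b r s))" if "(b, r, s) \<in> Tri n d basis" for b r s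
    unfolding \<psi>_\<eta>(2)[OF that]
    by (rule admissible_orbit_coordinates[OF \<xi>_coordinates(2)[OF that] Tri_index_of(1)[OF that]])
  then show ?thesis by (auto simp: etas_def)
qed

text \<open>Induction on the size of the support: a multiple of a generator cancels the value at one
  \<beta> and creates no new nonzero value, because its support lies in the orbit of \<beta>, where
  invariance keeps \<open>z\<close> nonzero.\<close>

lemma admissible_in_span:
  assumes "admissible z" "finite {\<beta>. z \<beta> \<noteq> 0}"
  shows "z \<in> fm.span (\<psi> ` etas)"
  using assms
proof (induction "card {\<beta>. z \<beta> \<noteq> 0}" arbitrary: z rule: less_induct)
  case less
  show ?case
  proof (cases "z = 0")
    case True
    then show ?thesis by (simp add: fm.span_zero)
  next
    case False
    then obtain \<beta> where \<beta>: "z \<beta> \<noteq> 0" by (auto simp: fun_eq_iff)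
    have inv: "invariant z" using less.prems by (simp add: admissible_def)
    have bL: "\<beta> \<in> Ind letters" using inv \<beta> by (auto simp: invariant_def)
    have "odd_distinct \<beta>" using invariant_not_odd_distinct[OF inv bL] \<beta> by auto
    then obtain b r s where T: "(b, r, s) \<in> Tri n d basis" and index_of: "index_of b r s = \<beta>"
      using index_of_surj[OF bL] by blast
    define h where "h = \<psi> (\<eta> n d e B\<^sub>\<cc> b r s)"
    have hE: "h \<in> \<psi> ` etas" using T by (auto simp: h_def etas_def)
    have hg: "admissible h" using hE admissible_etas by auto
    note oc = \<xi>_coordinates(2)[OF T, unfolded index_of]
    have h: "h \<gamma> = of_nat (\<cc>_stabilizer_order \<beta>) * \<psi> (\<xi> n d e b r s) \<gamma>" for \<gamma>
      by (simp add: h_def \<psi>_\<eta>(2)[OF T] index_of)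
    have "\<psi> (\<xi> n d e b r s) (\<beta> \<circ> id) = perm_sign id (odds \<beta>)"
      using oc permutes_id unfolding orbit_coordinates_def by blast
    then have hb: "h \<beta> = of_nat (\<cc>_stabilizer_order \<beta>)"
      using perm_sign_fixed[OF permutes_id, of "odds \<beta>"] by (simp add: h)
    \<comment> \<open>Divisibility enters here: the generator takes exactly the value
      \<open>of_nat (\<cc>_stabilizer_order \<beta>)\<close> at \<beta>, so \<open>q\<close> is the
      coefficient to subtract.\<close>
    obtain q where q: "z \<beta> = of_nat (\<cc>_stabilizer_order \<beta>) * q"
      using less.prems bL unfolding admissible_def by (auto elim: dvdE)
    define z' where "z' = z - (\<lambda>\<gamma>. q * h \<gamma>)"
    have "admissible z'"
      using fm.subspace_diff[OF admissible_subspace, of z "\<lambda>\<gamma>. q * h \<gamma>"]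
        fm.subspace_scale[OF admissible_subspace, of h q] less.prems hg by (simp add: z'_def)
    moreover have sub: "{\<gamma>. z' \<gamma> \<noteq> 0} \<subset> {\<gamma>. z \<gamma> \<noteq> 0}"
    proof
      show "{\<gamma>. z' \<gamma> \<noteq> 0} \<subseteq> {\<gamma>. z \<gamma> \<noteq> 0}"
      proof (rule Collect_mono, rule impI, rule notI)
        fix \<gamma> assume z': "z' \<gamma> \<noteq> 0" and z0: "z \<gamma> = 0"
        then have "\<psi> (\<xi> n d e b r s) \<gamma> \<noteq> 0" by (auto simp: z'_def h)
        then obtain \<sigma> where \<sigma>: "\<sigma> permutes {..<d}" "\<gamma> = \<beta> \<circ> \<sigma>"
          using oc unfolding orbit_coordinates_def by blast
        have "z \<gamma> = perm_sign \<sigma> (odds \<beta>) * z \<beta>" using inv \<sigma> bL unfolding invariant_def by blast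
        then show False using z0 \<beta> by (simp add: perm_sign_def)
      qed
      have "z' \<beta> = 0" by (simp add: z'_def hb q mult.commute)
      then show "{\<gamma>. z' \<gamma> \<noteq> 0} \<noteq> {\<gamma>. z \<gamma> \<noteq> 0}" using \<beta> by blast
    qed
    ultimately have "z' \<in> fm.span (\<psi> ` etas)"
      using less.hyps[of z'] psubset_card_mono[OF less.prems(2) sub] finite_subset[OF _ less.prems(2)] by blast
    moreover have "(\<lambda>\<gamma>. q * h \<gamma>) \<in> fm.span (\<psi> ` etas)"
      by (rule fm.span_scale[OF fm.span_base[OF hE]])
    ultimately have "z' + (\<lambda>\<gamma>. q * h \<gamma>) \<in> fm.span (\<psi> ` etas)" by (rule fm.span_add)
    then show ?thesis by (simp add: z'_def)
  qed
qed

text \<open>This reduces every closure property of \<open>T\<close> to one of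
  \<open>admissible\<close>. Admissible functions form a submodule containing the coordinates of the
  generators; conversely \<open>admissible_in_span\<close> yields a combination with the right
  coordinates, and coordinates determine the tensor.\<close>

lemma T_span_iff: "X \<in> T_span n d e B\<^sub>\<aa> B\<^sub>\<cc> B\<^sub>1 \<longleftrightarrow> X \<in> carrier TP \<and> admissible (\<psi> X)"
proof
  assume "X \<in> T_span n d e B\<^sub>\<aa> B\<^sub>\<cc> B\<^sub>1"
  then obtain F c where F: "X = (\<Oplus>\<^bsub>TP\<^esub>x\<in>F. c x \<odot>\<^bsub>TP\<^esub> x)" "finite F" "F \<subseteq> etas"
    by (auto simp: T_span_etas mspan_def)
  have Fc: "F \<subseteq> carrier TP" using F(3) etas_carrier by auto
  then have f: "(\<lambda>x. c x \<odot>\<^bsub>TP\<^esub> x) \<in> F \<rightarrow> carrier TP" using smult_closed by auto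
  have "\<psi> X = (\<Sum>x\<in>F. \<psi> (c x \<odot>\<^bsub>TP\<^esub> x))" unfolding F(1) by (rule \<psi>_finsum(1)[OF F(2) f])
  also have "\<dots> \<in> {z. admissible z}"
  proof (rule fm.subspace_sum[OF admissible_subspace])
    fix x assume x: "x \<in> F"
    then have "\<psi> x \<in> {z. admissible z}" using F(3) admissible_etas by auto
    then show "\<psi> (c x \<odot>\<^bsub>TP\<^esub> x) \<in> {z. admissible z}"
      using x Fc \<psi>_smult[of x "c x"] fm.subspace_scale[OF admissible_subspace, of "\<psi> x" "c x"] by auto
  qed
  finally show "X \<in> carrier TP \<and> admissible (\<psi> X)" using \<psi>_finsum(2)[OF F(2) f] F(1) by simp
next
  assume X: "X \<in> carrier TP \<and> admissible (\<psi> X)"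
  then obtain x where x: "x \<in> free_on_words n d" "X = tensor_class x" by (auto simp: TP_carrier)
  have "finite {\<beta>. \<psi> X \<beta> \<noteq> 0}" using \<Phi>_finite_support[OF x(1)] by (simp add: x \<psi>_tensor_class)
  then have "\<psi> X \<in> fm.span (\<psi> ` etas)" using X admissible_in_span by simp
  then obtain t u where t: "finite t" "t \<subseteq> \<psi> ` etas" "\<psi> X = (\<Sum>a\<in>t. (\<lambda>\<beta>. u a * a \<beta>))"
    unfolding fm.span_explicit by auto
  \<comment> \<open>\<open>mspan\<close> attaches coefficients to tensors, the span on the other
    side attaches them to coordinate functions; a set on which \<open>\<psi>\<close> is injective
    carries the coefficients over.\<close>
  obtain F where F: "F \<subseteq> etas" "inj_on \<psi> F" "t = \<psi> ` F"
    using t(2) by (auto simp: subset_image_inj)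
  have fF: "finite F" using t(1) F by (simp add: finite_image_iff)
  have Fc: "F \<subseteq> carrier TP" using F(1) etas_carrier by auto
  let ?f = "\<lambda>x. u (\<psi> x) \<odot>\<^bsub>TP\<^esub> x"
  have f: "?f \<in> F \<rightarrow> carrier TP" using Fc smult_closed by auto
  have "\<psi> (finsum TP ?f F) = (\<Sum>x\<in>F. \<psi> (?f x))" by (rule \<psi>_finsum(1)[OF fF f])
  also have "\<dots> = (\<Sum>x\<in>F. (\<lambda>\<beta>. u (\<psi> x) * \<psi> x \<beta>))"
    by (intro sum.cong refl \<psi>_smult) (use Fc in auto)
  also have "\<dots> = \<psi> X" unfolding t(3) F(3) sum.reindex[OF F(2)] by simp
  finally have "finsum TP ?f F = X" using \<psi>_inj[OF \<psi>_finsum(2)[OF fF f]] X by simp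
  then show "X \<in> T_span n d e B\<^sub>\<aa> B\<^sub>\<cc> B\<^sub>1" unfolding T_span_etas mspan_def using fF F(1)
    by (intro CollectI exI[of _ F] exI[of _ "\<lambda>x. u (\<psi> x)"]) simp
qed

text \<open>This gives the inclusion of \<open>T\<close> in \<open>S\<close>: by
  \<open>\<Phi>_act\<close> the action multiplies coordinates by the very sign that
  \<open>invariant\<close> prescribes.\<close>

lemma act_invariant:
  assumes X: "X \<in> carrier TP" and inv: "invariant (\<psi> X)" and \<sigma>: "\<sigma> permutes {..<d}"
  shows "act n d \<sigma> X = X"
proof -
  obtain x where x: "x \<in> free_on_words n d" "X = tensor_class x" using X by (auto simp: TP_carrier)
  let ?L = "linear_extension (word_act d \<sigma>) x"
  have L: "?L \<in> free_on_words n d" by (intro free_linear_extension free_word_act x(1) \<sigma>)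
  have inv: "invariant (\<Phi> x)" using inv by (simp add: x \<psi>_tensor_class)
  have "\<Phi> ?L = \<Phi> x"
  proof
    fix \<beta> :: "nat \<Rightarrow> 'a \<times> nat \<times> nat"
    show "\<Phi> ?L \<beta> = \<Phi> x \<beta>"
    proof (cases "\<beta> \<in> Ind letters")
      case True
      let ?g = "\<beta> \<circ> inv_into UNIV \<sigma>"
      have g: "?g \<circ> \<sigma> = \<beta>" by (simp add: comp_assoc permutes_inv_o[OF \<sigma>])
      have G: "?g \<in> Ind letters" by (rule Ind_permute[OF permutes_inv[OF \<sigma>] True])
      have "\<Phi> ?L (?g \<circ> \<sigma>) = \<Phi> x (?g \<circ> \<sigma>)"
        using \<Phi>_act[OF x(1) \<sigma> G] inv \<sigma> G unfolding invariant_def by metis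
      then show ?thesis unfolding g .
    qed (simp add: \<Phi>_outside)
  qed
  then show ?thesis using act_tensor_class[OF x(1) \<sigma>] tensor_class_eq[OF L x(1)] by (simp add: x(2))
qed

text \<open>The entries of the identity matrix lie in \<open>\<aa>\<close>, so its coordinates
  vanish at every index with a letter outside \<open>B\<^sub>\<aa>\<close>. The remaining indices
  have neither odd nor \<open>\<cc>\<close>-positions, so that all signs and the required divisor
  are 1.\<close>

lemma T_span_one: "\<one>\<^bsub>TP\<^esub> \<in> T_span n d e B\<^sub>\<aa> B\<^sub>\<cc> B\<^sub>1"
proof -
  let ?I = "mat n n (\<lambda>(i, j). if i = j then e else 0)"
  let ?w = "replicate d ?I"
  have w: "?w \<in> words n d" by (auto simp: words_def)
  have one: "\<one>\<^bsub>TP\<^esub> = tensor_class (word ?w)" by (simp add: tensor_power_def pure_def tensor_class_def)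
  have \<psi>: "\<psi> (tensor_class (word ?w)) = word_coord ?w"
    by (simp add: \<psi>_tensor_class free_word[OF w] \<Phi>_word fun_eq_iff)
  have val: "word_coord ?w \<beta> = (\<Prod>k<d. letter_coord (\<beta> k) ?I)" if "\<beta> \<in> Ind letters" for \<beta>
    using that by (simp add: word_coord_def)
  have crd0: "letter_coord t ?I = 0" if "fst t \<notin> B\<^sub>\<aa>" for t
    using that by (cases t) (auto simp: rep_\<aa> unit_in_\<aa> rep_zero)
  have zero: "word_coord ?w \<beta> = 0" if "\<beta> \<in> Ind letters" "k < d" "fst (\<beta> k) \<notin> B\<^sub>\<aa>" for \<beta> k
    unfolding val[OF that(1)] using that(2) crd0[OF that(3)] by (intro prod_zero) auto
  have inv: "word_coord ?w (\<beta> \<circ> \<sigma>) = perm_sign \<sigma> (odds \<beta>) * word_coord ?w \<beta>"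
    if \<sigma>: "\<sigma> permutes {..<d}" and \<beta>: "\<beta> \<in> Ind letters" for \<sigma> \<beta>
  proof -
    have eq: "word_coord ?w (\<beta> \<circ> \<sigma>) = word_coord ?w \<beta>"
      unfolding val[OF \<beta>] val[OF Ind_permute[OF \<sigma> \<beta>]]
      using prod.permute[OF \<sigma>, of "\<lambda>k. letter_coord (\<beta> k) ?I"] by (simp add: o_def)
    show ?thesis
    proof (cases "odds \<beta> = {}")
      case True
      then show ?thesis using eq perm_sign_fixed[OF \<sigma>, of "{}"] by simp
    next
      case False
      then obtain k where "k < d" "fst (\<beta> k) \<in> B\<^sub>1" by (auto simp: odds_def)
      then have "word_coord ?w \<beta> = 0" using zero[OF \<beta>] B_disjoint(2) by blast
      then show ?thesis using eq by simp
    qed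
  qed
  have dvd: "of_nat (\<cc>_stabilizer_order \<beta>) dvd word_coord ?w \<beta>" if \<beta>: "\<beta> \<in> Ind letters" for \<beta>
  proof (cases "\<cc>_positions \<beta> = {}")
    case True
    then show ?thesis by (simp add: \<cc>_stabilizer_order_def fibre_factorial_def)
  next
    case False
    then obtain k where "k < d" "fst (\<beta> k) \<in> B\<^sub>\<cc>" by (auto simp: \<cc>_positions_def)
    then have "word_coord ?w \<beta> = 0" using zero[OF \<beta>] B_disjoint(1) by blast
    then show ?thesis by simp
  qed
  have "admissible (word_coord ?w)" unfolding admissible_def invariant_def using inv dvd by (auto simp: word_coord_def)
  then show ?thesis unfolding T_span_iff one \<psi> using free_word[OF w] by (auto simp: TP_carrier)
qed

lemma T_span_mult:
  assumes "X \<in> T_span n d e B\<^sub>\<aa> B\<^sub>\<cc> B\<^sub>1" "Y \<in> T_span n d e B\<^sub>\<aa> B\<^sub>\<cc> B\<^sub>1"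
  shows "X \<otimes>\<^bsub>TP\<^esub> Y \<in> T_span n d e B\<^sub>\<aa> B\<^sub>\<cc> B\<^sub>1"
proof -
  obtain x y where x: "x \<in> free_on_words n d" "X = tensor_class x" "admissible (\<Phi> x)"
    and y: "y \<in> free_on_words n d" "Y = tensor_class y" "admissible (\<Phi> y)"
    using assms unfolding T_span_iff TP_carrier by (auto simp: \<psi>_tensor_class)
  obtain \<Delta> where \<Delta>: "finite \<Delta>" "\<Delta> \<subseteq> letters"
    "\<And>w. w \<in> Poly_Mapping.keys x \<union> Poly_Mapping.keys y \<Longrightarrow> supports \<Delta> w"
    using ex_supports[of "Poly_Mapping.keys x \<union> Poly_Mapping.keys y"] by auto
  have "admissible (\<Phi> (free_mult d x y))"
  proof (rule admissible_product[OF x(3) y(3) \<Delta>(1,2)])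
    show "\<Phi> (free_mult d x y) \<beta> = (\<Sum>\<gamma>\<in>Ind \<Delta>. \<Sum>\<delta>\<in>Ind \<Delta>. \<Phi> x \<gamma> * \<Phi> y \<delta> * structure_const \<beta> \<gamma> \<delta>)"
      if "\<beta> \<in> Ind letters" for \<beta>
      by (rule \<Phi>_free_mult[OF x(1) _ y(1) _ that]) (use \<Delta>(3) in blast)+
  qed (rule \<Phi>_outside)
  then show ?thesis
    using free_free_mult[OF x(1) y(1)] TP_mult[OF x(1) y(1)]
    unfolding T_span_iff x(2) y(2) by (auto simp: TP_carrier \<psi>_tensor_class)
qed

lemma T_span_add:
  "X \<in> T_span n d e B\<^sub>\<aa> B\<^sub>\<cc> B\<^sub>1 \<Longrightarrow> Y \<in> T_span n d e B\<^sub>\<aa> B\<^sub>\<cc> B\<^sub>1 \<Longrightarrow>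
    X \<oplus>\<^bsub>TP\<^esub> Y \<in> T_span n d e B\<^sub>\<aa> B\<^sub>\<cc> B\<^sub>1"
  using fm.subspace_add[OF admissible_subspace, of "\<psi> X" "\<psi> Y"] abelian_monoid.a_closed[OF TP_abelian_monoid]
  by (simp add: T_span_iff \<psi>_add)

lemma T_span_smult:
  "X \<in> T_span n d e B\<^sub>\<aa> B\<^sub>\<cc> B\<^sub>1 \<Longrightarrow> c \<odot>\<^bsub>TP\<^esub> X \<in> T_span n d e B\<^sub>\<aa> B\<^sub>\<cc> B\<^sub>1"
  using fm.subspace_scale[OF admissible_subspace, of "\<psi> X" c] smult_closed
  by (simp add: T_span_iff \<psi>_smult)

lemma T_span_zero: "\<zero>\<^bsub>TP\<^esub> \<in> T_span n d e B\<^sub>\<aa> B\<^sub>\<cc> B\<^sub>1"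
  using fm.subspace_0[OF admissible_subspace] abelian_monoid.zero_closed[OF TP_abelian_monoid]
  by (simp add: T_span_iff \<psi>_zero)

section \<open>The subalgebra conditions inside the invariants\<close>

abbreviation SA :: "('k, ('a mat list \<Rightarrow>\<^sub>0 'k) set) module" where
  "SA \<equiv> schur_algebra n d e"

lemma T_span_subset: "T_span n d e B\<^sub>\<aa> B\<^sub>\<cc> B\<^sub>1 \<subseteq> carrier SA"
  using act_invariant by (auto simp: schur_algebra_def T_span_iff admissible_def)

lemma SA_simps:
  "X \<otimes>\<^bsub>SA\<^esub> Y = X \<otimes>\<^bsub>TP\<^esub> Y" "\<one>\<^bsub>SA\<^esub> = \<one>\<^bsub>TP\<^esub>"
  "X \<oplus>\<^bsub>SA\<^esub> Y = X \<oplus>\<^bsub>TP\<^esub> Y" "\<zero>\<^bsub>SA\<^esub> = \<zero>\<^bsub>TP\<^esub>" "c \<odot>\<^bsub>SA\<^esub> X = c \<odot>\<^bsub>TP\<^esub> X"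
  by (simp_all add: schur_algebra_def)

lemma SA_carrier: "carrier SA \<subseteq> carrier TP"
  by (auto simp: schur_algebra_def)

text \<open>The inverse in \<open>add_monoid SA\<close> is a definite description. The multiple by
  -1 is an inverse, and its uniqueness follows because coordinates are additive and determine the
  tensor.\<close>

lemma T_span_a_inv:
  assumes X: "X \<in> T_span n d e B\<^sub>\<aa> B\<^sub>\<cc> B\<^sub>1"
  shows "inv\<^bsub>add_monoid SA\<^esub> X \<in> T_span n d e B\<^sub>\<aa> B\<^sub>\<cc> B\<^sub>1"
proof -
  let ?N = "(-1) \<odot>\<^bsub>TP\<^esub> X"
  have N: "?N \<in> T_span n d e B\<^sub>\<aa> B\<^sub>\<cc> B\<^sub>1" by (rule T_span_smult[OF X])
  have Xc: "X \<in> carrier TP" and Nc: "?N \<in> carrier TP" using X N by (auto simp: T_span_iff)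
  have \<psi>N: "\<psi> ?N = - \<psi> X" using \<psi>_smult[OF Xc] by (simp add: fun_eq_iff)
  interpret TP: abelian_monoid TP by (rule TP_abelian_monoid)
  have XN: "X \<oplus>\<^bsub>TP\<^esub> ?N = \<zero>\<^bsub>TP\<^esub>"
    by (rule \<psi>_inj) (simp_all add: Xc Nc \<psi>_add \<psi>_zero \<psi>N)
  have "inv\<^bsub>add_monoid SA\<^esub> X = ?N"
    unfolding m_inv_def
  proof (rule the_equality)
    show "?N \<in> carrier (add_monoid SA) \<and> X \<otimes>\<^bsub>add_monoid SA\<^esub> ?N = \<one>\<^bsub>add_monoid SA\<^esub> \<and>
        ?N \<otimes>\<^bsub>add_monoid SA\<^esub> X = \<one>\<^bsub>add_monoid SA\<^esub>"
      using N T_span_subset XN TP.a_comm[OF Xc Nc] by (auto simp: SA_simps)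
    fix Y assume Y: "Y \<in> carrier (add_monoid SA) \<and> X \<otimes>\<^bsub>add_monoid SA\<^esub> Y = \<one>\<^bsub>add_monoid SA\<^esub> \<and>
        Y \<otimes>\<^bsub>add_monoid SA\<^esub> X = \<one>\<^bsub>add_monoid SA\<^esub>"
    then have Yc: "Y \<in> carrier TP" and XY: "X \<oplus>\<^bsub>TP\<^esub> Y = \<zero>\<^bsub>TP\<^esub>"
      using SA_carrier by (auto simp: SA_simps)
    have "\<psi> X + \<psi> Y = 0" using \<psi>_add[OF Xc Yc] XY \<psi>_zero by simp
    then have "\<psi> Y = \<psi> ?N" unfolding \<psi>N by (simp add: eq_neg_iff_add_eq_0 add.commute)
    then show "Y = ?N" by (rule \<psi>_inj[OF Yc Nc])
  qed
  then show ?thesis using N by simp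
qed

lemma unital_subalgebra_T_span: "unital_subalgebra (T_span n d e B\<^sub>\<aa> B\<^sub>\<cc> B\<^sub>1) SA"
  unfolding unital_subalgebra_def
proof (intro conjI allI ballI subring.intro)
  show "subgroup (T_span n d e B\<^sub>\<aa> B\<^sub>\<cc> B\<^sub>1) (add_monoid SA)"
  proof
    show "inv\<^bsub>add_monoid SA\<^esub> X \<in> T_span n d e B\<^sub>\<aa> B\<^sub>\<cc> B\<^sub>1" if "X \<in> T_span n d e B\<^sub>\<aa> B\<^sub>\<cc> B\<^sub>1" for X
      using that by (rule T_span_a_inv)
  qed (use T_span_subset T_span_add T_span_zero in \<open>auto simp: SA_simps\<close>)
  show "submonoid (T_span n d e B\<^sub>\<aa> B\<^sub>\<cc> B\<^sub>1) SA"
    by standard (use T_span_subset T_span_mult T_span_one in \<open>auto simp: SA_simps\<close>)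
qed (simp add: SA_simps T_span_smult)

end

theorem theorem1:
  fixes scale :: "'k::{idom,ring_char_0} \<Rightarrow> 'a::ring \<Rightarrow> 'a"
    and A0 A1 \<aa> \<cc> B\<^sub>\<aa> B\<^sub>\<cc> B\<^sub>1 :: "'a set"
    and e :: 'a
    and n d :: nat
  assumes "unital_good_pair scale A0 A1 \<aa> e"
    and "good_pair_basis scale A0 A1 \<aa> \<cc> B\<^sub>\<aa> B\<^sub>\<cc> B\<^sub>1"
    and "n \<ge> 1"
  shows "unital_subalgebra (superalgebra.T_span scale A0 A1 n d e B\<^sub>\<aa> B\<^sub>\<cc> B\<^sub>1)
           (superalgebra.schur_algebra scale A0 A1 n d e)"
proof -
  interpret schur_setup scale A0 A1 \<aa> \<cc> B\<^sub>\<aa> B\<^sub>\<cc> B\<^sub>1 e n d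
    using assms(1,2) by (rule schur_setup.intro)
  show ?thesis by (rule unital_subalgebra_T_span)
qed

end
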